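(* Suppose each $f_i:\mathbb{R}^d\to\mathbb{R}$ ($i\in[n]$) is convex and $L$-smooth, let $0<\alpha\le \frac{2}{L}$ and $\theta\in(0,1)$. Let $(x^t)_{t\ge 0}$ be generated by Prox-DFinito with step-size $\alpha$, damping parameter $\theta$, initialization $\boldsymbol{z}^0\in\mathbb{R}^{nd}$, and random reshuffling. Then for every $k=0,1,2,\dots$ $$\mathbb{E}\,\min_{g\in\partial r(x^{kn})}\|\nabla F(x^{kn})+g\|^2\le \frac{C L^2}{(k+1)\theta(1-\theta)},\qquad C=\Big(\frac{5}{3\alpha L}\Big)^2\frac{1}{n}\|\boldsymbol{z}^0-\boldsymbol{z}^\star\|^2 .$$
   Context: Problem: $\min_{x\in\mathbb{R}^d}F(x)+r(x)$ with $F=\frac1n\sum_{i=1}^n f_i$, each $f_i$ differentiable and convex, and $r:\mathbb{R}^d\to\mathbb{R}\cup\{+\infty\}$ convex, closed and proper (not necessarily differentiable), with subdifferential $\partial r$. $[n]=\{1,\dots,n\}$; $L>0$, and $L$-smooth means the gradient is $L$-Lipschitz. $\mathrm{prox}_{\alpha r}(x)=\arg\min_{y}\{\alpha r(y)+\frac12\|y-x\|^2\}$. $\|\cdot\|$ is the Euclidean norm. A minimizer $x^\star$ of $F+r$ is assumed to exist, and $\boldsymbol{z}^\star=\mathrm{col}\{z_1^\star,\dots,z_n^\star\}\in\mathbb{R}^{nd}$ (stacked vector) with $z_i^\star=x^\star-\alpha\nabla f_i(x^\star)$. Prox-DFinito: given (deterministic) $\boldsymbol{z}^0=\mathrm{col}\{z_1^0,\dots,z_n^0\}$,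 set $\bar z^0=\frac1n\sum_i z_i^0$. For each epoch $k=0,1,2,\dots$: for $t=kn+1,\dots,(k+1)n$, set $x^{t-1}=\mathrm{prox}_{\alpha r}(\bar z^{t-1})$, pick an index $i_t$, set $z_{i_t}^t=x^{t-1}-\alpha\nabla f_{i_t}(x^{t-1})$, $z_i^t=z_i^{t-1}$ for $i\ne i_t$, and $\bar z^t=\bar z^{t-1}+(z_{i_t}^t-z_{i_t}^{t-1})/n$. At the end of the epoch apply the damping step: overwrite $z_i^{(k+1)n}\leftarrow(1-\theta)z_i^{kn}+\theta z_i^{(k+1)n}$ for all $i$ and $\bar z^{(k+1)n}\leftarrow(1-\theta)\bar z^{kn}+\theta\bar z^{(k+1)n}$. Thus $x^{kn}=\mathrm{prox}_{\alpha r}(\bar z^{kn})$ with the damped $\bar z^{kn}$. Random reshuffling: at the start of each epoch $k$ a fresh (independent) uniformly random permutation $\tau_k$ of $[n]$ is drawn, and $i_{kn+j}=\tau_k(j)$ for $j\in[n]$. Expectation is over all the permutations. *)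

theory Defs
  imports "HOL-Analysis.Analysis" "HOL-Probability.Probability"
begin

definition grad :: "('a::euclidean_space \<Rightarrow> real) \<Rightarrow> 'a \<Rightarrow> 'a" where
  "grad f x = (THE D. GDERIV f x :> D)"

definition smooth_fun :: "real \<Rightarrow> ('a::euclidean_space \<Rightarrow> real) \<Rightarrow> bool" where
  "smooth_fun L f \<longleftrightarrow> (\<forall>x. f differentiable (at x)) \<and> L-lipschitz_on UNIV (grad f)"

text \<open>Extended-valued functions: real epigraph heights only, so that the epigraph lives in a
  Euclidean space; closedness of the epigraph is lower semicontinuity.\<close>

definition epi :: "('a::euclidean_space \<Rightarrow> ereal) \<Rightarrow> ('a \<times> real) set" where
  "epi r = {(x, t). r x \<le> ereal t}"

definition closed_convex_proper :: "('a::euclidean_space \<Rightarrow> ereal) \<Rightarrow> bool" where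
  "closed_convex_proper r \<longleftrightarrow>
     closed (epi r) \<and> convex (epi r) \<and> (\<forall>x. r x \<noteq> -\<infinity>) \<and> (\<exists>x. r x \<noteq> \<infinity>)"

text \<open>For proper \<open>r\<close> this is empty wherever \<open>r x = \<infinity>\<close>.\<close>

definition subdiff :: "('a::euclidean_space \<Rightarrow> ereal) \<Rightarrow> 'a \<Rightarrow> 'a set" where
  "subdiff r x = {g. \<forall>y. r x + ereal (g \<bullet> (y - x)) \<le> r y}"

definition prox :: "real \<Rightarrow> ('a::euclidean_space \<Rightarrow> ereal) \<Rightarrow> 'a \<Rightarrow> 'a" where
  "prox \<alpha> r x = arg_min (\<lambda>y. ereal \<alpha> * r y + ereal ((norm (y - x))\<^sup>2 / 2)) (\<lambda>_. True)"

definition avg_fun :: "nat \<Rightarrow> (nat \<Rightarrow> 'a \<Rightarrow> real) \<Rightarrow> 'a \<Rightarrow> real" where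
  "avg_fun n f x = (\<Sum>i=1..n. f i x) / real n"

text \<open>The state of the algorithm is the pair of the table \<open>z\<close>, of which only the entries
  \<open>z 1, \<dots>, z n\<close> matter, and the running average \<open>zb\<close>.\<close>

definition dfinito_step ::
  "nat \<Rightarrow> real \<Rightarrow> ('a::euclidean_space \<Rightarrow> ereal) \<Rightarrow> (nat \<Rightarrow> 'a \<Rightarrow> real) \<Rightarrow> nat \<Rightarrow>
   (nat \<Rightarrow> 'a) \<times> 'a \<Rightarrow> (nat \<Rightarrow> 'a) \<times> 'a" where
  "dfinito_step n \<alpha> r f i = (\<lambda>(z, zb).
     let x = prox \<alpha> r zb;
         zi = x - \<alpha> *\<^sub>R grad (f i) x
     in (z(i := zi), zb + (zi - z i) /\<^sub>R real n))"

text \<open>The first \<open>j\<close> undamped updates of an epoch that visits the indices in the order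
  \<open>p 1, \<dots>, p n\<close>.\<close>

primrec dfinito_inner ::
  "nat \<Rightarrow> real \<Rightarrow> ('a::euclidean_space \<Rightarrow> ereal) \<Rightarrow> (nat \<Rightarrow> 'a \<Rightarrow> real) \<Rightarrow> (nat \<Rightarrow> nat) \<Rightarrow>
   (nat \<Rightarrow> 'a) \<times> 'a \<Rightarrow> nat \<Rightarrow> (nat \<Rightarrow> 'a) \<times> 'a" where
  "dfinito_inner n \<alpha> r f p s 0 = s"
| "dfinito_inner n \<alpha> r f p s (Suc j) =
     dfinito_step n \<alpha> r f (p (Suc j)) (dfinito_inner n \<alpha> r f p s j)"

definition damp ::
  "real \<Rightarrow> (nat \<Rightarrow> 'a::real_vector) \<times> 'a \<Rightarrow> (nat \<Rightarrow> 'a) \<times> 'a \<Rightarrow> (nat \<Rightarrow> 'a) \<times> 'a" where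
  "damp \<theta> s s' =
     ((\<lambda>i. (1 - \<theta>) *\<^sub>R fst s i + \<theta> *\<^sub>R fst s' i), (1 - \<theta>) *\<^sub>R snd s + \<theta> *\<^sub>R snd s')"

text \<open>State at the start of epoch \<open>k\<close>, after the damping step of epoch \<open>k - 1\<close>;
  \<open>\<tau> k\<close> is the order of visits in epoch \<open>k\<close>.\<close>

primrec dfinito_epoch ::
  "nat \<Rightarrow> real \<Rightarrow> real \<Rightarrow> ('a::euclidean_space \<Rightarrow> ereal) \<Rightarrow> (nat \<Rightarrow> 'a \<Rightarrow> real) \<Rightarrow>
   (nat \<Rightarrow> 'a) \<Rightarrow> (nat \<Rightarrow> nat \<Rightarrow> nat) \<Rightarrow> nat \<Rightarrow> (nat \<Rightarrow> 'a) \<times> 'a" where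
  "dfinito_epoch n \<alpha> \<theta> r f z0 \<tau> 0 = (z0, (\<Sum>i=1..n. z0 i) /\<^sub>R real n)"
| "dfinito_epoch n \<alpha> \<theta> r f z0 \<tau> (Suc k) =
     (let s = dfinito_epoch n \<alpha> \<theta> r f z0 \<tau> k
      in damp \<theta> s (dfinito_inner n \<alpha> r f (\<tau> k) s n))"

definition prox_dfinito ::
  "nat \<Rightarrow> real \<Rightarrow> real \<Rightarrow> ('a::euclidean_space \<Rightarrow> ereal) \<Rightarrow> (nat \<Rightarrow> 'a \<Rightarrow> real) \<Rightarrow>
   (nat \<Rightarrow> 'a) \<Rightarrow> (nat \<Rightarrow> nat \<Rightarrow> nat) \<Rightarrow> nat \<Rightarrow> 'a" where
  "prox_dfinito n \<alpha> \<theta> r f z0 \<tau> t =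
     prox \<alpha> r (snd (dfinito_inner n \<alpha> r f (\<tau> (t div n))
       (dfinito_epoch n \<alpha> \<theta> r f z0 \<tau> (t div n)) (t mod n)))"

text \<open>Independent uniformly random permutations of \<open>{1..n}\<close>, one for each epoch. With the codomain
  \<open>count_space {p. p permutes {1..n}}\<close> measurability forces every value to be a permutation.\<close>

definition random_reshuffling ::
  "'w measure \<Rightarrow> nat \<Rightarrow> (nat \<Rightarrow> 'w \<Rightarrow> nat \<Rightarrow> nat) \<Rightarrow> bool" where
  "random_reshuffling M n \<tau> \<longleftrightarrow> prob_space M \<and>
     prob_space.indep_vars M (\<lambda>_. count_space {p. p permutes {1..n}}) \<tau> UNIV \<and>
     (\<forall>k. distr M (count_space {p. p permutes {1..n}}) (\<tau> k) =
            uniform_count_measure {p. p permutes {1..n}})"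

end

theory Submission
  imports Defs
begin

text \<open>
  Let \<open>V\<close> be the squared distance of the table to \<open>zstar\<close>, \<open>J\<close> the sum of the squares of the residuals
  \<open>z i - (x - \<alpha> \<nabla>f i x)\<close>, \<open>gap\<close> the suboptimality of \<open>x\<close> times \<open>n \<alpha>\<close> and \<open>\<Phi>\<close> the sum of the
  squared increments of the table entries during an epoch. The squared norm to be bounded is at most
  \<open>J / (n \<alpha>\<^sup>2)\<close>, and \<open>J \<le> 4 V\<close>.

  For \<^emph>\<open>every\<close> visiting order the function \<open>\<psi> = gap + b J\<close> decreases by at least \<open>m \<theta> (1 - \<theta>) \<Phi>\<close> for suitable
  constants \<open>b\<close> and \<open>m\<close>. Summing the
  inequalities of smooth convexity and of the proximal map over the epoch reduces this to a quadratic
  inequality for a discrete path, which a Wirtinger inequality turns into finitely many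
  definite matrices.

  Averaged over a uniformly random order, \<open>V\<close> decreases by \<open>\<theta> (1 - \<theta>) \<Phi>\<close> plus \<open>\<theta>\<close> times a loss made
  of the variance of the table and of cocoercivity defects, while \<open>\<psi>\<close> is at most a constant times \<open>\<Phi>\<close> plus a
  constant times the loss. Hence \<open>V + \<theta> (1 - \<theta>) C k \<psi>\<close> is a supermartingale for weights \<open>C k\<close>
  that eventually grow linearly in \<open>k\<close>, and comparing it with \<open>J\<close> gives the rate.
\<close>

section \<open>Smooth convex functions\<close>

text \<open>\<open>V\<close> alone would bound only the average of \<open>J\<close> over the epochs;
  a bound at the last epoch needs a second quantity that never increases. For n = 1 this is
  \<open>J\<close> itself. For n >= 2 every table entry is formed at its own point, and monotonicity
  is obtained only after adding \<open>gap\<close>. The price: up to losses, \<open>\<psi>\<close>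
  is bounded by (0.785 + 2.367 b) \<open>\<Phi>\<close>, so mere monotonicity would let b
  \<open>C k\<close> grow with slope b / (0.785 + 2.367 b) only. For the values b = 11/10 and b =
  1/2 in use this is below 36/100, the slope that the factor 5/3 of the claim demands. Hence the
  descent of \<open>\<psi>\<close> has to be quantified by \<open>m\<close>: it feeds the growth of
  \<open>C\<close> until the slope is reached, and the slack of \<open>J \<le> 4 V\<close> at k = 0
  covers the transient. Randomness matters only for \<open>V\<close>: a uniform order makes the
  entry replaced at any given time cost V / n in the mean, so that the growth of the energy within
  an epoch is compensated.\<close>

lemma grad_GDERIV:
  fixes f :: "'a::euclidean_space \<Rightarrow> real"
  assumes "f differentiable (at x)"
  shows "GDERIV f x :> grad f x"
proof -
  from assms obtain f' where f': "(f has_derivative f') (at x)"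
    by (auto simp: differentiable_def)
  interpret f': bounded_linear f' using f' by (rule has_derivative_bounded_linear)
  define D where "D = (\<Sum>b\<in>Basis. f' b *\<^sub>R b)"
  have "f' h = h \<bullet> D" for h
  proof -
    have "f' h = f' (\<Sum>b\<in>Basis. (h \<bullet> b) *\<^sub>R b)" by (simp add: euclidean_representation)
    also have "\<dots> = h \<bullet> D"
      unfolding D_def f'.sum inner_sum_right by (simp add: f'.scaleR mult.commute)
    finally show ?thesis .
  qed
  then have "f' = (\<lambda>h. h \<bullet> D)" by auto
  with f' have D: "GDERIV f x :> D" by (simp add: gderiv_def)
  show ?thesis unfolding grad_def
  proof (rule theI[where a = D])
    fix E assume E: "GDERIV f x :> E"
    have "(\<lambda>h. h \<bullet> E) = (\<lambda>h. h \<bullet> D)"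
      using D E unfolding gderiv_def by (rule has_derivative_unique[rotated])
    then have "h \<bullet> E = h \<bullet> D" for h by meson
    then show "E = D" by (metis inner_commute vector_eq_ldot)
  qed (rule D)
qed

lemma grad_eqI: "GDERIV f x :> D \<Longrightarrow> grad f x = D" for f :: "'a::euclidean_space \<Rightarrow> real"
  using grad_GDERIV[of f x]
  by (metis differentiable_def gderiv_def has_derivative_unique inner_commute vector_eq_ldot)

lemma line_DERIV:
  fixes f :: "'a::euclidean_space \<Rightarrow> real"
  assumes "\<And>x. GDERIV f x :> D x"
  shows "((\<lambda>t. f (x + t *\<^sub>R h)) has_real_derivative h \<bullet> D (x + t *\<^sub>R h)) (at t)"
proof -
  have g: "((\<lambda>t. x + t *\<^sub>R h) has_derivative (\<lambda>t. t *\<^sub>R h)) (at t)"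
    by (auto intro!: derivative_eq_intros)
  have "((\<lambda>t. f (x + t *\<^sub>R h)) has_derivative (\<lambda>u. (u *\<^sub>R h) \<bullet> D (x + t *\<^sub>R h))) (at t)"
    using has_derivative_compose[OF g, of f] assms[of "x + t *\<^sub>R h"] unfolding gderiv_def by blast
  then show ?thesis
    by (simp add: has_field_derivative_def mult.commute[of _ "h \<bullet> _"])
qed

lemma convex_above_tangent:
  fixes f :: "'a::euclidean_space \<Rightarrow> real"
  assumes "convex_on UNIV f" and D: "\<And>x. GDERIV f x :> D x"
  shows "f y \<ge> f x + D x \<bullet> (y - x)"
proof -
  define \<phi> where "\<phi> t = f (x + t *\<^sub>R (y - x))" for t
  have "convex_on UNIV \<phi>"
  proof (rule convex_onI)
    fix t u v :: real assume t: "0 < t" "t < 1"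
    have eq: "x + ((1 - t) *\<^sub>R u + t *\<^sub>R v) *\<^sub>R (y - x) =
      (1 - t) *\<^sub>R (x + u *\<^sub>R (y - x)) + t *\<^sub>R (x + v *\<^sub>R (y - x))"
      by (simp add: algebra_simps)
    show "\<phi> ((1 - t) *\<^sub>R u + t *\<^sub>R v) \<le> (1 - t) * \<phi> u + t * \<phi> v"
      unfolding \<phi>_def eq using t by (intro convex_onD[OF assms(1)]) auto
  qed auto
  then have "\<phi> 1 - \<phi> 0 \<ge> ((y - x) \<bullet> D x) * (1 - 0)"
    by (rule convex_on_imp_above_tangent[where A = UNIV])
      (use line_DERIV[OF D, where t = 0 and x = x and h = "y - x"] in \<open>auto simp: \<phi>_def[abs_def]\<close>)
  then show ?thesis by (simp add: \<phi>_def inner_commute)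
qed

lemma descent_lemma:
  fixes f :: "'a::euclidean_space \<Rightarrow> real"
  assumes D: "\<And>x. GDERIV f x :> D x" and L: "L-lipschitz_on UNIV D"
  shows "f y \<le> f x + D x \<bullet> (y - x) + L / 2 * (norm (y - x))\<^sup>2"
proof -
  define h where "h = y - x"
  define \<phi> where "\<phi> t = f (x + t *\<^sub>R h) - t * (h \<bullet> D x) - L / 2 * t\<^sup>2 * (norm h)\<^sup>2" for t
  have der: "(\<phi> has_real_derivative (h \<bullet> D (x + t *\<^sub>R h) - h \<bullet> D x - L * t * (norm h)\<^sup>2)) (at t)" for t
    unfolding \<phi>_def[abs_def]
    by (rule derivative_eq_intros line_DERIV[OF D] refl | simp)+
  have "h \<bullet> D (x + t *\<^sub>R h) - h \<bullet> D x - L * t * (norm h)\<^sup>2 \<le> 0" if "0 \<le> t" for t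
  proof -
    have "h \<bullet> (D (x + t *\<^sub>R h) - D x) \<le> norm h * norm (D (x + t *\<^sub>R h) - D x)"
      by (rule norm_cauchy_schwarz)
    also have "\<dots> \<le> norm h * (L * (t * norm h))"
      using lipschitz_onD[OF L, of "x + t *\<^sub>R h" x] that
      by (intro mult_left_mono) (auto simp: dist_norm)
    finally show ?thesis by (simp add: inner_diff_right power2_eq_square algebra_simps)
  qed
  then have "\<phi> 1 \<le> \<phi> 0"
    by (intro DERIV_nonpos_imp_nonincreasing[of 0 1 \<phi>]) (use der in \<open>fastforce+\<close>)
  then show ?thesis by (simp add: \<phi>_def h_def inner_commute)
qed

text \<open>Evaluate at \<open>w\<close>, the gradient step of length 1/L from y for the function f
  minus its tangent at x. The tangent at x bounds \<open>f w\<close> from below, the descent lemma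
  at y bounds it from above, and the square is what remains.\<close>

lemma cocoercive:
  fixes f :: "'a::euclidean_space \<Rightarrow> real"
  assumes cv: "convex_on UNIV f" and D: "\<And>x. GDERIV f x :> D x"
    and L: "L-lipschitz_on UNIV D" and "L > 0"
  shows "f y \<ge> f x + D x \<bullet> (y - x) + (norm (D y - D x))\<^sup>2 / (2 * L)"
proof -
  define w where "w = y - (1 / L) *\<^sub>R (D y - D x)"
  have "f x + D x \<bullet> (w - x) \<le> f w" by (rule convex_above_tangent[OF cv D])
  also have "f w \<le> f y + D y \<bullet> (w - y) + L / 2 * (norm (w - y))\<^sup>2"
    by (rule descent_lemma[OF D L])
  finally have "f x + D x \<bullet> (y - x) \<le> f y + (D y - D x) \<bullet> (w - y) + L / 2 * (norm (w - y))\<^sup>2"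
    by (simp add: inner_diff_left inner_diff_right)
  moreover have "(D y - D x) \<bullet> (w - y) = - ((norm (D y - D x))\<^sup>2 / L)"
    by (simp add: w_def power2_norm_eq_inner)
  moreover have "L / 2 * (norm (w - y))\<^sup>2 = (norm (D y - D x))\<^sup>2 / (2 * L)"
  proof -
    have "norm (w - y) = norm (D y - D x) / L"
      using \<open>L > 0\<close> by (simp add: w_def del: scaleR_diff_right)
    then show ?thesis using \<open>L > 0\<close> by (simp add: power_divide power2_eq_square)
  qed
  moreover have "(norm (D y - D x))\<^sup>2 / L = (norm (D y - D x))\<^sup>2 / (2 * L) + (norm (D y - D x))\<^sup>2 / (2 * L)"
    using \<open>L > 0\<close> by (simp add: field_simps)
  ultimately show ?thesis by linarith
qed

section \<open>Quadratic forms along a path\<close>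

lemma sum_nat_real: "(\<Sum>l<n. real l) = real n * (real n - 1) / 2"
  by (induction n) (auto simp: field_simps)
lemma sum_nat_real2: "(\<Sum>l<n. (real l)^2) = real n * (real n - 1) * (2 * real n - 1) / 6"
  by (induction n) (auto simp: field_simps power2_eq_square)
lemma sum_nat_real3: "(\<Sum>l<n. (real l)^3) = (real n * (real n - 1) / 2)^2"
  by (induction n) (auto simp: field_simps power2_eq_square power3_eq_cube)
lemma sum_nat_real4: "(\<Sum>l<n. (real l)^4) = real n * (real n - 1) * (2 * real n - 1) * (3 * (real n)^2 - 3 * real n - 1) / 30"
  by (induction n) (auto simp: field_simps power2_eq_square power3_eq_cube power4_eq_xxxx)

text \<open>The weights \<open>s j = j * (n - j)\<close> play the role of the ground
  state, which costs a little in the constant compared with the sine.\<close>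

lemma wirtinger:
  fixes \<beta> :: "nat \<Rightarrow> 'a::real_inner"
  assumes "\<beta> 0 = 0" "\<beta> n = 0"
  shows "8 * (\<Sum>j<n. \<beta> j \<bullet> \<beta> j) \<le>
    (real n)\<^sup>2 * (\<Sum>j<n. (\<beta> (Suc j) - \<beta> j) \<bullet> (\<beta> (Suc j) - \<beta> j))"
proof (cases "n \<le> 1")
  case True
  then consider "n = 0" | "n = 1" by linarith
  then show ?thesis using assms by cases auto
next
  case False
  define \<delta> where "\<delta> j = (\<beta> (Suc j) - \<beta> j) \<bullet> (\<beta> (Suc j) - \<beta> j)" for j
  define s where "s j = real j * (real n - real j)" for j
  have spos: "s j > 0" if "1 \<le> j" "j < n" for j using that by (auto simp: s_def)
  have s2: "s (Suc j) = 2 * s j - s (j - 1) - 2" if "1 \<le> j" for j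
    using that by (cases j) (auto simp: s_def algebra_simps)
  \<comment> \<open>A discrete Picone inequality, from the square of
    \<open>p *\<^sub>R b - q *\<^sub>R a\<close>. With consecutive values of \<open>s\<close> for p
    and q, the energy becomes a telescoping boundary term plus a potential; as the second difference
    of \<open>s\<close> is -2, the potential is \<open>2 / s j\<close>.\<close>
  have key: "(b - a) \<bullet> (b - a) \<ge> (b \<bullet> b) * (1 - p / q) + (a \<bullet> a) * (1 - q / p)"
    if "p > 0" "q > 0" for a b :: 'a and p q :: real
  proof -
    have "0 \<le> (p *\<^sub>R b - q *\<^sub>R a) \<bullet> (p *\<^sub>R b - q *\<^sub>R a)" by simp
    also have "\<dots> = p * p * (b \<bullet> b) - 2 * p * q * (a \<bullet> b) + q * q * (a \<bullet> a)"
      by (simp add: inner_diff inner_commute algebra_simps)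
    finally have "2 * (a \<bullet> b) \<le> (p * p * (b \<bullet> b) + q * q * (a \<bullet> a)) / (p * q)"
      using that by (simp add: field_simps)
    also have "\<dots> = p / q * (b \<bullet> b) + q / p * (a \<bullet> a)"
      using that by (simp add: field_simps)
    finally have "2 * (a \<bullet> b) \<le> p / q * (b \<bullet> b) + q / p * (a \<bullet> a)" .
    then show ?thesis by (simp add: inner_diff inner_commute algebra_simps)
  qed
  have part: "(\<Sum>j<m. \<delta> j) \<ge>
      (\<Sum>j=1..<m. 2 / s j * (\<beta> j \<bullet> \<beta> j)) + (\<beta> m \<bullet> \<beta> m) * (1 - s (m - 1) / s m)"
    if "1 \<le> m" "m < n" for m
    using that
  proof (induction m rule: dec_induct)
    case base
    then show ?case by (simp add: assms s_def \<delta>_def)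
  next
    case (step m)
    have sp: "s m > 0" "s (Suc m) > 0" using step spos by auto
    have "\<delta> m \<ge> (\<beta> (Suc m) \<bullet> \<beta> (Suc m)) * (1 - s m / s (Suc m))
        + (\<beta> m \<bullet> \<beta> m) * (1 - s (Suc m) / s m)"
      unfolding \<delta>_def by (rule key[OF sp])
    moreover have "(1 - s (m - 1) / s m) + (1 - s (Suc m) / s m) = (2 * s m - s (m - 1) - s (Suc m)) / s m"
      using sp by (simp add: field_simps)
    then have "2 / s m = (1 - s (m - 1) / s m) + (1 - s (Suc m) / s m)"
      using s2[of m] step(1) by simp
    then have "2 / s m * (\<beta> m \<bullet> \<beta> m) = (\<beta> m \<bullet> \<beta> m) * (1 - s (m - 1) / s m)
        + (\<beta> m \<bullet> \<beta> m) * (1 - s (Suc m) / s m)"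
      by (simp add: distrib_left[symmetric] mult.commute)
    moreover have "(\<Sum>j<m. \<delta> j) \<ge>
      (\<Sum>j=1..<m. 2 / s j * (\<beta> j \<bullet> \<beta> j)) + (\<beta> m \<bullet> \<beta> m) * (1 - s (m - 1) / s m)"
      using step by simp
    ultimately show ?case using step(1) by simp
  qed
  obtain m where m: "n = Suc m" "1 \<le> m" using False by (cases n) auto
  have sm: "s m > 0" using m spos by auto
  have "2 / s m = (1 - s (m - 1) / s m) + 1"
    using sm s2[of m] m by (simp add: field_simps s_def)
  then have "2 / s m * (\<beta> m \<bullet> \<beta> m) = ((1 - s (m - 1) / s m) + 1) * (\<beta> m \<bullet> \<beta> m)"
    by (rule arg_cong)
  then have "2 / s m * (\<beta> m \<bullet> \<beta> m) = (\<beta> m \<bullet> \<beta> m) * (1 - s (m - 1) / s m)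
      + \<beta> m \<bullet> \<beta> m"
    by (simp add: algebra_simps)
  moreover have "\<delta> m = \<beta> m \<bullet> \<beta> m" using m assms by (simp add: \<delta>_def)
  ultimately have tot: "(\<Sum>j<n. \<delta> j) \<ge> (\<Sum>j=1..<n. 2 / s j * (\<beta> j \<bullet> \<beta> j))"
    using part[of m] m by simp
  have "{..<n} = insert 0 {1..<n}" using m by auto
  then have "(\<Sum>j<n. \<beta> j \<bullet> \<beta> j) = (\<Sum>j=1..<n. \<beta> j \<bullet> \<beta> j)"
    using assms by (metis (no_types, lifting) add_0 finite_atLeastLessThan inner_zero_left
        atLeastLessThan_iff not_one_le_zero sum.insert)
  then have "8 * (\<Sum>j<n. \<beta> j \<bullet> \<beta> j) = (real n)\<^sup>2 * (\<Sum>j=1..<n. 8 / (real n)\<^sup>2 * (\<beta> j \<bullet> \<beta> j))"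
  proof -
    have "(\<Sum>j=1..<n. 8 / (real n)\<^sup>2 * (\<beta> j \<bullet> \<beta> j))
        = 8 / (real n)\<^sup>2 * (\<Sum>j=1..<n. \<beta> j \<bullet> \<beta> j)"
      by (simp only: sum_distrib_left)
    with \<open>(\<Sum>j<n. \<beta> j \<bullet> \<beta> j) = (\<Sum>j=1..<n. \<beta> j \<bullet> \<beta> j)\<close> m show ?thesis by simp
  qed
  also have "\<dots> \<le> (real n)\<^sup>2 * (\<Sum>j=1..<n. 2 / s j * (\<beta> j \<bullet> \<beta> j))"
  proof (intro mult_left_mono sum_mono mult_right_mono)
    fix j assume j: "j \<in> {1..<n}"
    \<comment> \<open>The parabola \<open>s\<close> peaks at n^2/4; this is the origin of the
      constant 8.\<close>
    have "4 * s j \<le> (real n)\<^sup>2"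
      using zero_le_power2[of "real n - 2 * real j"] by (simp add: s_def power2_eq_square algebra_simps)
    then show "8 / (real n)\<^sup>2 \<le> 2 / s j" using j spos[of j] m by (simp add: field_simps del: of_nat_Suc)
  qed auto
  also have "\<dots> \<le> (real n)\<^sup>2 * (\<Sum>j<n. \<delta> j)"
    using tot by (intro mult_left_mono) auto
  finally show ?thesis by (simp add: \<delta>_def)
qed

lemma inner_le_weighted:
  "\<tau> > 0 \<Longrightarrow> x \<bullet> y \<le> \<tau> * (x \<bullet> x) + (y \<bullet> y) / (4 * \<tau>)" for x y :: "'a::real_inner"
proof -
  assume t: "\<tau> > 0"
  have "0 \<le> ((2 * \<tau>) *\<^sub>R x - y) \<bullet> ((2 * \<tau>) *\<^sub>R x - y)" by (rule inner_ge_zero)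
  also have "\<dots> = 4 * \<tau> * (\<tau> * (x \<bullet> x) + (y \<bullet> y) / (4 * \<tau>) - x \<bullet> y)"
    using t by (simp add: inner_diff inner_commute field_simps)
  finally show ?thesis using t by (simp add: zero_le_mult_iff)
qed

text \<open>Split the path into the straight line to \<open>q n\<close> and a bridge
  \<open>\<beta>\<close> that vanishes at both ends. The line contributes exact sums, the square of
  the bridge falls to \<open>wirtinger\<close>, and the cross terms are summed by parts against the
  increments \<open>\<eta>\<close> and split by Young's inequality with weight
  \<open>\<tau>\<close>. So all but the end point is charged to the fluctuation of the
  steps.\<close>

lemma path_bound:
  fixes h :: "nat \<Rightarrow> 'a::real_inner" and v :: 'a
  assumes n: "2 \<le> n" and A: "A \<ge> 0" and tau: "\<tau> > 0"
  defines "q j \<equiv> (\<Sum>l<j. h l) /\<^sub>R real n" and "u \<equiv> 1 / real n"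
  shows "(\<Sum>j<n. A * (q j \<bullet> q j) + q j \<bullet> v) \<le>
      real n * (A * (q n \<bullet> q n) * ((1 - u) * (2 - u) / 6) + q n \<bullet> v * ((1 - u) / 2))
      + (A / 8 + \<tau>) * ((\<Sum>j<n. h j \<bullet> h j) - real n * (q n \<bullet> q n))
      + real n / (4 * \<tau>) * ((A *\<^sub>R q n + v) \<bullet> (A *\<^sub>R q n + v) * (1 - u\<^sup>2) / 12
          + A\<^sup>2 * (q n \<bullet> q n) * (1 - 4 * u\<^sup>2) / 180)"
proof -
  define N where "N = real n"
  have N: "N \<ge> 2" using n by (simp add: N_def)
  have u: "u = 1 / N" by (simp add: u_def N_def)
  define g where "g = q n"
  define \<eta> where "\<eta> l = h l - g" for l
  define \<beta> where "\<beta> j = q j - (real j / N) *\<^sub>R g" for j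
  \<comment> \<open>Midpoints of n equal cells of the unit interval, recentred at 0 so that the odd
    moments vanish.\<close>
  define z where "z l = (real l + 1/2) / N - 1/2" for l
  define m2 where "m2 = (1 - u\<^sup>2) / 12"
  \<comment> \<open>A discrete primitive of the coefficient of \<open>\<beta> j\<close> in the cross
    terms. As the \<open>\<eta> l\<close> sum to zero, it may be shifted by a constant; subtracting
    \<open>m2\<close>, the mean of the squares of \<open>z\<close>, gives the centred primitive,
    whose sum of squares is smallest.\<close>
  define r where "r l = - (z l *\<^sub>R (A *\<^sub>R g + v) + (A * ((z l)\<^sup>2 - m2)) *\<^sub>R g)" for l
  have q0: "q 0 = 0" by (simp add: q_def)
  have qS: "q (Suc j) = q j + h j /\<^sub>R N" for j by (simp add: q_def N_def scaleR_right_distrib)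
  have b0: "\<beta> 0 = 0" "\<beta> n = 0" using n by (auto simp: \<beta>_def q0 g_def N_def)
  have bS: "\<beta> (Suc j) - \<beta> j = \<eta> j /\<^sub>R N" for j
    using N by (simp add: \<beta>_def qS \<eta>_def algebra_simps add_divide_distrib divide_inverse)
  have hsum: "(\<Sum>l<n. h l) = N *\<^sub>R g" using N by (simp add: g_def q_def N_def)
  have eta2: "(\<Sum>l<n. \<eta> l \<bullet> \<eta> l) = (\<Sum>j<n. h j \<bullet> h j) - N * (g \<bullet> g)"
  proof -
    have "(\<Sum>l<n. \<eta> l \<bullet> \<eta> l) = (\<Sum>l<n. h l \<bullet> h l - 2 * (h l \<bullet> g) + g \<bullet> g)"
      by (intro sum.cong) (auto simp: \<eta>_def inner_diff inner_commute)
    also have "\<dots> = (\<Sum>l<n. h l \<bullet> h l) - 2 * ((\<Sum>l<n. h l) \<bullet> g) + N * (g \<bullet> g)"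
      by (simp add: sum.distrib sum_subtractf sum_distrib_left inner_sum_left N_def)
    finally show ?thesis by (simp add: hsum)
  qed
  have w: "8 * (\<Sum>j<n. \<beta> j \<bullet> \<beta> j) \<le> (\<Sum>l<n. \<eta> l \<bullet> \<eta> l)"
  proof -
    have "8 * (\<Sum>j<n. \<beta> j \<bullet> \<beta> j) \<le> N\<^sup>2 * (\<Sum>j<n. (\<eta> j /\<^sub>R N) \<bullet> (\<eta> j /\<^sub>R N))"
      using wirtinger[OF b0] by (simp only: bS N_def)
    also have "\<dots> = (\<Sum>j<n. \<eta> j \<bullet> \<eta> j)"
      using N by (simp add: sum_distrib_left power2_eq_square field_simps)
    finally show ?thesis .
  qed
  define k where "k = 1 / (2 * N) - 1 / 2"
  define y where "y = 1 / N"
  have zk: "z l = real l * y + k" for l using N by (simp add: z_def k_def y_def field_simps)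
  have kN: "k = (1 - N) / (2 * N)" using N by (simp add: k_def field_simps)
  have z1: "(\<Sum>l<n. z l) = 0"
  proof -
    have "(\<Sum>l<n. z l) = (\<Sum>l<n. real l) * y + N * k"
      by (simp only: zk sum.distrib sum_distrib_right[symmetric] sum_constant card_lessThan N_def)
    also have "\<dots> = 0" using N by (simp add: sum_nat_real kN y_def N_def[symmetric] field_simps)
    finally show ?thesis .
  qed
  have z2: "(\<Sum>l<n. (z l)^2) = N * m2"
  proof -
    have e: "(z l)^2 = (real l)^2 * y^2 + real l * (2 * k * y) + k^2" for l
      unfolding zk by algebra
    have "(\<Sum>l<n. (z l)^2) = (\<Sum>l<n. (real l)^2) * y^2 + (\<Sum>l<n. real l) * (2 * k * y) + N * k^2"
      by (simp only: e sum.distrib sum_distrib_right[symmetric] sum_constant card_lessThan N_def)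
    also have "\<dots> = N * m2"
      using N by (simp add: sum_nat_real sum_nat_real2 kN m2_def u y_def N_def[symmetric] field_simps) algebra
    finally show ?thesis .
  qed
  have z3: "(\<Sum>l<n. (z l)^3) = 0"
  proof -
    have e: "(z l)^3 = (real l)^3 * y^3 + (real l)^2 * (3 * k * y^2) + real l * (3 * k^2 * y) + k^3" for l
      unfolding zk by algebra
    have "(\<Sum>l<n. (z l)^3) = (\<Sum>l<n. (real l)^3) * y^3 + (\<Sum>l<n. (real l)^2) * (3 * k * y^2)
        + (\<Sum>l<n. real l) * (3 * k^2 * y) + N * k^3"
      by (simp only: e sum.distrib sum_distrib_right[symmetric] sum_constant card_lessThan N_def)
    also have "\<dots> = 0"
      using N by (simp add: sum_nat_real sum_nat_real2 sum_nat_real3 kN y_def N_def[symmetric] field_simps) algebra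
    finally show ?thesis .
  qed
  have z4: "(\<Sum>l<n. (z l)^4) = N * (1 - u\<^sup>2) * (3 - 7 * u\<^sup>2) / 240"
  proof -
    have e: "(z l)^4 = (real l)^4 * y^4 + (real l)^3 * (4 * k * y^3) + (real l)^2 * (6 * k^2 * y^2)
        + real l * (4 * k^3 * y) + k^4" for l
      unfolding zk by algebra
    have "(\<Sum>l<n. (z l)^4) = (\<Sum>l<n. (real l)^4) * y^4 + (\<Sum>l<n. (real l)^3) * (4 * k * y^3)
        + (\<Sum>l<n. (real l)^2) * (6 * k^2 * y^2) + (\<Sum>l<n. real l) * (4 * k^3 * y) + N * k^4"
      by (simp only: e sum.distrib sum_distrib_right[symmetric] sum_constant card_lessThan N_def)
    also have "\<dots> = N * (1 - u\<^sup>2) * (3 - 7 * u\<^sup>2) / 240"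
      using N by (simp add: sum_nat_real sum_nat_real2 sum_nat_real3 sum_nat_real4 kN u y_def N_def[symmetric] field_simps) algebra
    finally show ?thesis .
  qed
  have u2: "u\<^sup>2 \<le> 1 / 4"
    using power_mono[of 2 N 2] N by (simp add: u power_divide field_simps)
  have v2: "(\<Sum>l<n. ((z l)\<^sup>2 - m2)\<^sup>2) \<le> N * (1 - 4 * u\<^sup>2) / 180"
  proof -
    have "(\<Sum>l<n. ((z l)\<^sup>2 - m2)\<^sup>2) = (\<Sum>l<n. (z l)^4) - 2 * m2 * (\<Sum>l<n. (z l)^2) + N * m2^2"
      by (simp add: power2_diff sum.distrib sum_subtractf sum_distrib_left power_mult[symmetric] N_def mult_ac)
    also have "\<dots> = N * ((1 - u\<^sup>2) * (1 - 4 * u\<^sup>2) / 180)"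
      by (simp add: z2 z4 m2_def field_simps) algebra
    also have "\<dots> \<le> N * ((1 - 4 * u\<^sup>2) / 180)"
      using N u2 by (intro mult_left_mono divide_right_mono) (auto intro: mult_left_le_one_le)
    finally show ?thesis by simp
  qed
  have rr: "(\<Sum>l<n. r l \<bullet> r l) \<le> N * ((A *\<^sub>R g + v) \<bullet> (A *\<^sub>R g + v) * (1 - u\<^sup>2) / 12
          + A\<^sup>2 * (g \<bullet> g) * (1 - 4 * u\<^sup>2) / 180)"
  proof -
    have "r l \<bullet> r l = (z l)^2 * ((A *\<^sub>R g + v) \<bullet> (A *\<^sub>R g + v)) + ((z l)^3
        - m2 * z l) * (2 * A * ((A *\<^sub>R g + v) \<bullet> g))
       + ((z l)\<^sup>2 - m2)\<^sup>2 * (A^2 * (g \<bullet> g))" for l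
      unfolding r_def
      by (simp add: inner_add_left[of "z l *\<^sub>R (A *\<^sub>R g + v)"] inner_add_right[of _ "z l *\<^sub>R (A *\<^sub>R g + v)"]
          inner_commute[of g "A *\<^sub>R g + v"] power2_eq_square power3_eq_cube del: scaleR_add_right)
        (simp add: algebra_simps inner_commute[of g v])
    then have "(\<Sum>l<n. r l \<bullet> r l) = (\<Sum>l<n. (z l)^2) * ((A *\<^sub>R g + v) \<bullet> (A *\<^sub>R g + v))
       + ((\<Sum>l<n. (z l)^3) - m2 * (\<Sum>l<n. z l)) * (2 * A * ((A *\<^sub>R g + v) \<bullet> g))
       + (\<Sum>l<n. ((z l)\<^sup>2 - m2)\<^sup>2) * (A^2 * (g \<bullet> g))"
      by (simp only: sum.distrib sum_distrib_right[symmetric] sum_subtractf sum_distrib_left[symmetric])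
    also have "\<dots> \<le> N * m2 * ((A *\<^sub>R g + v) \<bullet> (A *\<^sub>R g + v)) + N * (1
        - 4 * u\<^sup>2) / 180 * (A^2 * (g \<bullet> g))"
      unfolding z1 z2 z3 using mult_right_mono[OF v2, of "A^2 * (g \<bullet> g)"] by simp
    also have "\<And>X Y. N * m2 * X + N * (1 - 4 * u\<^sup>2) / 180 * (A^2 * Y) = N * (X * (1 - u\<^sup>2) / 12
        + A\<^sup>2 * Y * (1 - 4 * u\<^sup>2) / 180)"
      by (simp add: m2_def field_simps)
    finally show ?thesis .
  qed
  have qb: "q j = \<beta> j + (real j / N) *\<^sub>R g" for j by (simp add: \<beta>_def)
  define \<rho> where "\<rho> j = (2 * A * (real j / N)) *\<^sub>R g + v" for j
  have cross: "(\<Sum>j<n. \<beta> j \<bullet> \<rho> j) = (\<Sum>l<n. \<eta> l \<bullet> r l)"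
  proof -
    \<comment> \<open>Summation by parts up to m. For m = 0 the index m - 1 truncates to 0, which is
      harmless because \<open>\<beta> 0\<close> vanishes.\<close>
    have part: "(\<Sum>l<m. \<eta> l \<bullet> r l) = (\<Sum>j<m. \<beta> j \<bullet> \<rho> j)
        + N * (\<beta> m \<bullet> (r (m - 1)))" if "m \<le> n" for m
      using that
    proof (induction m)
      case 0
      then show ?case by (simp add: b0)
    next
      case (Suc m)
      have bs: "\<eta> m = N *\<^sub>R (\<beta> (Suc m) - \<beta> m)" using N by (simp add: bS)
      show ?case
      proof (cases m)
        case 0
        then show ?thesis using bs by (simp add: b0)
      next
        case (Suc i)
        have zi: "z m = z i + 1 / N" using N Suc by (simp add: z_def field_simps)
        have "r i - r m = (z m - z i) *\<^sub>R (A *\<^sub>R g + v) + (A * ((z m)\<^sup>2 - (z i)\<^sup>2)) *\<^sub>R g"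
          by (simp add: r_def algebra_simps)
        also have "(z m)\<^sup>2 - (z i)\<^sup>2 = (2 * real m / N - 1) / N"
          using N Suc by (simp add: z_def field_simps power2_eq_square)
        also have "z m - z i = 1 / N" by (simp add: zi)
        finally have "N *\<^sub>R (r i - r m) = (N * (1 / N)) *\<^sub>R (A *\<^sub>R g + v)
            + (N * (A * ((2 * real m / N - 1) / N))) *\<^sub>R g"
          by (simp only: scaleR_add_right scaleR_scaleR mult.assoc)
        also have "N * (1 / N) = 1" using N by simp
        also have "N * (A * ((2 * real m / N - 1) / N)) = A * (2 * real m / N - 1)"
          using N by simp
        finally have "N *\<^sub>R (r i - r m) = \<rho> m"
          by (simp add: \<rho>_def algebra_simps)
        then have "\<beta> m \<bullet> \<rho> m = N * (\<beta> m \<bullet> r i) - N * (\<beta> m \<bullet> r m)"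
          by (metis inner_diff_right inner_scaleR_right right_diff_distrib)
        moreover have "\<eta> m \<bullet> r m = N * (\<beta> (Suc m) \<bullet> r m) - N * (\<beta> m \<bullet> r m)"
          unfolding bs by (simp only: inner_scaleR_left inner_diff_left right_diff_distrib)
        moreover have "(\<Sum>l<m. \<eta> l \<bullet> r l) = (\<Sum>j<m. \<beta> j \<bullet> \<rho> j) + N * (\<beta> m \<bullet> r i)"
          using Suc.IH Suc.prems Suc by simp
        ultimately show ?thesis by simp
      qed
    qed
    show ?thesis using part[of n] by (simp add: b0)
  qed
  have "(\<Sum>j<n. A * (q j \<bullet> q j) + q j \<bullet> v) =
      A * (\<Sum>j<n. \<beta> j \<bullet> \<beta> j) + (\<Sum>j<n. \<beta> j \<bullet> \<rho> j)
      + (\<Sum>j<n. (real j)^2) * (A / N^2 * (g \<bullet> g)) + (\<Sum>j<n. real j) * (g \<bullet> v / N)"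
  proof -
    have "A * (q j \<bullet> q j) + q j \<bullet> v = A * (\<beta> j \<bullet> \<beta> j) + \<beta> j \<bullet> \<rho> j
      + (real j)^2 * (A / N^2 * (g \<bullet> g)) + real j * (g \<bullet> v / N)" for j
      using N by (simp add: qb \<rho>_def inner_add inner_commute power2_eq_square algebra_simps)
    then show ?thesis by (simp only: sum.distrib sum_distrib_left[symmetric] sum_distrib_right[symmetric])
  qed
  also have "(\<Sum>j<n. (real j)^2) * (A / N^2 * (g \<bullet> g)) = N * (A * (g \<bullet> g) * ((1 - u) * (2 - u) / 6))"
    using N by (simp add: sum_nat_real2 u N_def[symmetric] field_simps) algebra
  also have "(\<Sum>j<n. real j) * (g \<bullet> v / N) = N * (g \<bullet> v * ((1 - u) / 2))"
    using N by (simp add: sum_nat_real u N_def[symmetric] field_simps)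
  also have "(\<Sum>j<n. \<beta> j \<bullet> \<rho> j) \<le> \<tau> * (\<Sum>l<n. \<eta> l \<bullet> \<eta> l)
      + (\<Sum>l<n. r l \<bullet> r l) / (4 * \<tau>)"
    unfolding cross sum_distrib_left sum_divide_distrib sum.distrib[symmetric]
    by (intro sum_mono inner_le_weighted tau)
  also have "(\<Sum>l<n. r l \<bullet> r l) / (4 * \<tau>) \<le> N / (4 * \<tau>) * ((A *\<^sub>R g
      + v) \<bullet> (A *\<^sub>R g + v) * (1 - u\<^sup>2) / 12
          + A\<^sup>2 * (g \<bullet> g) * (1 - 4 * u\<^sup>2) / 180)"
    using divide_right_mono[OF rr, of "4 * \<tau>"] tau by simp
  also have "A * (\<Sum>j<n. \<beta> j \<bullet> \<beta> j) \<le> A / 8 * (\<Sum>l<n. \<eta> l \<bullet> \<eta> l)"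
    using mult_left_mono[OF w A] by simp
  finally show ?thesis unfolding eta2 g_def[symmetric] N_def[symmetric] by (simp add: algebra_simps)
qed
text \<open>The products \<open>q j \<bullet> h j\<close> telescope to the end point up to the
  squares of the steps, and the negative term with \<open>K\<close> absorbs what
  \<open>path_bound\<close> charges to the fluctuation. Only \<open>q n\<close> is left, so a path
  of any length is reduced to a form in finitely many vectors.\<close>

lemma path_form:
  fixes h :: "nat \<Rightarrow> 'a::real_inner" and v w :: 'a
  assumes n: "2 \<le> n" and A: "A \<ge> 0" and B: "B \<ge> 0" and tau: "\<tau> > 0" and K: "A / 8 + \<tau> \<le> K"
  defines "q j \<equiv> (\<Sum>l<j. h l) /\<^sub>R real n" and "u \<equiv> 1 / real n"
  shows "(\<Sum>j<n. A * (q j \<bullet> q j) + B * (q j \<bullet> h j) - K * (h j \<bullet> h j) + q j \<bullet> v + h j \<bullet> w) \<le>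
      real n * (A * (q n \<bullet> q n) * ((1 - u) * (2 - u) / 6) + q n \<bullet> v * ((1 - u) / 2)
        + B / 2 * (1 - u) * (q n \<bullet> q n) + q n \<bullet> w - K * (q n \<bullet> q n)
        + 1 / (4 * \<tau>) * ((A *\<^sub>R q n + v) \<bullet> (A *\<^sub>R q n + v) * (1 - u\<^sup>2) / 12
          + A\<^sup>2 * (q n \<bullet> q n) * (1 - 4 * u\<^sup>2) / 180))"
proof -
  define N where "N = real n"
  have N: "N \<ge> 2" using n by (simp add: N_def)
  define E where "E = (\<Sum>j<n. h j \<bullet> h j)"
  have hsum: "(\<Sum>l<n. h l) = N *\<^sub>R q n" using N by (simp add: q_def N_def)
  have "0 \<le> (\<Sum>j<n. (h j - q n) \<bullet> (h j - q n))" by (intro sum_nonneg) auto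
  also have "\<dots> = (\<Sum>l<n. h l \<bullet> h l - 2 * (h l \<bullet> q n) + q n \<bullet> q n)"
    by (intro sum.cong) (auto simp: inner_diff inner_commute)
  also have "\<dots> = E - 2 * ((\<Sum>l<n. h l) \<bullet> q n) + N * (q n \<bullet> q n)"
    by (simp add: sum.distrib sum_subtractf sum_distrib_left inner_sum_left N_def E_def)
  finally have E: "N * (q n \<bullet> q n) \<le> E" by (simp add: hsum)
  have tel: "2 * (\<Sum>j<m. q j \<bullet> h j) = N * (q m \<bullet> q m) - (\<Sum>j<m. h j \<bullet> h j) / N" for m
  proof (induction m)
    case 0
    then show ?case by (simp add: q_def)
  next
    case (Suc m)
    have "q (Suc m) = q m + (1 / N) *\<^sub>R h m"
      by (simp add: q_def N_def scaleR_right_distrib divide_inverse)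
    then have "N * (q (Suc m) \<bullet> q (Suc m)) = N * (q m \<bullet> q m) + 2 * (q m \<bullet> h m) + (h m \<bullet> h m) / N"
      using N by (simp add: inner_add inner_commute field_simps)
    then show ?case using Suc by (simp add: add_divide_distrib)
  qed
  have "2 * (\<Sum>j<n. q j \<bullet> h j) = N * (q n \<bullet> q n) - E / N"
    unfolding E_def by (rule tel)
  also have "\<dots> \<le> N * (q n \<bullet> q n) - q n \<bullet> q n"
    using E N by (simp add: field_simps)
  also have "\<dots> = N * (1 - u) * (q n \<bullet> q n)"
    using N by (simp add: u_def N_def[symmetric] field_simps)
  finally have qh: "(\<Sum>j<n. q j \<bullet> h j) \<le> N * ((1 - u) / 2 * (q n \<bullet> q n))" by simp
  have "(\<Sum>j<n. A * (q j \<bullet> q j) + B * (q j \<bullet> h j) - K * (h j \<bullet> h j) + q j \<bullet> v + h j \<bullet> w)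
     = (\<Sum>j<n. A * (q j \<bullet> q j) + q j \<bullet> v) + B * (\<Sum>j<n. q j \<bullet> h j) - K * E + (\<Sum>j<n. h j) \<bullet> w"
    by (simp add: sum.distrib sum_subtractf sum_distrib_left E_def inner_sum_left)
  also have "\<dots> \<le> (N * (A * (q n \<bullet> q n) * ((1 - u) * (2 - u) / 6) + q n \<bullet> v * ((1 - u) / 2))
      + (A / 8 + \<tau>) * (E - N * (q n \<bullet> q n))
      + N / (4 * \<tau>) * ((A *\<^sub>R q n + v) \<bullet> (A *\<^sub>R q n + v) * (1 - u\<^sup>2) / 12
          + A\<^sup>2 * (q n \<bullet> q n) * (1 - 4 * u\<^sup>2) / 180))
      + B * (N * ((1 - u) / 2 * (q n \<bullet> q n))) - K * E + (\<Sum>j<n. h j) \<bullet> w"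
    using path_bound[OF n A tau, of h v] mult_left_mono[OF qh B]
    unfolding q_def[symmetric] u_def[symmetric] E_def N_def by linarith
  also have "(A / 8 + \<tau>) * (E - N * (q n \<bullet> q n)) \<le> K * (E - N * (q n \<bullet> q n))"
    using K E by (intro mult_right_mono) auto
  finally show ?thesis unfolding hsum N_def[symmetric] by (simp add: algebra_simps)
qed

text \<open>The letters \<open>a\<close>, \<open>b\<close>, \<open>c\<close> stand for the ranges \<open>[0, 2/5]\<close>, \<open>[2/5, 7/10]\<close>, \<open>[7/10, 1]\<close> of the damping
  parameter. All quadratic forms below are affine in \<open>\<theta>\<close> up to a multiple of \<open>s (1 - s)\<close>, where \<open>s\<close> is the
  relative position in the range, so that a certificate at both end points is enough. The multipliers
  were found by numerical optimization and rounded; the squares are the resulting LDL decompositions.\<close>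

lemma gram_a0:
  fixes k c e q H d f :: "'a::real_inner"
  shows "0 \<le> 23 / 25 * (k \<bullet> k) - 11 / 5 * (k \<bullet> c) + 11 / 5 * (k \<bullet> e)
      + 87 / 50 * (c \<bullet> c) - 11 / 5 * (c \<bullet> e) - (c \<bullet> d) + 54 / 25 * (e \<bullet> e)
      - 27 / 20 * (e \<bullet> H) - 53 / 100 * (e \<bullet> d) - 13 / 100 * (e \<bullet> f)
      + 1 / 500 * (q \<bullet> q) + 621 / 1000 * (H \<bullet> H) + 11 / 500 * (H \<bullet> d)
      + 3 / 25 * (H \<bullet> f) + 591 / 1000 * (d \<bullet> d) + 1 / 500 * (d \<bullet> f) + 1 / 125 * (f \<bullet> f)"
proof -
  define v0 where "v0 = k - (55 / 46) *\<^sub>R c + (55 / 46) *\<^sub>R e"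
  define v1 where "v1 = c + (495 / 977) *\<^sub>R e - (1150 / 977) *\<^sub>R d"
  define v2 where "v2 = e - (131895 / 143764) *\<^sub>R H - (2281 / 143764) *\<^sub>R d - (12701 / 143764) *\<^sub>R f"
  define v3 where "v3 = q"
  define v4 where "v4 = H + (41729 / 248319) *\<^sub>R d + (17555 / 82773) *\<^sub>R f"
  define v5 where "v5 = d - (23061 / 553670) *\<^sub>R f"
  define v6 where "v6 = f"
  have "0 \<le> (23 / 25) * (v0 \<bullet> v0) + (977 / 2300) * (v1 \<bullet> v1)
      + (35941 / 48850) * (v2 \<bullet> v2) + (1 / 500) * (v3 \<bullet> v3)
      + (248319 / 143764000) * (v4 \<bullet> v4) + (55367 / 24831900) * (v5 \<bullet> v5) + (1204751 / 553670000) * (v6 \<bullet> v6)"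
    by (intro add_nonneg_nonneg mult_nonneg_nonneg inner_ge_zero) simp_all
  then show ?thesis
    unfolding v0_def v1_def v2_def v3_def v4_def v5_def v6_def
    by (simp add: inner_add_left inner_add_right inner_diff_left inner_diff_right inner_commute algebra_simps)
qed

lemma gram_a1:
  fixes k c e q H d f :: "'a::real_inner"
  shows "0 \<le> 359 / 625 * (k \<bullet> k) - 331 / 250 * (k \<bullet> c) + 33 / 25 * (k \<bullet> e)
      + 101 / 250 * (k \<bullet> q) - 1 / 5 * (k \<bullet> d) + 17 / 10 * (c \<bullet> c)
      - 11 / 5 * (c \<bullet> e) - 149 / 250 * (c \<bullet> d) + 217 / 125 * (e \<bullet> e)
      - 137 / 100 * (e \<bullet> H) - 11 / 20 * (e \<bullet> d) - 11 / 50 * (e \<bullet> f)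
      + 39 / 250 * (q \<bullet> q) + 59 / 250 * (q \<bullet> H) - 21 / 125 * (q \<bullet> d)
      + 19 / 500 * (q \<bullet> f) + 551 / 1000 * (H \<bullet> H) + 62 / 125 * (H \<bullet> d)
      + 22 / 125 * (H \<bullet> f) + 196 / 625 * (d \<bullet> d) + 2 / 25 * (d \<bullet> f) + 2 / 125 * (f \<bullet> f)"
proof -
  define v0 where "v0 = k - (1655 / 1436) *\<^sub>R c + (825 / 718) *\<^sub>R e + (505 / 1436) *\<^sub>R q - (125 / 718) *\<^sub>R d"
  define v1 where "v1 = c - (48730 / 134559) *\<^sub>R e + (33431 / 134559) *\<^sub>R q - (296714 / 672795) *\<^sub>R d"
  define v2 where "v2 = e - (4971725 / 28753606) *\<^sub>R q - (92172915 / 115014424) *\<^sub>R H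
      - (41680265 / 115014424) *\<^sub>R d - (7400745 / 57507212) *\<^sub>R f"
  define v3 where "v3 = q - (12706117 / 45067236) *\<^sub>R H + (2680771 / 15022412) *\<^sub>R d - (47603 / 3755603) *\<^sub>R f"
  define v4 where "v4 = H - (898032 / 10783999) *\<^sub>R d - (7208109 / 86271992) *\<^sub>R f"
  define v5 where "v5 = d + (5484591 / 70066460) *\<^sub>R f"
  define v6 where "v6 = f"
  have "0 \<le> (359 / 625) * (v0 \<bullet> v0) + (134559 / 143600) * (v1 \<bullet> v1)
      + (14376803 / 16819875) * (v2 \<bullet> v2) + (11266809 / 7188401500) * (v3 \<bullet> v3)
      + (10783999 / 5633404500) * (v4 \<bullet> v4) + (3503323 / 2156799800) * (v5 \<bullet> v5)
      + (1020313897 / 560531680000) * (v6 \<bullet> v6)"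
    by (intro add_nonneg_nonneg mult_nonneg_nonneg inner_ge_zero) simp_all
  then show ?thesis
    unfolding v0_def v1_def v2_def v3_def v4_def v5_def v6_def
    by (simp add: inner_add_left inner_add_right inner_diff_left inner_diff_right inner_commute algebra_simps)
qed

lemma gram_b0:
  fixes k c e q H d f :: "'a::real_inner"
  shows "0 \<le> 63 / 125 * (k \<bullet> k) - 6 / 5 * (k \<bullet> c) + 33 / 25 * (k \<bullet> e)
      + 7 / 25 * (k \<bullet> q) - 1 / 5 * (k \<bullet> d) + 17 / 10 * (c \<bullet> c) - 11 / 5 * (c \<bullet> e)
      - 18 / 25 * (c \<bullet> d) + 217 / 125 * (e \<bullet> e) - 3 / 5 * (e \<bullet> H) - 1 / 2 * (e \<bullet> d)
      - 1 / 2 * (e \<bullet> f) + 91 / 1000 * (q \<bullet> q) + 51 / 500 * (q \<bullet> H)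
      - 63 / 500 * (q \<bullet> d) + 21 / 250 * (q \<bullet> f) + 119 / 1000 * (H \<bullet> H)
      + 53 / 250 * (H \<bullet> d) + 97 / 500 * (H \<bullet> f) + 7 / 20 * (d \<bullet> d)
      + 22 / 125 * (d \<bullet> f) + 83 / 1000 * (f \<bullet> f)"
proof -
  define v0 where "v0 = k - (25 / 21) *\<^sub>R c + (55 / 42) *\<^sub>R e + (5 / 18) *\<^sub>R q - (25 / 126) *\<^sub>R d"
  define v1 where "v1 = c - (22 / 69) *\<^sub>R e + (35 / 207) *\<^sub>R q - (503 / 1035) *\<^sub>R d"
  define v2 where "v2 = e - (13475 / 79851) *\<^sub>R q - (10350 / 26617) *\<^sub>R H - (28130 / 79851) *\<^sub>R d
      - (8625 / 26617) *\<^sub>R f"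
  define v3 where "v3 = q + (29901 / 156541) *\<^sub>R H - (1009 / 22363) *\<^sub>R d - (2144 / 22363) *\<^sub>R f"
  define v4 where "v4 = H + (52059 / 355928) *\<^sub>R d - (27615 / 355928) *\<^sub>R f"
  define v5 where "v5 = d - (56549 / 1652929) *\<^sub>R f"
  define v6 where "v6 = f"
  have "0 \<le> (63 / 125) * (v0 \<bullet> v0) + (69 / 70) * (v1 \<bullet> v1)
      + (26617 / 34500) * (v2 \<bullet> v2) + (156541 / 79851000) * (v3 \<bullet> v3)
      + (44491 / 19567625) * (v4 \<bullet> v4) + (1652929 / 1067784000) * (v5 \<bullet> v5) + (1616751 / 826464500) * (v6 \<bullet> v6)"
    by (intro add_nonneg_nonneg mult_nonneg_nonneg inner_ge_zero) simp_all
  then show ?thesis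
    unfolding v0_def v1_def v2_def v3_def v4_def v5_def v6_def
    by (simp add: inner_add_left inner_add_right inner_diff_left inner_diff_right inner_commute algebra_simps)
qed

lemma gram_b1:
  fixes k c e q H d f :: "'a::real_inner"
  shows "0 \<le> 123 / 500 * (k \<bullet> k) - 9 / 20 * (k \<bullet> c) + 33 / 50 * (k \<bullet> e)
      + 49 / 100 * (k \<bullet> q) - 7 / 20 * (k \<bullet> d) + 11 / 5 * (c \<bullet> c) - 11 / 5 * (c \<bullet> e)
      - 51 / 100 * (c \<bullet> d) + 709 / 500 * (e \<bullet> e) - 4 / 5 * (e \<bullet> H)
      - 2 / 5 * (e \<bullet> d) - 2 / 5 * (e \<bullet> f) + 179 / 500 * (q \<bullet> q)
      + 73 / 250 * (q \<bullet> H) - 173 / 500 * (q \<bullet> d) + 73 / 500 * (q \<bullet> f)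
      + 123 / 500 * (H \<bullet> H) + 4 / 25 * (H \<bullet> d) + 61 / 250 * (H \<bullet> f)
      + 239 / 1000 * (d \<bullet> d) + 2 / 25 * (d \<bullet> f) + 63 / 1000 * (f \<bullet> f)"
proof -
  define v0 where "v0 = k - (75 / 82) *\<^sub>R c + (55 / 41) *\<^sub>R e + (245 / 246) *\<^sub>R q - (175 / 246) *\<^sub>R d"
  define v1 where "v1 = c - (2618 / 6541) *\<^sub>R e + (735 / 6541) *\<^sub>R q - (6807 / 32705) *\<^sub>R d"
  define v2 where "v2 = e - (781550 / 2144969) *\<^sub>R q - (1308200 / 2144969) *\<^sub>R H
      - (429645 / 2144969) *\<^sub>R d - (654100 / 2144969) *\<^sub>R f"
  define v3 where "v3 = q + (818211 / 5610953) *\<^sub>R H + (198782 / 5610953) *\<^sub>R d + (818211 / 11221906) *\<^sub>R f"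
  define v4 where "v4 = H - (182983 / 2813908) *\<^sub>R d + (16863 / 11255632) *\<^sub>R f"
  define v5 where "v5 = d - (182983 / 5052640) *\<^sub>R f"
  define v6 where "v6 = f"
  have "0 \<le> (123 / 500) * (v0 \<bullet> v0) + (6541 / 3280) * (v1 \<bullet> v1)
      + (2144969 / 3270500) * (v2 \<bullet> v2) + (5610953 / 3217453500) * (v3 \<bullet> v3)
      + (1406954 / 701369125) * (v4 \<bullet> v4) + (31579 / 17586925) * (v5 \<bullet> v5) + (40403803 / 20210560000) * (v6 \<bullet> v6)"
    by (intro add_nonneg_nonneg mult_nonneg_nonneg inner_ge_zero) simp_all
  then show ?thesis
    unfolding v0_def v1_def v2_def v3_def v4_def v5_def v6_def
    by (simp add: inner_add_left inner_add_right inner_diff_left inner_diff_right inner_commute algebra_simps)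
qed

lemma gram_c0:
  fixes k c e q H d f :: "'a::real_inner"
  shows "0 \<le> 13 / 50 * (k \<bullet> k) + 1 / 20 * (k \<bullet> c) + 3 / 10 * (k \<bullet> e)
      + 7 / 20 * (k \<bullet> q) - 7 / 20 * (k \<bullet> d) + 147 / 100 * (c \<bullet> c) - (c \<bullet> e)
      - 13 / 20 * (c \<bullet> d) + 23 / 40 * (e \<bullet> e) - 41 / 100 * (e \<bullet> H)
      + 11 / 100 * (e \<bullet> d) - 31 / 100 * (e \<bullet> f) + 157 / 1000 * (q \<bullet> q)
      + 71 / 500 * (q \<bullet> H) - 131 / 500 * (q \<bullet> d) + 27 / 250 * (q \<bullet> f)
      + 69 / 500 * (H \<bullet> H) - 8 / 125 * (H \<bullet> d) + 103 / 500 * (H \<bullet> f)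
      + 24 / 125 * (d \<bullet> d) - 6 / 125 * (d \<bullet> f) + 2 / 25 * (f \<bullet> f)"
proof -
  define v0 where "v0 = k + (5 / 52) *\<^sub>R c + (15 / 26) *\<^sub>R e + (35 / 52) *\<^sub>R q - (35 / 52) *\<^sub>R d"
  define v1 where "v1 = c - (5350 / 15263) *\<^sub>R e - (175 / 15263) *\<^sub>R q - (3205 / 15263) *\<^sub>R d"
  define v2 where "v2 = e - (65240 / 188129) *\<^sub>R q - (625783 / 940645) *\<^sub>R H
      + (146343 / 940645) *\<^sub>R d - (473153 / 940645) *\<^sub>R f"
  define v3 where "v3 = q - (17041 / 369003) *\<^sub>R H - (22574 / 369003) *\<^sub>R d + (46766 / 369003) *\<^sub>R f"
  define v4 where "v4 = H - (41401 / 596104) *\<^sub>R d - (4861 / 74513) *\<^sub>R f"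
  define v5 where "v5 = d + (72944 / 1207861) *\<^sub>R f"
  define v6 where "v6 = f"
  have "0 \<le> (13 / 50) * (v0 \<bullet> v0) + (15263 / 10400) * (v1 \<bullet> v1)
      + (188129 / 610520) * (v2 \<bullet> v2) + (369003 / 188129000) * (v3 \<bullet> v3)
      + (74513 / 46125375) * (v4 \<bullet> v4) + (1207861 / 596104000) * (v5 \<bullet> v5) + (2401009 / 1207861000) * (v6 \<bullet> v6)"
    by (intro add_nonneg_nonneg mult_nonneg_nonneg inner_ge_zero) simp_all
  then show ?thesis
    unfolding v0_def v1_def v2_def v3_def v4_def v5_def v6_def
    by (simp add: inner_add_left inner_add_right inner_diff_left inner_diff_right inner_commute algebra_simps)
qed

lemma gram_c1:
  fixes k c e q H d f :: "'a::real_inner"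
  shows "0 \<le> 1 / 4 * (k \<bullet> k) + 1 / 2 * (k \<bullet> c) + 1 / 2 * (k \<bullet> q)
      - 1 / 2 * (k \<bullet> d) + 151 / 100 * (c \<bullet> c) - (c \<bullet> e) - 1 / 2 * (c \<bullet> d)
      + 1 / 2 * (e \<bullet> e) - 11 / 20 * (e \<bullet> H) - 1 / 50 * (e \<bullet> f)
      + 167 / 500 * (q \<bullet> q) + 9 / 50 * (q \<bullet> H) - 1 / 2 * (q \<bullet> d)
      + 3 / 500 * (q \<bullet> f) + 253 / 1000 * (H \<bullet> H) + 9 / 500 * (H \<bullet> f)
      + 63 / 250 * (d \<bullet> d) + 1 / 500 * (f \<bullet> f)"
proof -
  define v0 where "v0 = k + (1) *\<^sub>R c + (1) *\<^sub>R q - (1) *\<^sub>R d"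
  define v1 where "v1 = c - (25 / 63) *\<^sub>R e - (25 / 126) *\<^sub>R q"
  define v2 where "v2 = e - (25 / 76) *\<^sub>R q - (693 / 760) *\<^sub>R H - (63 / 1900) *\<^sub>R f"
  define v3 where "v3 = q - (35 / 134) *\<^sub>R H - (11 / 67) *\<^sub>R f"
  define v4 where "v4 = H - (52 / 569) *\<^sub>R f"
  define v5 where "v5 = d"
  define v6 where "v6 = f"
  have "0 \<le> (1 / 4) * (v0 \<bullet> v0) + (63 / 50) * (v1 \<bullet> v1) + (19 / 63) * (v2 \<bullet> v2)
      + (67 / 38000) * (v3 \<bullet> v3) + (569 / 268000) * (v4 \<bullet> v4) + (1 / 500) * (v5 \<bullet> v5)
      + (4561 / 2845000) * (v6 \<bullet> v6)"
    by (intro add_nonneg_nonneg mult_nonneg_nonneg inner_ge_zero) simp_all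
  then show ?thesis
    unfolding v0_def v1_def v2_def v3_def v4_def v5_def v6_def
    by (simp add: inner_add_left inner_add_right inner_diff_left inner_diff_right inner_commute algebra_simps)
qed

section \<open>Quadratic inequalities for one index and for the end point of the path\<close>

abbreviation (input) mix :: "real \<Rightarrow> real \<Rightarrow> real \<Rightarrow> real" where
  "mix s a b \<equiv> a * (1 - s) + b * s"

text \<open>The contribution of one index to the change of the Lyapunov function of \<open>epoch_descent\<close>, divided
  by \<open>\<theta>\<close>. Writing \<open>G x = x - D x\<close>, \<open>x\<close> and \<open>x' = x + \<theta> d\<close> for the points before and after the epoch and \<open>y = x + q\<close> for
  the point at which the index is visited, \<open>e\<close> is the increment of the table entry, \<open>c = G y - G x\<close> and
  \<open>k = (G x - G x') / \<theta>\<close>. The weight \<open>w\<close> mixes the two-point bound on \<open>\<phi> x' - \<phi> x\<close> with the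
  three-point bound through \<open>y\<close>.\<close>

definition increment_form :: "real \<Rightarrow> real \<Rightarrow> real \<Rightarrow> 'a::real_inner \<Rightarrow> 'a \<Rightarrow> 'a \<Rightarrow> 'a \<Rightarrow> 'a \<Rightarrow> real" where
  "increment_form \<theta> b w k c e q d = - (1 - \<theta>) * (e \<bullet> d) + c \<bullet> d
      - \<theta> / 4 * (d \<bullet> d - 2 * (k \<bullet> d) + k \<bullet> k)
     + b * (\<theta> * (k \<bullet> k) + 2 * (k \<bullet> c) - 2 * (1 - \<theta>) * (k \<bullet> e)
         + 2 * (c \<bullet> e) - (2 - \<theta>) * (e \<bullet> e))
     + w / 2 * (q \<bullet> q - c \<bullet> c - \<theta> * (q \<bullet> d + k \<bullet> q + c \<bullet> d + k \<bullet> c))"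

lemma quad_nonpos:
  fixes d f :: "'a::real_inner"
  assumes "x < 0" "y * y \<le> 4 * (x * z)"
  shows "x * (d \<bullet> d) + y * (d \<bullet> f) + z * (f \<bullet> f) \<le> 0"
proof -
  have "4 * x * (x * (d \<bullet> d) + y * (d \<bullet> f) + z * (f \<bullet> f)) =
    ((2 * x) *\<^sub>R d + y *\<^sub>R f) \<bullet> ((2 * x) *\<^sub>R d + y *\<^sub>R f) + (4 * (x * z) - y * y) * (f \<bullet> f)"
    by (simp add: inner_add_left inner_add_right inner_commute algebra_simps)
  also have "\<dots> \<ge> 0" using assms by (intro add_nonneg_nonneg mult_nonneg_nonneg) auto
  finally show ?thesis using assms by (simp add: zero_le_mult_iff)
qed

lemma inner_lincomb:
  fixes d f :: "'a::real_inner"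
  shows "(a *\<^sub>R d + b *\<^sub>R f) \<bullet> (a' *\<^sub>R d + b' *\<^sub>R f) = a * a' * (d \<bullet> d)
      + (a * b' + b * a') * (d \<bullet> f) + b * b' * (f \<bullet> f)"
  by (simp add: inner_add_left inner_add_right inner_commute algebra_simps)

text \<open>All vectors lie in the span of \<open>d\<close> and \<open>f\<close>. Once the three
  coefficients are scalars, the comparison with a Bernstein expansion becomes a polynomial identity
  in s and u, which \<open>algebra\<close> can check.\<close>

lemma path_form_eq:
  fixes d f g v w :: "'a::real_inner" and u :: real
  assumes g: "g = \<theta> *\<^sub>R d + (1 - \<theta>) *\<^sub>R f" and v: "v = v1 *\<^sub>R d + v2 *\<^sub>R f"
      and w: "w = w1 *\<^sub>R d + w2 *\<^sub>R f"
  shows "A * (g \<bullet> g) * ((1 - u) * (2 - u) / 6) + g \<bullet> v * ((1 - u) / 2)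
        + B / 2 * (1 - u) * (g \<bullet> g) + g \<bullet> w - K * (g \<bullet> g)
        + t * ((A *\<^sub>R g + v) \<bullet> (A *\<^sub>R g + v) * (1 - u\<^sup>2) / 12
          + A\<^sup>2 * (g \<bullet> g) * (1 - 4 * u\<^sup>2) / 180)
        + (c1 * (d \<bullet> d) + c2 * (d \<bullet> f) + c3 * (f \<bullet> f)) =
      (A * (\<theta>^2) * ((1 - u) * (2 - u) / 6) + (\<theta> * v1) * ((1 - u) / 2) + B / 2 * (1
          - u) * (\<theta>^2) + (\<theta> * w1) - K * (\<theta>^2) + (((A * \<theta> + v1)^2) * ((1
          - u\<^sup>2) / 12) + A\<^sup>2 * (\<theta>^2) * ((1 - 4 * u\<^sup>2) / 180)) * t + c1) * (d \<bullet> d) +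
      (A * ((2 * \<theta> * (1 - \<theta>))) * ((1 - u) * (2 - u) / 6) + ((\<theta> * v2 + (1
          - \<theta>) * v1)) * ((1 - u) / 2) + B / 2 * (1 - u) * ((2 * \<theta> * (1 - \<theta>)))
          + ((\<theta> * w2 + (1 - \<theta>) * w1)) - K * ((2 * \<theta> * (1 - \<theta>))) + (((2 * (A * \<theta>
          + v1) * (A * (1 - \<theta>) + v2))) * ((1 - u\<^sup>2) / 12) + A\<^sup>2 * ((2 * \<theta> * (1
          - \<theta>))) * ((1 - 4 * u\<^sup>2) / 180)) * t + c2) * (d \<bullet> f) +
      (A * ((1 - \<theta>)^2) * ((1 - u) * (2 - u) / 6) + ((1 - \<theta>) * v2) * ((1 - u) / 2) + B / 2 * (1
          - u) * ((1 - \<theta>)^2) + ((1 - \<theta>) * w2) - K * ((1 - \<theta>)^2) + (((A * (1 - \<theta>)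
          + v2)^2) * ((1 - u\<^sup>2) / 12) + A\<^sup>2 * ((1 - \<theta>)^2) * ((1 - 4 * u\<^sup>2) / 180)) * t + c3) * (f \<bullet> f)"
proof -
  have "A *\<^sub>R g + v = (A * \<theta> + v1) *\<^sub>R d + (A * (1 - \<theta>) + v2) *\<^sub>R f"
    unfolding g v by (simp add: algebra_simps)
  note rr = this
  have lin: "A * (a1 * X + a2 * Y + a3 * Z) * p2 + (b1 * X + b2 * Y + b3 * Z) * p1 + B' * (a1 * X + a2 * Y + a3 * Z)
      + (e1 * X + e2 * Y + e3 * Z) - K * (a1 * X + a2 * Y + a3 * Z)
      + t * ((r1 * X + r2 * Y + r3 * Z) * m / 12 + A2 * (a1 * X + a2 * Y + a3 * Z) * m' / 180) + (c1 * X + c2 * Y + c3 * Z)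
    = (A * a1 * p2 + b1 * p1 + B' * a1 + e1 - K * a1 + (r1 * (m / 12) + A2 * a1 * (m' / 180)) * t + c1) * X
      + (A * a2 * p2 + b2 * p1 + B' * a2 + e2 - K * a2 + (r2 * (m / 12) + A2 * a2 * (m' / 180)) * t + c2) * Y
      + (A * a3 * p2 + b3 * p1 + B' * a3 + e3 - K * a3 + (r3 * (m / 12) + A2 * a3 * (m' / 180)) * t + c3) * Z"
    for a1 a2 a3 b1 b2 b3 e1 e2 e3 r1 r2 r3 X Y Z p1 p2 B' A2 m m' :: real
    by (simp add: algebra_simps add_divide_distrib)
  have c: "x + x' = y + y'" if "x = y" "x' = y'" for x x' y y' :: real using that by simp
  show ?thesis unfolding rr unfolding g v w inner_lincomb lin
    by (intro c arg_cong[where f = "\<lambda>x. x * _"] arg_cong2[where f = "(-)"] arg_cong2[where f = "(*)"] refl) algebra+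
qed

text \<open>The bound of \<open>path_form\<close> is a quadratic form in \<open>d\<close>, \<open>f\<close> with coefficients polynomial in \<open>s\<close> and \<open>u\<close>, and
  each of its Bernstein coefficients on \<open>[0, 1] \<times> [0, 1/2]\<close> is negative definite.\<close>

lemma path_form_nonpos_a:
  fixes d f g v w :: "'a::real_inner" and s u :: real
  assumes s: "0 \<le> s" "s \<le> 1" and u: "0 \<le> u" "u \<le> 1 / 2" and th: "\<theta> = 0 + (2 / 5) * s"
    and g: "g = \<theta> *\<^sub>R d + (1 - \<theta>) *\<^sub>R f"
    and v: "v = (mix s 0 (- 261 / 250)) *\<^sub>R d + (mix s 0 (19 / 500)) *\<^sub>R f" and w: "w
        = (mix s (11 / 500) (62 / 125)) *\<^sub>R d + (mix s (3 / 25) (22 / 125)) *\<^sub>R f"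
    and A: "A = (mix s (871 / 500) (232 / 125))" and B: "B = (mix s 0 (59 / 250))" and K: "K
        = (mix s (729 / 1000) (819 / 1000))" and tau: "\<tau> = (511 / 1000)"
  shows "A * (g \<bullet> g) * ((1 - u) * (2 - u) / 6) + g \<bullet> v * ((1 - u) / 2)
        + B / 2 * (1 - u) * (g \<bullet> g) + g \<bullet> w - K * (g \<bullet> g)
        + 1 / (4 * \<tau>) * ((A *\<^sub>R g + v) \<bullet> (A *\<^sub>R g + v) * (1 - u\<^sup>2) / 12
          + A\<^sup>2 * (g \<bullet> g) * (1 - 4 * u\<^sup>2) / 180)
        + ((mix s (- 19 / 1000) (- 11 / 500)) * (d \<bullet> d) + (mix s (1 / 500) (2 / 25)) * (d \<bullet> f)
            + (mix s (- 61 / 500) (- 51 / 250)) * (f \<bullet> f)) \<le> 0"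
proof -
  define v1 where "v1 = (mix s 0 (- 261 / 250))"
  define v2 where "v2 = (mix s 0 (19 / 500))"
  define w1 where "w1 = (mix s (11 / 500) (62 / 125))"
  define w2 where "w2 = (mix s (3 / 25) (22 / 125))"
  define c1 where "c1 = (mix s (- 19 / 1000) (- 11 / 500))"
  define c2 where "c2 = (mix s (1 / 500) (2 / 25))"
  define c3 where "c3 = (mix s (- 61 / 500) (- 51 / 250))"
  \<comment> \<open>Tensor product Bernstein basis: degree 4 in s, because \<open>A\<close> and
    \<open>\<theta>\<close> are affine in s and their product is squared, and degree 2 in u on
    [0, 1/2], the range of 1/n for n >= 2.\<close>
  define w00 where "w00 = ((1 - s)^4) * ((1 - 2 * u)^2)"
  define w01 where "w01 = ((1 - s)^4) * (4 * u * (1 - 2 * u))"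
  define w02 where "w02 = ((1 - s)^4) * (4 * u^2)"
  define w10 where "w10 = (4 * s * (1 - s)^3) * ((1 - 2 * u)^2)"
  define w11 where "w11 = (4 * s * (1 - s)^3) * (4 * u * (1 - 2 * u))"
  define w12 where "w12 = (4 * s * (1 - s)^3) * (4 * u^2)"
  define w20 where "w20 = (6 * s^2 * (1 - s)^2) * ((1 - 2 * u)^2)"
  define w21 where "w21 = (6 * s^2 * (1 - s)^2) * (4 * u * (1 - 2 * u))"
  define w22 where "w22 = (6 * s^2 * (1 - s)^2) * (4 * u^2)"
  define w30 where "w30 = (4 * s^3 * (1 - s)) * ((1 - 2 * u)^2)"
  define w31 where "w31 = (4 * s^3 * (1 - s)) * (4 * u * (1 - 2 * u))"
  define w32 where "w32 = (4 * s^3 * (1 - s)) * (4 * u^2)"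
  define w40 where "w40 = (s^4) * ((1 - 2 * u)^2)"
  define w41 where "w41 = (s^4) * (4 * u * (1 - 2 * u))"
  define w42 where "w42 = (s^4) * (4 * u^2)"
  have pos: "0 \<le> w00" "0 \<le> w01" "0 \<le> w02" "0 \<le> w10" "0 \<le> w11" "0 \<le> w12" "0
      \<le> w20" "0 \<le> w21" "0 \<le> w22" "0 \<le> w30" "0 \<le> w31" "0 \<le> w32" "0 \<le> w40" "0 \<le> w41" "0 \<le> w42"
    using s u by (simp_all add: w00_def w01_def w02_def w10_def w11_def w12_def w20_def w21_def w22_def w30_def w31_def w32_def w40_def w41_def w42_def)
  note defs = v1_def v2_def w1_def w2_def c1_def c2_def c3_def
    w00_def w01_def w02_def w10_def w11_def w12_def w20_def w21_def w22_def w30_def w31_def w32_def w40_def w41_def w42_def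
  have X: "A * (\<theta>^2) * ((1 - u) * (2 - u) / 6) + (\<theta> * v1) * ((1 - u) / 2) + B / 2 * (1
      - u) * (\<theta>^2) + (\<theta> * w1) - K * (\<theta>^2) + (((A * \<theta> + v1)^2) * ((1 - u\<^sup>2) / 12)
      + A\<^sup>2 * (\<theta>^2) * ((1 - 4 * u\<^sup>2) / 180)) * (250 / 511) + c1 =
      w00 * (- 19 / 1000) + w01 * (- 19 / 1000) + w02 * (- 19 / 1000) + w10 * (- 351 / 20000)
          + w11 * (- 351 / 20000) + w12 * (- 351 / 20000) + w20 * (- 19157561 / 862312500)
          + w21 * (- 33325207 / 1724625000) + w22 * (- 163363 / 10950000) + w30 * (- 70454479 / 2299500000)
          + w31 * (- 1703717 / 71859375) + w32 * (- 87739 / 7300000) + w40 * (- 23205851 / 574875000)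
          + w41 * (- 8625073 / 287437500) + w42 * (- 495599 / 51100000)"
    unfolding A B K th defs by algebra
  have Y: "A * ((2 * \<theta> * (1 - \<theta>))) * ((1 - u) * (2 - u) / 6) + ((\<theta> * v2 + (1
      - \<theta>) * v1)) * ((1 - u) / 2) + B / 2 * (1 - u) * ((2 * \<theta> * (1 - \<theta>))) + ((\<theta> * w2
      + (1 - \<theta>) * w1)) - K * ((2 * \<theta> * (1 - \<theta>))) + (((2 * (A * \<theta> + v1) * (A * (1
      - \<theta>) + v2))) * ((1 - u\<^sup>2) / 12) + A\<^sup>2 * ((2 * \<theta> * (1 - \<theta>))) * ((1
      - 4 * u\<^sup>2) / 180)) * (250 / 511) + c2 =
      w00 * (3 / 125) + w01 * (3 / 125) + w02 * (3 / 125) + w10 * (438601 / 459900000)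
          + w11 * (- 9171613 / 919800000) + w12 * (- 2889 / 584000) + w20 * (10645499 / 1724625000)
          + w21 * (- 65239187 / 3449250000) + w22 * (- 1630729 / 102200000) + w30 * (19611227 / 574875000)
          + w31 * (- 22402199 / 4599000000) + w32 * (- 799793 / 102200000) + w40 * (15148649 / 191625000)
          + w41 * (5736029 / 191625000) + w42 * (1048553 / 51100000)"
    unfolding A B K th defs by algebra
  have Z: "A * ((1 - \<theta>)^2) * ((1 - u) * (2 - u) / 6) + ((1 - \<theta>) * v2) * ((1 - u) / 2) + B / 2 * (1
      - u) * ((1 - \<theta>)^2) + ((1 - \<theta>) * w2) - K * ((1 - \<theta>)^2) + (((A * (1 - \<theta>)
      + v2)^2) * ((1 - u\<^sup>2) / 12) + A\<^sup>2 * ((1 - \<theta>)^2) * ((1 - 4 * u\<^sup>2) / 180)) * (250 / 511) + c3 =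
      w00 * (- 422351 / 22995000) + w01 * (- 21718049 / 91980000) + w02 * (- 3437691 / 8176000)
          + w10 * (- 6140767 / 919800000) + w11 * (- 88761251 / 459900000) + w12 * (- 14432001 / 40880000)
          + w20 * (- 161724341 / 13797000000) + w21 * (- 2294142671 / 13797000000)
          + w22 * (- 184370273 / 613200000) + w30 * (- 7747031 / 255500000) + w31 * (- 78957707 / 511000000)
          + w32 * (- 53891847 / 204400000) + w40 * (- 45377803 / 766500000) + w41 * (- 59860319 / 383250000)
          + w42 * (- 49511591 / 204400000)"
    unfolding A B K th defs by algebra
  let ?q = "\<lambda>x y z. x * (d \<bullet> d) + y * (d \<bullet> f) + z * (f \<bullet> f)"
  have c: "w * ?q x y z \<le> 0" if "0 \<le> w" "x < 0" "y * y \<le> 4 * (x * z)" for w x y z :: real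
    by (rule mult_nonneg_nonpos[OF that(1) quad_nonpos[OF that(2,3)]])
  have fin: "w00 * ?q (- 19 / 1000) (3 / 125) (- 422351 / 22995000)
      + w01 * ?q (- 19 / 1000) (3 / 125) (- 21718049 / 91980000)
      + w02 * ?q (- 19 / 1000) (3 / 125) (- 3437691 / 8176000)
      + w10 * ?q (- 351 / 20000) (438601 / 459900000) (- 6140767 / 919800000)
      + w11 * ?q (- 351 / 20000) (- 9171613 / 919800000) (- 88761251 / 459900000)
      + w12 * ?q (- 351 / 20000) (- 2889 / 584000) (- 14432001 / 40880000)
      + w20 * ?q (- 19157561 / 862312500) (10645499 / 1724625000) (- 161724341 / 13797000000)
      + w21 * ?q (- 33325207 / 1724625000) (- 65239187 / 3449250000) (- 2294142671 / 13797000000)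
      + w22 * ?q (- 163363 / 10950000) (- 1630729 / 102200000) (- 184370273 / 613200000)
      + w30 * ?q (- 70454479 / 2299500000) (19611227 / 574875000) (- 7747031 / 255500000)
      + w31 * ?q (- 1703717 / 71859375) (- 22402199 / 4599000000) (- 78957707 / 511000000)
      + w32 * ?q (- 87739 / 7300000) (- 799793 / 102200000) (- 53891847 / 204400000)
      + w40 * ?q (- 23205851 / 574875000) (15148649 / 191625000) (- 45377803 / 766500000)
      + w41 * ?q (- 8625073 / 287437500) (5736029 / 191625000) (- 59860319 / 383250000)
      + w42 * ?q (- 495599 / 51100000) (1048553 / 51100000) (- 49511591 / 204400000) \<le> 0"
    by (intro add_nonpos_nonpos c pos) simp_all
  have t: "1 / (4 * \<tau>) = (250 / 511)" by (simp add: tau)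
  have vw: "v = v1 *\<^sub>R d + v2 *\<^sub>R f" "w = w1 *\<^sub>R d + w2 *\<^sub>R f"
    unfolding defs by (rule v, rule w)
  note eq = path_form_eq[OF g vw, where A = A and B = B and K = K and t = "(250 / 511)" and u = u and ?c1.0 = c1
      and ?c2.0 = c2 and ?c3.0 = c3,
    unfolded X Y Z, unfolded c1_def c2_def c3_def]
  show ?thesis unfolding t eq
    using fin by (simp only: distrib_left distrib_right mult.assoc)
qed

text \<open>The right side minus the left is a nonnegative combination of the two Gram forms,
  weighted by 1 - s and s, and of the slacks of the hypotheses. \<open>cq\<close>, \<open>kd\<close>
  and \<open>aq\<close> express nonexpansiveness of the gradient step for the three pairs among x,
  x' and y; \<open>He\<close> expresses firm nonexpansiveness of the proximal map for two
  consecutive points. The aim is to eliminate \<open>k\<close>, \<open>c\<close> and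
  \<open>e\<close>: the right side contains only the path \<open>q\<close>, its steps
  \<open>H\<close> and the fixed vectors \<open>d\<close>, \<open>f\<close>, as
  \<open>path_form\<close> requires.\<close>

lemma increment_form_a:
  fixes k c e q H d f :: "'a::real_inner" and s :: real
  assumes s: "0 \<le> s" "s \<le> 1" and th: "\<theta> = 0 + (2 / 5) * s"
    and cq: "c \<bullet> c \<le> q \<bullet> q" and kd: "k \<bullet> k \<le> d \<bullet> d"
    and aq: "c \<bullet> c + 2 * \<theta> * (k \<bullet> c) + \<theta>\<^sup>2 * (k \<bullet> k)
        \<le> q \<bullet> q - 2 * \<theta> * (q \<bullet> d) + \<theta>\<^sup>2 * (d \<bullet> d)"
    and He: "H \<bullet> H \<le> e \<bullet> H"
  shows "increment_form \<theta> (11 / 10) (101 / 50) k c e q d + (1 / 25) * (1 - \<theta>) * (e \<bullet> e)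
      + (mix s (153 / 100) (23 / 20)) * (e \<bullet> d - d \<bullet> d) + (mix s (13 / 100) (11 / 50)) * (e \<bullet> f - f \<bullet> f)
      \<le> (mix s (871 / 500) (232 / 125)) * (q \<bullet> q) + (mix s 0 (59 / 250)) * (q \<bullet> H)
          + (mix s 0 (- 261 / 250)) * (q \<bullet> d) + (mix s 0 (19 / 500)) * (q \<bullet> f)
          + (mix s (- 729 / 1000) (- 819 / 1000)) * (H \<bullet> H)
          + (mix s (11 / 500) (62 / 125)) * (H \<bullet> d) + (mix s (3 / 25) (22 / 125)) * (H \<bullet> f)
          + (mix s (- 19 / 1000) (- 11 / 500)) * (d \<bullet> d) + (mix s (1 / 500) (2 / 25)) * (d \<bullet> f)
          + (mix s (- 61 / 500) (- 51 / 250)) * (f \<bullet> f)"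
proof -
  define G0 where "G0 = 23 / 25 * (k \<bullet> k) - 11 / 5 * (k \<bullet> c) + 11 / 5 * (k \<bullet> e)
      + 87 / 50 * (c \<bullet> c) - 11 / 5 * (c \<bullet> e) - (c \<bullet> d) + 54 / 25 * (e \<bullet> e)
      - 27 / 20 * (e \<bullet> H) - 53 / 100 * (e \<bullet> d) - 13 / 100 * (e \<bullet> f)
      + 1 / 500 * (q \<bullet> q) + 621 / 1000 * (H \<bullet> H) + 11 / 500 * (H \<bullet> d)
      + 3 / 25 * (H \<bullet> f) + 591 / 1000 * (d \<bullet> d) + 1 / 500 * (d \<bullet> f) + 1 / 125 * (f \<bullet> f)"
  define G1 where "G1 = 359 / 625 * (k \<bullet> k) - 331 / 250 * (k \<bullet> c) + 33 / 25 * (k \<bullet> e)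
      + 101 / 250 * (k \<bullet> q) - 1 / 5 * (k \<bullet> d) + 17 / 10 * (c \<bullet> c)
      - 11 / 5 * (c \<bullet> e) - 149 / 250 * (c \<bullet> d) + 217 / 125 * (e \<bullet> e)
      - 137 / 100 * (e \<bullet> H) - 11 / 20 * (e \<bullet> d) - 11 / 50 * (e \<bullet> f)
      + 39 / 250 * (q \<bullet> q) + 59 / 250 * (q \<bullet> H) - 21 / 125 * (q \<bullet> d)
      + 19 / 500 * (q \<bullet> f) + 551 / 1000 * (H \<bullet> H) + 62 / 125 * (H \<bullet> d)
      + 22 / 125 * (H \<bullet> f) + 196 / 625 * (d \<bullet> d) + 2 / 25 * (d \<bullet> f) + 2 / 125 * (f \<bullet> f)"
  have "0 \<le> (1 - s) * G0" using s gram_a0[where k = k and c = c and e = e and q = q and H = H and d = d and f = f] by (simp add: G0_def)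
  moreover have "0 \<le> s * G1" using s gram_a1[where k = k and c = c and e = e and q = q and H = H and d = d
      and f = f] by (simp add: G1_def)
  moreover have "0 \<le> (mix s (7 / 50) (1 / 10)) * (q \<bullet> q - c \<bullet> c)" using s cq
      by (intro mult_nonneg_nonneg add_nonneg_nonneg) auto
  moreover have "0 \<le> (mix s (23 / 25) (41 / 50)) * (d \<bullet> d - k \<bullet> k)" using s kd
      by (intro mult_nonneg_nonneg add_nonneg_nonneg) auto
  \<comment> \<open>The next constraint, with multiplier 59/100, brings in the square of
    \<open>\<theta>\<close> and hence s^2. This multiple of s (1 - s) makes the sum affine in s, as
    59/625 is 59/100 times (2/5)^2.\<close>
  moreover have "0 \<le> (59 / 625) * (s * (1 - s)) * (d \<bullet> d - k \<bullet> k)" using s kd by (intro mult_nonneg_nonneg) auto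
  moreover have "0 \<le> (59 / 100) * (q \<bullet> q - 2 * \<theta> * (q \<bullet> d)
      + \<theta>\<^sup>2 * (d \<bullet> d) - (c \<bullet> c + 2 * \<theta> * (k \<bullet> c)
      + \<theta>\<^sup>2 * (k \<bullet> k)))" using aq by simp
  moreover have "0 \<le> (mix s (27 / 20) (137 / 100)) * (e \<bullet> H - H \<bullet> H)" using s He
      by (intro mult_nonneg_nonneg add_nonneg_nonneg) auto
  ultimately show ?thesis
    unfolding th G0_def G1_def increment_form_def power2_eq_square by (simp add: field_simps)
qed

lemma path_form_nonpos_b:
  fixes d f g v w :: "'a::real_inner" and s u :: real
  assumes s: "0 \<le> s" "s \<le> 1" and u: "0 \<le> u" "u \<le> 1 / 2" and th: "\<theta> = (2 / 5) + (3 / 10) * s"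
    and g: "g = \<theta> *\<^sub>R d + (1 - \<theta>) *\<^sub>R f"
    and v: "v = (mix s (- 563 / 500) (- 262 / 125)) *\<^sub>R d + (mix s (21 / 250) (73 / 500)) *\<^sub>R f"
        and w: "w = (mix s (53 / 250) (4 / 25)) *\<^sub>R d + (mix s (97 / 500) (61 / 250)) *\<^sub>R f"
    and A: "A = (mix s (1791 / 1000) (1279 / 500))" and B: "B = (mix s (51 / 500) (73 / 250))" and K: "K
        = (mix s (481 / 1000) (277 / 500))" and tau: "\<tau> = (117 / 500)"
  shows "A * (g \<bullet> g) * ((1 - u) * (2 - u) / 6) + g \<bullet> v * ((1 - u) / 2)
        + B / 2 * (1 - u) * (g \<bullet> g) + g \<bullet> w - K * (g \<bullet> g)
        + 1 / (4 * \<tau>) * ((A *\<^sub>R g + v) \<bullet> (A *\<^sub>R g + v) * (1 - u\<^sup>2) / 12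
          + A\<^sup>2 * (g \<bullet> g) * (1 - 4 * u\<^sup>2) / 180)
        + ((mix s (- 3 / 500) (41 / 200)) * (d \<bullet> d) + (mix s (22 / 125) (2 / 25)) * (d \<bullet> f)
            + (mix s (- 417 / 1000) (- 337 / 1000)) * (f \<bullet> f)) \<le> 0"
proof -
  define v1 where "v1 = (mix s (- 563 / 500) (- 262 / 125))"
  define v2 where "v2 = (mix s (21 / 250) (73 / 500))"
  define w1 where "w1 = (mix s (53 / 250) (4 / 25))"
  define w2 where "w2 = (mix s (97 / 500) (61 / 250))"
  define c1 where "c1 = (mix s (- 3 / 500) (41 / 200))"
  define c2 where "c2 = (mix s (22 / 125) (2 / 25))"
  define c3 where "c3 = (mix s (- 417 / 1000) (- 337 / 1000))"
  define w00 where "w00 = ((1 - s)^4) * ((1 - 2 * u)^2)"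
  define w01 where "w01 = ((1 - s)^4) * (4 * u * (1 - 2 * u))"
  define w02 where "w02 = ((1 - s)^4) * (4 * u^2)"
  define w10 where "w10 = (4 * s * (1 - s)^3) * ((1 - 2 * u)^2)"
  define w11 where "w11 = (4 * s * (1 - s)^3) * (4 * u * (1 - 2 * u))"
  define w12 where "w12 = (4 * s * (1 - s)^3) * (4 * u^2)"
  define w20 where "w20 = (6 * s^2 * (1 - s)^2) * ((1 - 2 * u)^2)"
  define w21 where "w21 = (6 * s^2 * (1 - s)^2) * (4 * u * (1 - 2 * u))"
  define w22 where "w22 = (6 * s^2 * (1 - s)^2) * (4 * u^2)"
  define w30 where "w30 = (4 * s^3 * (1 - s)) * ((1 - 2 * u)^2)"
  define w31 where "w31 = (4 * s^3 * (1 - s)) * (4 * u * (1 - 2 * u))"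
  define w32 where "w32 = (4 * s^3 * (1 - s)) * (4 * u^2)"
  define w40 where "w40 = (s^4) * ((1 - 2 * u)^2)"
  define w41 where "w41 = (s^4) * (4 * u * (1 - 2 * u))"
  define w42 where "w42 = (s^4) * (4 * u^2)"
  have pos: "0 \<le> w00" "0 \<le> w01" "0 \<le> w02" "0 \<le> w10" "0 \<le> w11" "0 \<le> w12" "0
      \<le> w20" "0 \<le> w21" "0 \<le> w22" "0 \<le> w30" "0 \<le> w31" "0 \<le> w32" "0 \<le> w40" "0 \<le> w41" "0 \<le> w42"
    using s u by (simp_all add: w00_def w01_def w02_def w10_def w11_def w12_def w20_def w21_def w22_def w30_def w31_def w32_def w40_def w41_def w42_def)
  note defs = v1_def v2_def w1_def w2_def c1_def c2_def c3_def
    w00_def w01_def w02_def w10_def w11_def w12_def w20_def w21_def w22_def w30_def w31_def w32_def w40_def w41_def w42_def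
  have X: "A * (\<theta>^2) * ((1 - u) * (2 - u) / 6) + (\<theta> * v1) * ((1 - u) / 2) + B / 2 * (1
      - u) * (\<theta>^2) + (\<theta> * w1) - K * (\<theta>^2) + (((A * \<theta> + v1)^2) * ((1 - u\<^sup>2) / 12)
      + A\<^sup>2 * (\<theta>^2) * ((1 - 4 * u\<^sup>2) / 180)) * (125 / 117) + c1 =
      w00 * (- 35695573 / 351000000) + w01 * (- 29223133 / 351000000) + w02 * (- 69799 / 1170000)
          + w10 * (- 291343747 / 2808000000) + w11 * (- 229178137 / 2808000000) + w12 * (- 3667 / 72000)
          + w20 * (- 1523676607 / 12636000000) + w21 * (- 2451802739 / 25272000000)
          + w22 * (- 534729431 / 8985600000) + w30 * (- 617666107 / 4212000000)
          + w31 * (- 2133214783 / 16848000000) + w32 * (- 3255481 / 38400000) + w40 * (- 22557763 / 131625000)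
          + w41 * (- 342312433 / 2106000000) + w42 * (- 5099519 / 41600000)"
    unfolding A B K th defs by algebra
  have Y: "A * ((2 * \<theta> * (1 - \<theta>))) * ((1 - u) * (2 - u) / 6) + ((\<theta> * v2 + (1
      - \<theta>) * v1)) * ((1 - u) / 2) + B / 2 * (1 - u) * ((2 * \<theta> * (1 - \<theta>))) + ((\<theta> * w2
      + (1 - \<theta>) * w1)) - K * ((2 * \<theta> * (1 - \<theta>))) + (((2 * (A * \<theta> + v1) * (A * (1
      - \<theta>) + v2))) * ((1 - u\<^sup>2) / 12) + A\<^sup>2 * ((2 * \<theta> * (1 - \<theta>))) * ((1
      - 4 * u\<^sup>2) / 180)) * (125 / 117) + c2 =
      w00 * (7557827 / 117000000) + w01 * (3658217 / 117000000) + w02 * (223 / 4875)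
          + w10 * (131447369 / 2808000000) + w11 * (- 5344351 / 2808000000) + w12 * (685537 / 299520000)
          + w20 * (50031193 / 702000000) + w21 * (7617761 / 1404000000) + w22 * (- 30262939 / 4492800000)
          + w30 * (353754581 / 2808000000) + w31 * (65493583 / 1404000000) + w32 * (191341 / 11700000)
          + w40 * (66304181 / 351000000) + w41 * (36890381 / 351000000) + w42 * (3879517 / 62400000)"
    unfolding A B K th defs by algebra
  have Z: "A * ((1 - \<theta>)^2) * ((1 - u) * (2 - u) / 6) + ((1 - \<theta>) * v2) * ((1 - u) / 2) + B / 2 * (1
      - u) * ((1 - \<theta>)^2) + ((1 - \<theta>) * w2) - K * ((1 - \<theta>)^2) + (((A * (1 - \<theta>)
      + v2)^2) * ((1 - u\<^sup>2) / 12) + A\<^sup>2 * ((1 - \<theta>)^2) * ((1 - 4 * u\<^sup>2) / 180)) * (125 / 117) + c3 =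
      w00 * (- 1733831 / 19500000) + w01 * (- 7035577 / 39000000) + w02 * (- 2344171 / 8320000)
          + w10 * (- 7666903 / 117000000) + w11 * (- 17182513 / 117000000) + w12 * (- 24106909 / 99840000)
          + w20 * (- 22271903 / 324000000) + w21 * (- 88063081 / 648000000) + w22 * (- 150724907 / 691200000)
          + w30 * (- 258598993 / 2808000000) + w31 * (- 807346871 / 5616000000) + w32 * (- 314306689 / 1497600000)
          + w40 * (- 21780569 / 175500000) + w41 * (- 113473601 / 702000000) + w42 * (- 79243031 / 374400000)"
    unfolding A B K th defs by algebra
  let ?q = "\<lambda>x y z. x * (d \<bullet> d) + y * (d \<bullet> f) + z * (f \<bullet> f)"
  have c: "w * ?q x y z \<le> 0" if "0 \<le> w" "x < 0" "y * y \<le> 4 * (x * z)" for w x y z :: real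
    by (rule mult_nonneg_nonpos[OF that(1) quad_nonpos[OF that(2,3)]])
  have fin: "w00 * ?q (- 35695573 / 351000000) (7557827 / 117000000) (- 1733831 / 19500000)
      + w01 * ?q (- 29223133 / 351000000) (3658217 / 117000000) (- 7035577 / 39000000)
      + w02 * ?q (- 69799 / 1170000) (223 / 4875) (- 2344171 / 8320000)
      + w10 * ?q (- 291343747 / 2808000000) (131447369 / 2808000000) (- 7666903 / 117000000)
      + w11 * ?q (- 229178137 / 2808000000) (- 5344351 / 2808000000) (- 17182513 / 117000000)
      + w12 * ?q (- 3667 / 72000) (685537 / 299520000) (- 24106909 / 99840000)
      + w20 * ?q (- 1523676607 / 12636000000) (50031193 / 702000000) (- 22271903 / 324000000)
      + w21 * ?q (- 2451802739 / 25272000000) (7617761 / 1404000000) (- 88063081 / 648000000)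
      + w22 * ?q (- 534729431 / 8985600000) (- 30262939 / 4492800000) (- 150724907 / 691200000)
      + w30 * ?q (- 617666107 / 4212000000) (353754581 / 2808000000) (- 258598993 / 2808000000)
      + w31 * ?q (- 2133214783 / 16848000000) (65493583 / 1404000000) (- 807346871 / 5616000000)
      + w32 * ?q (- 3255481 / 38400000) (191341 / 11700000) (- 314306689 / 1497600000)
      + w40 * ?q (- 22557763 / 131625000) (66304181 / 351000000) (- 21780569 / 175500000)
      + w41 * ?q (- 342312433 / 2106000000) (36890381 / 351000000) (- 113473601 / 702000000)
      + w42 * ?q (- 5099519 / 41600000) (3879517 / 62400000) (- 79243031 / 374400000) \<le> 0"
    by (intro add_nonpos_nonpos c pos) simp_all
  have t: "1 / (4 * \<tau>) = (125 / 117)" by (simp add: tau)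
  have vw: "v = v1 *\<^sub>R d + v2 *\<^sub>R f" "w = w1 *\<^sub>R d + w2 *\<^sub>R f"
    unfolding defs by (rule v, rule w)
  note eq = path_form_eq[OF g vw, where A = A and B = B and K = K and t = "(125 / 117)" and u = u and ?c1.0 = c1
      and ?c2.0 = c2 and ?c3.0 = c3,
    unfolded X Y Z, unfolded c1_def c2_def c3_def]
  show ?thesis unfolding t eq
    using fin by (simp only: distrib_left distrib_right mult.assoc)
qed

lemma increment_form_b:
  fixes k c e q H d f :: "'a::real_inner" and s :: real
  assumes s: "0 \<le> s" "s \<le> 1" and th: "\<theta> = (2 / 5) + (3 / 10) * s"
    and cq: "c \<bullet> c \<le> q \<bullet> q" and kd: "k \<bullet> k \<le> d \<bullet> d"
    and aq: "c \<bullet> c + 2 * \<theta> * (k \<bullet> c) + \<theta>\<^sup>2 * (k \<bullet> k)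
        \<le> q \<bullet> q - 2 * \<theta> * (q \<bullet> d) + \<theta>\<^sup>2 * (d \<bullet> d)"
    and He: "H \<bullet> H \<le> e \<bullet> H"
  shows "increment_form \<theta> (11 / 10) (7 / 5) k c e q d + (1 / 25) * (1 - \<theta>) * (e \<bullet> e)
      + (mix s (11 / 10) (7 / 10)) * (e \<bullet> d - d \<bullet> d) + (mix s (1 / 2) (2 / 5)) * (e \<bullet> f - f \<bullet> f)
      \<le> (mix s (1791 / 1000) (1279 / 500)) * (q \<bullet> q) + (mix s (51 / 500) (73 / 250)) * (q \<bullet> H)
          + (mix s (- 563 / 500) (- 262 / 125)) * (q \<bullet> d) + (mix s (21 / 250) (73 / 500)) * (q \<bullet> f)
          + (mix s (- 481 / 1000) (- 277 / 500)) * (H \<bullet> H) + (mix s (53 / 250) (4 / 25)) * (H \<bullet> d)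
          + (mix s (97 / 500) (61 / 250)) * (H \<bullet> f) + (mix s (- 3 / 500) (41 / 200)) * (d \<bullet> d)
          + (mix s (22 / 125) (2 / 25)) * (d \<bullet> f) + (mix s (- 417 / 1000) (- 337 / 1000)) * (f \<bullet> f)"
proof -
  define G0 where "G0 = 63 / 125 * (k \<bullet> k) - 6 / 5 * (k \<bullet> c) + 33 / 25 * (k \<bullet> e)
      + 7 / 25 * (k \<bullet> q) - 1 / 5 * (k \<bullet> d) + 17 / 10 * (c \<bullet> c) - 11 / 5 * (c \<bullet> e)
      - 18 / 25 * (c \<bullet> d) + 217 / 125 * (e \<bullet> e) - 3 / 5 * (e \<bullet> H) - 1 / 2 * (e \<bullet> d)
      - 1 / 2 * (e \<bullet> f) + 91 / 1000 * (q \<bullet> q) + 51 / 500 * (q \<bullet> H)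
      - 63 / 500 * (q \<bullet> d) + 21 / 250 * (q \<bullet> f) + 119 / 1000 * (H \<bullet> H)
      + 53 / 250 * (H \<bullet> d) + 97 / 500 * (H \<bullet> f) + 7 / 20 * (d \<bullet> d)
      + 22 / 125 * (d \<bullet> f) + 83 / 1000 * (f \<bullet> f)"
  define G1 where "G1 = 123 / 500 * (k \<bullet> k) - 9 / 20 * (k \<bullet> c) + 33 / 50 * (k \<bullet> e)
      + 49 / 100 * (k \<bullet> q) - 7 / 20 * (k \<bullet> d) + 11 / 5 * (c \<bullet> c) - 11 / 5 * (c \<bullet> e)
      - 51 / 100 * (c \<bullet> d) + 709 / 500 * (e \<bullet> e) - 4 / 5 * (e \<bullet> H)
      - 2 / 5 * (e \<bullet> d) - 2 / 5 * (e \<bullet> f) + 179 / 500 * (q \<bullet> q)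
      + 73 / 250 * (q \<bullet> H) - 173 / 500 * (q \<bullet> d) + 73 / 500 * (q \<bullet> f)
      + 123 / 500 * (H \<bullet> H) + 4 / 25 * (H \<bullet> d) + 61 / 250 * (H \<bullet> f)
      + 239 / 1000 * (d \<bullet> d) + 2 / 25 * (d \<bullet> f) + 63 / 1000 * (f \<bullet> f)"
  have "0 \<le> (1 - s) * G0" using s gram_b0[where k = k and c = c and e = e and q = q and H = H and d = d and f = f] by (simp add: G0_def)
  moreover have "0 \<le> s * G1" using s gram_b1[where k = k and c = c and e = e and q = q and H = H and d = d
      and f = f] by (simp add: G1_def)
  moreover have "0 \<le> (mix s (1 / 10) (3 / 5)) * (q \<bullet> q - c \<bullet> c)" using s cq
      by (intro mult_nonneg_nonneg add_nonneg_nonneg) auto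
  moreover have "0 \<le> (mix s (7 / 10) (2 / 5)) * (d \<bullet> d - k \<bullet> k)" using s kd
      by (intro mult_nonneg_nonneg add_nonneg_nonneg) auto
  moreover have "0 \<le> (81 / 1000) * (s * (1 - s)) * (d \<bullet> d - k \<bullet> k)" using s kd by (intro mult_nonneg_nonneg) auto
  moreover have "0 \<le> (9 / 10) * (q \<bullet> q - 2 * \<theta> * (q \<bullet> d)
      + \<theta>\<^sup>2 * (d \<bullet> d) - (c \<bullet> c + 2 * \<theta> * (k \<bullet> c)
      + \<theta>\<^sup>2 * (k \<bullet> k)))" using aq by simp
  moreover have "0 \<le> (mix s (3 / 5) (4 / 5)) * (e \<bullet> H - H \<bullet> H)" using s He
      by (intro mult_nonneg_nonneg add_nonneg_nonneg) auto
  ultimately show ?thesis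
    unfolding th G0_def G1_def increment_form_def power2_eq_square by (simp add: field_simps)
qed

lemma path_form_nonpos_c:
  fixes d f g v w :: "'a::real_inner" and s u :: real
  assumes s: "0 \<le> s" "s \<le> 1" and u: "0 \<le> u" "u \<le> 1 / 2" and th: "\<theta> = (7 / 10) + (3 / 10) * s"
    and g: "g = \<theta> *\<^sub>R d + (1 - \<theta>) *\<^sub>R f"
    and v: "v = (mix s (- 164 / 125) (- 2)) *\<^sub>R d + (mix s (27 / 250) (3 / 500)) *\<^sub>R f" and w: "w
        = (mix s (- 8 / 125) 0) *\<^sub>R d + (mix s (103 / 500) (9 / 500)) *\<^sub>R f"
    and A: "A = (mix s (1627 / 1000) (461 / 250))" and B: "B = (mix s (71 / 500) (9 / 50))" and K: "K
        = (mix s (34 / 125) (297 / 1000))" and tau: "\<tau> = (33 / 500)"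
  shows "A * (g \<bullet> g) * ((1 - u) * (2 - u) / 6) + g \<bullet> v * ((1 - u) / 2)
        + B / 2 * (1 - u) * (g \<bullet> g) + g \<bullet> w - K * (g \<bullet> g)
        + 1 / (4 * \<tau>) * ((A *\<^sub>R g + v) \<bullet> (A *\<^sub>R g + v) * (1 - u\<^sup>2) / 12
          + A\<^sup>2 * (g \<bullet> g) * (1 - 4 * u\<^sup>2) / 180)
        + ((mix s (131 / 500) (251 / 500)) * (d \<bullet> d) + (mix s (- 6 / 125) 0) * (d \<bullet> f)
            + (mix s (- 23 / 100) (- 9 / 500)) * (f \<bullet> f)) \<le> 0"
proof -
  define v1 where "v1 = (mix s (- 164 / 125) (- 2))"
  define v2 where "v2 = (mix s (27 / 250) (3 / 500))"
  define w1 where "w1 = (mix s (- 8 / 125) 0)"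
  define w2 where "w2 = (mix s (103 / 500) (9 / 500))"
  define c1 where "c1 = (mix s (131 / 500) (251 / 500))"
  define c2 where "c2 = (mix s (- 6 / 125) 0)"
  define c3 where "c3 = (mix s (- 23 / 100) (- 9 / 500))"
  define w00 where "w00 = ((1 - s)^4) * ((1 - 2 * u)^2)"
  define w01 where "w01 = ((1 - s)^4) * (4 * u * (1 - 2 * u))"
  define w02 where "w02 = ((1 - s)^4) * (4 * u^2)"
  define w10 where "w10 = (4 * s * (1 - s)^3) * ((1 - 2 * u)^2)"
  define w11 where "w11 = (4 * s * (1 - s)^3) * (4 * u * (1 - 2 * u))"
  define w12 where "w12 = (4 * s * (1 - s)^3) * (4 * u^2)"
  define w20 where "w20 = (6 * s^2 * (1 - s)^2) * ((1 - 2 * u)^2)"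
  define w21 where "w21 = (6 * s^2 * (1 - s)^2) * (4 * u * (1 - 2 * u))"
  define w22 where "w22 = (6 * s^2 * (1 - s)^2) * (4 * u^2)"
  define w30 where "w30 = (4 * s^3 * (1 - s)) * ((1 - 2 * u)^2)"
  define w31 where "w31 = (4 * s^3 * (1 - s)) * (4 * u * (1 - 2 * u))"
  define w32 where "w32 = (4 * s^3 * (1 - s)) * (4 * u^2)"
  define w40 where "w40 = (s^4) * ((1 - 2 * u)^2)"
  define w41 where "w41 = (s^4) * (4 * u * (1 - 2 * u))"
  define w42 where "w42 = (s^4) * (4 * u^2)"
  have pos: "0 \<le> w00" "0 \<le> w01" "0 \<le> w02" "0 \<le> w10" "0 \<le> w11" "0 \<le> w12" "0
      \<le> w20" "0 \<le> w21" "0 \<le> w22" "0 \<le> w30" "0 \<le> w31" "0 \<le> w32" "0 \<le> w40" "0 \<le> w41" "0 \<le> w42"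
    using s u by (simp_all add: w00_def w01_def w02_def w10_def w11_def w12_def w20_def w21_def w22_def w30_def w31_def w32_def w40_def w41_def w42_def)
  note defs = v1_def v2_def w1_def w2_def c1_def c2_def c3_def
    w00_def w01_def w02_def w10_def w11_def w12_def w20_def w21_def w22_def w30_def w31_def w32_def w40_def w41_def w42_def
  have X: "A * (\<theta>^2) * ((1 - u) * (2 - u) / 6) + (\<theta> * v1) * ((1 - u) / 2) + B / 2 * (1
      - u) * (\<theta>^2) + (\<theta> * w1) - K * (\<theta>^2) + (((A * \<theta> + v1)^2) * ((1 - u\<^sup>2) / 12)
      + A\<^sup>2 * (\<theta>^2) * ((1 - 4 * u\<^sup>2) / 180)) * (125 / 33) + c1 =
      w00 * (- 11283839 / 297000000) + w01 * (- 37474241 / 1188000000) + w02 * (- 3032493 / 140800000)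
          + w10 * (- 168277 / 6000000) + w11 * (- 1025771 / 48000000) + w12 * (- 307173 / 28160000)
          + w20 * (- 19106683 / 891000000) + w21 * (- 7034039 / 445500000) + w22 * (- 1577 / 256000)
          + w30 * (- 55271 / 3300000) + w31 * (- 371713 / 26400000) + w32 * (- 5211 / 704000)
          + w40 * (- 16477 / 1485000) + w41 * (- 5233 / 371250) + w42 * (- 1209 / 88000)"
    unfolding A B K th defs by algebra
  have Y: "A * ((2 * \<theta> * (1 - \<theta>))) * ((1 - u) * (2 - u) / 6) + ((\<theta> * v2 + (1
      - \<theta>) * v1)) * ((1 - u) / 2) + B / 2 * (1 - u) * ((2 * \<theta> * (1 - \<theta>))) + ((\<theta> * w2
      + (1 - \<theta>) * w1)) - K * ((2 * \<theta> * (1 - \<theta>))) + (((2 * (A * \<theta> + v1) * (A * (1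
      - \<theta>) + v2))) * ((1 - u\<^sup>2) / 12) + A\<^sup>2 * ((2 * \<theta> * (1 - \<theta>))) * ((1
      - 4 * u\<^sup>2) / 180)) * (125 / 33) + c2 =
      w00 * (1941821 / 99000000) + w01 * (- 6634613 / 198000000) + w02 * (- 4594937 / 70400000)
          + w10 * (29160953 / 792000000) + w11 * (- 4361441 / 396000000) + w12 * (- 1162389 / 28160000)
          + w20 * (58099433 / 1188000000) + w21 * (12602003 / 1188000000) + w22 * (- 22659 / 1408000)
          + w30 * (3742819 / 79200000) + w31 * (59837 / 2475000) + w32 * (42853 / 7040000) + w40 * (449 / 22000)
          + w41 * (173 / 8800) + w42 * (1677 / 88000)"
    unfolding A B K th defs by algebra
  have Z: "A * ((1 - \<theta>)^2) * ((1 - u) * (2 - u) / 6) + ((1 - \<theta>) * v2) * ((1 - u) / 2) + B / 2 * (1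
      - u) * ((1 - \<theta>)^2) + ((1 - \<theta>) * w2) - K * ((1 - \<theta>)^2) + (((A * (1 - \<theta>)
      + v2)^2) * ((1 - u\<^sup>2) / 12) + A\<^sup>2 * ((1 - \<theta>)^2) * ((1 - 4 * u\<^sup>2) / 180)) * (125 / 33) + c3 =
      w00 * (- 67693 / 16500000) + w01 * (- 3703109 / 132000000) + w02 * (- 11117333 / 140800000)
          + w10 * (- 14245513 / 264000000) + w11 * (- 35222531 / 528000000) + w12 * (- 666957 / 7040000)
          + w20 * (- 30854713 / 396000000) + w21 * (- 32654533 / 396000000) + w22 * (- 130769 / 1408000)
          + w30 * (- 30269 / 440000) + w31 * (- 4847 / 70400) + w32 * (- 7597 / 110000) + w40 * (- 1583 / 88000)
          + w41 * (- 1583 / 88000) + w42 * (- 6333 / 352000)"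
    unfolding A B K th defs by algebra
  let ?q = "\<lambda>x y z. x * (d \<bullet> d) + y * (d \<bullet> f) + z * (f \<bullet> f)"
  have c: "w * ?q x y z \<le> 0" if "0 \<le> w" "x < 0" "y * y \<le> 4 * (x * z)" for w x y z :: real
    by (rule mult_nonneg_nonpos[OF that(1) quad_nonpos[OF that(2,3)]])
  have fin: "w00 * ?q (- 11283839 / 297000000) (1941821 / 99000000) (- 67693 / 16500000)
      + w01 * ?q (- 37474241 / 1188000000) (- 6634613 / 198000000) (- 3703109 / 132000000)
      + w02 * ?q (- 3032493 / 140800000) (- 4594937 / 70400000) (- 11117333 / 140800000)
      + w10 * ?q (- 168277 / 6000000) (29160953 / 792000000) (- 14245513 / 264000000)
      + w11 * ?q (- 1025771 / 48000000) (- 4361441 / 396000000) (- 35222531 / 528000000)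
      + w12 * ?q (- 307173 / 28160000) (- 1162389 / 28160000) (- 666957 / 7040000)
      + w20 * ?q (- 19106683 / 891000000) (58099433 / 1188000000) (- 30854713 / 396000000)
      + w21 * ?q (- 7034039 / 445500000) (12602003 / 1188000000) (- 32654533 / 396000000)
      + w22 * ?q (- 1577 / 256000) (- 22659 / 1408000) (- 130769 / 1408000)
      + w30 * ?q (- 55271 / 3300000) (3742819 / 79200000) (- 30269 / 440000)
      + w31 * ?q (- 371713 / 26400000) (59837 / 2475000) (- 4847 / 70400)
      + w32 * ?q (- 5211 / 704000) (42853 / 7040000) (- 7597 / 110000)
      + w40 * ?q (- 16477 / 1485000) (449 / 22000) (- 1583 / 88000)
      + w41 * ?q (- 5233 / 371250) (173 / 8800) (- 1583 / 88000) + w42 * ?q (- 1209 / 88000) (1677 / 88000) (- 6333 / 352000) \<le> 0"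
    by (intro add_nonpos_nonpos c pos) simp_all
  have t: "1 / (4 * \<tau>) = (125 / 33)" by (simp add: tau)
  have vw: "v = v1 *\<^sub>R d + v2 *\<^sub>R f" "w = w1 *\<^sub>R d + w2 *\<^sub>R f"
    unfolding defs by (rule v, rule w)
  note eq = path_form_eq[OF g vw, where A = A and B = B and K = K and t = "(125 / 33)" and u = u and ?c1.0 = c1
      and ?c2.0 = c2 and ?c3.0 = c3,
    unfolded X Y Z, unfolded c1_def c2_def c3_def]
  show ?thesis unfolding t eq
    using fin by (simp only: distrib_left distrib_right mult.assoc)
qed

lemma increment_form_c:
  fixes k c e q H d f :: "'a::real_inner" and s :: real
  assumes s: "0 \<le> s" "s \<le> 1" and th: "\<theta> = (7 / 10) + (3 / 10) * s"
    and cq: "c \<bullet> c \<le> q \<bullet> q" and kd: "k \<bullet> k \<le> d \<bullet> d"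
    and aq: "c \<bullet> c + 2 * \<theta> * (k \<bullet> c) + \<theta>\<^sup>2 * (k \<bullet> k)
        \<le> q \<bullet> q - 2 * \<theta> * (q \<bullet> d) + \<theta>\<^sup>2 * (d \<bullet> d)"
    and He: "H \<bullet> H \<le> e \<bullet> H"
  shows "increment_form \<theta> (1 / 2) 1 k c e q d + (1 / 4) * (1 - \<theta>) * (e \<bullet> e)
      + (mix s (19 / 100) 0) * (e \<bullet> d - d \<bullet> d) + (mix s (31 / 100) (1 / 50)) * (e \<bullet> f - f \<bullet> f)
      \<le> (mix s (1627 / 1000) (461 / 250)) * (q \<bullet> q) + (mix s (71 / 500) (9 / 50)) * (q \<bullet> H)
          + (mix s (- 164 / 125) (- 2)) * (q \<bullet> d) + (mix s (27 / 250) (3 / 500)) * (q \<bullet> f)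
          + (mix s (- 34 / 125) (- 297 / 1000)) * (H \<bullet> H) + (mix s (- 8 / 125) 0) * (H \<bullet> d)
          + (mix s (103 / 500) (9 / 500)) * (H \<bullet> f) + (mix s (131 / 500) (251 / 500)) * (d \<bullet> d)
          + (mix s (- 6 / 125) 0) * (d \<bullet> f) + (mix s (- 23 / 100) (- 9 / 500)) * (f \<bullet> f)"
proof -
  define G0 where "G0 = 13 / 50 * (k \<bullet> k) + 1 / 20 * (k \<bullet> c) + 3 / 10 * (k \<bullet> e)
      + 7 / 20 * (k \<bullet> q) - 7 / 20 * (k \<bullet> d) + 147 / 100 * (c \<bullet> c) - (c \<bullet> e)
      - 13 / 20 * (c \<bullet> d) + 23 / 40 * (e \<bullet> e) - 41 / 100 * (e \<bullet> H)
      + 11 / 100 * (e \<bullet> d) - 31 / 100 * (e \<bullet> f) + 157 / 1000 * (q \<bullet> q)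
      + 71 / 500 * (q \<bullet> H) - 131 / 500 * (q \<bullet> d) + 27 / 250 * (q \<bullet> f)
      + 69 / 500 * (H \<bullet> H) - 8 / 125 * (H \<bullet> d) + 103 / 500 * (H \<bullet> f)
      + 24 / 125 * (d \<bullet> d) - 6 / 125 * (d \<bullet> f) + 2 / 25 * (f \<bullet> f)"
  define G1 where "G1 = 1 / 4 * (k \<bullet> k) + 1 / 2 * (k \<bullet> c) + 1 / 2 * (k \<bullet> q)
      - 1 / 2 * (k \<bullet> d) + 151 / 100 * (c \<bullet> c) - (c \<bullet> e) - 1 / 2 * (c \<bullet> d)
      + 1 / 2 * (e \<bullet> e) - 11 / 20 * (e \<bullet> H) - 1 / 50 * (e \<bullet> f)
      + 167 / 500 * (q \<bullet> q) + 9 / 50 * (q \<bullet> H) - 1 / 2 * (q \<bullet> d)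
      + 3 / 500 * (q \<bullet> f) + 253 / 1000 * (H \<bullet> H) + 9 / 500 * (H \<bullet> f)
      + 63 / 250 * (d \<bullet> d) + 1 / 500 * (f \<bullet> f)"
  have "0 \<le> (1 - s) * G0" using s gram_c0[where k = k and c = c and e = e and q = q and H = H and d = d and f = f] by (simp add: G0_def)
  moreover have "0 \<le> s * G1" using s gram_c1[where k = k and c = c and e = e and q = q and H = H and d = d
      and f = f] by (simp add: G1_def)
  moreover have "0 \<le> (mix s (47 / 100) (51 / 100)) * (q \<bullet> q - c \<bullet> c)" using s cq
      by (intro mult_nonneg_nonneg add_nonneg_nonneg) auto
  moreover have "0 \<le> (mix s (19 / 100) 0) * (d \<bullet> d - k \<bullet> k)" using s kd
      by (intro mult_nonneg_nonneg add_nonneg_nonneg) auto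
  moreover have "0 \<le> (9 / 200) * (s * (1 - s)) * (d \<bullet> d - k \<bullet> k)" using s kd by (intro mult_nonneg_nonneg) auto
  moreover have "0 \<le> (1 / 2) * (q \<bullet> q - 2 * \<theta> * (q \<bullet> d)
      + \<theta>\<^sup>2 * (d \<bullet> d) - (c \<bullet> c + 2 * \<theta> * (k \<bullet> c)
      + \<theta>\<^sup>2 * (k \<bullet> k)))" using aq by simp
  moreover have "0 \<le> (mix s (41 / 100) (11 / 20)) * (e \<bullet> H - H \<bullet> H)" using s He
      by (intro mult_nonneg_nonneg add_nonneg_nonneg) auto
  ultimately show ?thesis
    unfolding th G0_def G1_def increment_form_def power2_eq_square by (simp add: field_simps)
qed

section \<open>One epoch\<close>

text \<open>The term \<open>ze * (e \<bullet> d - d \<bullet> d) + ch * (e \<bullet> f - f \<bullet> f)\<close> is nonnegative after summation over an epoch, by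
  firm nonexpansiveness of the proximal map on the damped and on the discarded part of the step.\<close>

definition certificate :: "real \<Rightarrow> real \<Rightarrow> real \<Rightarrow> real \<Rightarrow> 'a::real_inner \<Rightarrow> 'a \<Rightarrow> bool" where
  "certificate \<theta> b m \<omega> d f \<longleftrightarrow> (\<exists>A B K \<tau> v w C0 ze ch.
     A \<ge> 0 \<and> B \<ge> 0 \<and> \<tau> > 0 \<and> A / 8 + \<tau> \<le> K \<and> ze \<ge> 0 \<and> ch \<ge> 0 \<and>
     (\<forall>k c e q H. c \<bullet> c \<le> q \<bullet> q \<longrightarrow> k \<bullet> k \<le> d \<bullet> d \<longrightarrow>
        c \<bullet> c + 2 * \<theta> * (k \<bullet> c) + \<theta>\<^sup>2 * (k \<bullet> k) \<le> q \<bullet> q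
            - 2 * \<theta> * (q \<bullet> d) + \<theta>\<^sup>2 * (d \<bullet> d) \<longrightarrow>
        H \<bullet> H \<le> e \<bullet> H \<longrightarrow>
        increment_form \<theta> b \<omega> k c e q d + m * (1 - \<theta>) * (e \<bullet> e) + ze * (e \<bullet> d
            - d \<bullet> d) + ch * (e \<bullet> f - f \<bullet> f)
          \<le> A * (q \<bullet> q) + B * (q \<bullet> H) - K * (H \<bullet> H) + q \<bullet> v + H \<bullet> w + C0) \<and>
     (\<forall>u g. 0 \<le> u \<longrightarrow> u \<le> 1 / 2 \<longrightarrow> g = \<theta> *\<^sub>R d + (1
         - \<theta>) *\<^sub>R f \<longrightarrow>
        A * (g \<bullet> g) * ((1 - u) * (2 - u) / 6) + g \<bullet> v * ((1 - u) / 2)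
        + B / 2 * (1 - u) * (g \<bullet> g) + g \<bullet> w - K * (g \<bullet> g)
        + 1 / (4 * \<tau>) * ((A *\<^sub>R g + v) \<bullet> (A *\<^sub>R g + v) * (1 - u\<^sup>2) / 12
          + A\<^sup>2 * (g \<bullet> g) * (1 - 4 * u\<^sup>2) / 180) + C0 \<le> 0))"

section \<open>The three ranges of the damping parameter\<close>

lemma certificate_a:
  assumes "0 \<le> \<theta>" "\<theta> \<le> (2 / 5)"
  shows "certificate \<theta> (11 / 10) (1 / 25) (101 / 50) d f"
proof -
  define s where "s = (\<theta> - 0) / (2 / 5)"
  have s: "0 \<le> s" "s \<le> 1" and th: "\<theta> = 0 + (2 / 5) * s" using assms by (simp_all add: s_def field_simps)
  define v where "v = (mix s 0 (- 261 / 250)) *\<^sub>R d + (mix s 0 (19 / 500)) *\<^sub>R f"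
  define w where "w = (mix s (11 / 500) (62 / 125)) *\<^sub>R d + (mix s (3 / 25) (22 / 125)) *\<^sub>R f"
  define C0 where "C0 = (mix s (- 19 / 1000) (- 11 / 500)) * (d \<bullet> d)
      + (mix s (1 / 500) (2 / 25)) * (d \<bullet> f) + (mix s (- 61 / 500) (- 51 / 250)) * (f \<bullet> f)"
  show ?thesis unfolding certificate_def
  proof (intro exI conjI allI impI)
    show "0 \<le> (mix s (871 / 500) (232 / 125))" "0 \<le> (mix s 0 (59 / 250))" "0 < ((511 / 1000)::real)" "(mix s (871 / 500) (232 / 125)) / 8 + (511 / 1000) \<le> (mix s (729 / 1000) (819 / 1000))" "0 \<le> (mix s (153 / 100) (23 / 20))" "0 \<le> (mix s (13 / 100) (11 / 50))"
      using s by (simp_all add: field_simps)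
    fix k c e q H :: 'a
    assume "c \<bullet> c \<le> q \<bullet> q" "k \<bullet> k \<le> d \<bullet> d" "H \<bullet> H \<le> e \<bullet> H"
      "c \<bullet> c + 2 * \<theta> * (k \<bullet> c) + \<theta>\<^sup>2 * (k \<bullet> k) \<le> q \<bullet> q
          - 2 * \<theta> * (q \<bullet> d) + \<theta>\<^sup>2 * (d \<bullet> d)"
    note increment_form_a[OF s th this(1,2,4,3), of f]
    moreover have "q \<bullet> v = (mix s 0 (- 261 / 250)) * (q \<bullet> d)
        + (mix s 0 (19 / 500)) * (q \<bullet> f)" "H \<bullet> w = (mix s (11 / 500) (62 / 125)) * (H \<bullet> d)
        + (mix s (3 / 25) (22 / 125)) * (H \<bullet> f)"
      by (simp_all only: v_def w_def inner_add_right inner_scaleR_right)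
    moreover have "(mix s (- 729 / 1000) (- 819 / 1000)) * (H \<bullet> H) =
        - ((mix s (729 / 1000) (819 / 1000)) * (H \<bullet> H))" by (simp add: algebra_simps)
    ultimately show "increment_form \<theta> (11 / 10) (101 / 50) k c e q d + (1 / 25) * (1
        - \<theta>) * (e \<bullet> e) + (mix s (153 / 100) (23 / 20)) * (e \<bullet> d - d \<bullet> d)
        + (mix s (13 / 100) (11 / 50)) * (e \<bullet> f - f \<bullet> f)
          \<le> (mix s (871 / 500) (232 / 125)) * (q \<bullet> q) + (mix s 0 (59 / 250)) * (q \<bullet> H)
              - (mix s (729 / 1000) (819 / 1000)) * (H \<bullet> H) + q \<bullet> v + H \<bullet> w + C0"
      unfolding C0_def by linarith
  next
    fix u :: real and g :: 'a
    assume "0 \<le> u" "u \<le> 1 / 2" "g = \<theta> *\<^sub>R d + (1 - \<theta>) *\<^sub>R f"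
    then show "(mix s (871 / 500) (232 / 125)) * (g \<bullet> g) * ((1 - u) * (2 - u) / 6) + g \<bullet> v * ((1 - u) / 2)
        + (mix s 0 (59 / 250)) / 2 * (1 - u) * (g \<bullet> g) + g \<bullet> w - (mix s (729 / 1000) (819 / 1000)) * (g \<bullet> g)
        + 1 / (4 * (511 / 1000)) * (((mix s (871 / 500) (232 / 125)) *\<^sub>R g
            + v) \<bullet> ((mix s (871 / 500) (232 / 125)) *\<^sub>R g + v) * (1 - u\<^sup>2) / 12
          + (mix s (871 / 500) (232 / 125))\<^sup>2 * (g \<bullet> g) * (1 - 4 * u\<^sup>2) / 180) + C0 \<le> 0"
      unfolding C0_def by (rule path_form_nonpos_a[OF s _ _ th _ v_def w_def refl refl refl refl])
  qed
qed

lemma certificate_b: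
  assumes "(2 / 5) \<le> \<theta>" "\<theta> \<le> (7 / 10)"
  shows "certificate \<theta> (11 / 10) (1 / 25) (7 / 5) d f"
proof -
  define s where "s = (\<theta> - (2 / 5)) / (3 / 10)"
  have s: "0 \<le> s" "s \<le> 1" and th: "\<theta> = (2 / 5) + (3 / 10) * s" using assms by (simp_all add: s_def field_simps)
  define v where "v = (mix s (- 563 / 500) (- 262 / 125)) *\<^sub>R d + (mix s (21 / 250) (73 / 500)) *\<^sub>R f"
  define w where "w = (mix s (53 / 250) (4 / 25)) *\<^sub>R d + (mix s (97 / 500) (61 / 250)) *\<^sub>R f"
  define C0 where "C0 = (mix s (- 3 / 500) (41 / 200)) * (d \<bullet> d)
      + (mix s (22 / 125) (2 / 25)) * (d \<bullet> f) + (mix s (- 417 / 1000) (- 337 / 1000)) * (f \<bullet> f)"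
  show ?thesis unfolding certificate_def
  proof (intro exI conjI allI impI)
    show "0 \<le> (mix s (1791 / 1000) (1279 / 500))" "0 \<le> (mix s (51 / 500) (73 / 250))" "0 < ((117 / 500)::real)" "(mix s (1791 / 1000) (1279 / 500)) / 8 + (117 / 500) \<le> (mix s (481 / 1000) (277 / 500))" "0 \<le> (mix s (11 / 10) (7 / 10))" "0 \<le> (mix s (1 / 2) (2 / 5))"
      using s by (simp_all add: field_simps)
    fix k c e q H :: 'a
    assume "c \<bullet> c \<le> q \<bullet> q" "k \<bullet> k \<le> d \<bullet> d" "H \<bullet> H \<le> e \<bullet> H"
      "c \<bullet> c + 2 * \<theta> * (k \<bullet> c) + \<theta>\<^sup>2 * (k \<bullet> k) \<le> q \<bullet> q
          - 2 * \<theta> * (q \<bullet> d) + \<theta>\<^sup>2 * (d \<bullet> d)"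
    note increment_form_b[OF s th this(1,2,4,3), of f]
    moreover have "q \<bullet> v = (mix s (- 563 / 500) (- 262 / 125)) * (q \<bullet> d)
        + (mix s (21 / 250) (73 / 500)) * (q \<bullet> f)" "H \<bullet> w
        = (mix s (53 / 250) (4 / 25)) * (H \<bullet> d) + (mix s (97 / 500) (61 / 250)) * (H \<bullet> f)"
      by (simp_all only: v_def w_def inner_add_right inner_scaleR_right)
    moreover have "(mix s (- 481 / 1000) (- 277 / 500)) * (H \<bullet> H) =
        - ((mix s (481 / 1000) (277 / 500)) * (H \<bullet> H))" by (simp add: algebra_simps)
    ultimately show "increment_form \<theta> (11 / 10) (7 / 5) k c e q d + (1 / 25) * (1
        - \<theta>) * (e \<bullet> e) + (mix s (11 / 10) (7 / 10)) * (e \<bullet> d - d \<bullet> d)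
        + (mix s (1 / 2) (2 / 5)) * (e \<bullet> f - f \<bullet> f)
          \<le> (mix s (1791 / 1000) (1279 / 500)) * (q \<bullet> q)
              + (mix s (51 / 500) (73 / 250)) * (q \<bullet> H)
              - (mix s (481 / 1000) (277 / 500)) * (H \<bullet> H) + q \<bullet> v + H \<bullet> w + C0"
      unfolding C0_def by linarith
  next
    fix u :: real and g :: 'a
    assume "0 \<le> u" "u \<le> 1 / 2" "g = \<theta> *\<^sub>R d + (1 - \<theta>) *\<^sub>R f"
    then show "(mix s (1791 / 1000) (1279 / 500)) * (g \<bullet> g) * ((1 - u) * (2 - u) / 6) + g \<bullet> v * ((1 - u) / 2)
        + (mix s (51 / 500) (73 / 250)) / 2 * (1 - u) * (g \<bullet> g) + g \<bullet> w - (mix s (481 / 1000) (277 / 500)) * (g \<bullet> g)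
        + 1 / (4 * (117 / 500)) * (((mix s (1791 / 1000) (1279 / 500)) *\<^sub>R g
            + v) \<bullet> ((mix s (1791 / 1000) (1279 / 500)) *\<^sub>R g + v) * (1 - u\<^sup>2) / 12
          + (mix s (1791 / 1000) (1279 / 500))\<^sup>2 * (g \<bullet> g) * (1 - 4 * u\<^sup>2) / 180) + C0 \<le> 0"
      unfolding C0_def by (rule path_form_nonpos_b[OF s _ _ th _ v_def w_def refl refl refl refl])
  qed
qed

lemma certificate_c:
  assumes "(7 / 10) \<le> \<theta>" "\<theta> \<le> 1"
  shows "certificate \<theta> (1 / 2) (1 / 4) 1 d f"
proof -
  define s where "s = (\<theta> - (7 / 10)) / (3 / 10)"
  have s: "0 \<le> s" "s \<le> 1" and th: "\<theta> = (7 / 10) + (3 / 10) * s" using assms by (simp_all add: s_def field_simps)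
  define v where "v = (mix s (- 164 / 125) (- 2)) *\<^sub>R d + (mix s (27 / 250) (3 / 500)) *\<^sub>R f"
  define w where "w = (mix s (- 8 / 125) 0) *\<^sub>R d + (mix s (103 / 500) (9 / 500)) *\<^sub>R f"
  define C0 where "C0 = (mix s (131 / 500) (251 / 500)) * (d \<bullet> d) + (mix s (- 6 / 125) 0) * (d \<bullet> f)
      + (mix s (- 23 / 100) (- 9 / 500)) * (f \<bullet> f)"
  show ?thesis unfolding certificate_def
  proof (intro exI conjI allI impI)
    show "0 \<le> (mix s (1627 / 1000) (461 / 250))" "0 \<le> (mix s (71 / 500) (9 / 50))" "0 < ((33 / 500)::real)" "(mix s (1627 / 1000) (461 / 250)) / 8 + (33 / 500) \<le> (mix s (34 / 125) (297 / 1000))" "0 \<le> (mix s (19 / 100) 0)" "0 \<le> (mix s (31 / 100) (1 / 50))"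
      using s by (simp_all add: field_simps)
    fix k c e q H :: 'a
    assume "c \<bullet> c \<le> q \<bullet> q" "k \<bullet> k \<le> d \<bullet> d" "H \<bullet> H \<le> e \<bullet> H"
      "c \<bullet> c + 2 * \<theta> * (k \<bullet> c) + \<theta>\<^sup>2 * (k \<bullet> k) \<le> q \<bullet> q
          - 2 * \<theta> * (q \<bullet> d) + \<theta>\<^sup>2 * (d \<bullet> d)"
    note increment_form_c[OF s th this(1,2,4,3), of f]
    moreover have "q \<bullet> v = (mix s (- 164 / 125) (- 2)) * (q \<bullet> d)
        + (mix s (27 / 250) (3 / 500)) * (q \<bullet> f)" "H \<bullet> w = (mix s (- 8 / 125) 0) * (H \<bullet> d)
        + (mix s (103 / 500) (9 / 500)) * (H \<bullet> f)"
      by (simp_all only: v_def w_def inner_add_right inner_scaleR_right)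
    moreover have "(mix s (- 34 / 125) (- 297 / 1000)) * (H \<bullet> H) =
        - ((mix s (34 / 125) (297 / 1000)) * (H \<bullet> H))" by (simp add: algebra_simps)
    ultimately show "increment_form \<theta> (1 / 2) 1 k c e q d + (1 / 4) * (1 - \<theta>) * (e \<bullet> e)
        + (mix s (19 / 100) 0) * (e \<bullet> d - d \<bullet> d) + (mix s (31 / 100) (1 / 50)) * (e \<bullet> f - f \<bullet> f)
          \<le> (mix s (1627 / 1000) (461 / 250)) * (q \<bullet> q) + (mix s (71 / 500) (9 / 50)) * (q \<bullet> H)
              - (mix s (34 / 125) (297 / 1000)) * (H \<bullet> H) + q \<bullet> v + H \<bullet> w + C0"
      unfolding C0_def by linarith
  next
    fix u :: real and g :: 'a
    assume "0 \<le> u" "u \<le> 1 / 2" "g = \<theta> *\<^sub>R d + (1 - \<theta>) *\<^sub>R f"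
    then show "(mix s (1627 / 1000) (461 / 250)) * (g \<bullet> g) * ((1 - u) * (2 - u) / 6) + g \<bullet> v * ((1 - u) / 2)
        + (mix s (71 / 500) (9 / 50)) / 2 * (1 - u) * (g \<bullet> g) + g \<bullet> w - (mix s (34 / 125) (297 / 1000)) * (g \<bullet> g)
        + 1 / (4 * (33 / 500)) * (((mix s (1627 / 1000) (461 / 250)) *\<^sub>R g
            + v) \<bullet> ((mix s (1627 / 1000) (461 / 250)) *\<^sub>R g + v) * (1 - u\<^sup>2) / 12
          + (mix s (1627 / 1000) (461 / 250))\<^sup>2 * (g \<bullet> g) * (1 - 4 * u\<^sup>2) / 180) + C0 \<le> 0"
      unfolding C0_def by (rule path_form_nonpos_c[OF s _ _ th _ v_def w_def refl refl refl refl])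
  qed
qed

section \<open>Descent along an arbitrary visiting order\<close>

lemma grad_step_nonexpansive:
  fixes x y :: "'a::real_inner"
  assumes coco: "\<And>x y. \<phi> y \<ge> \<phi> x + D x \<bullet> (y - x) + 1 / 4 * ((D y - D x) \<bullet> (D y - D x))"
  shows "((y - D y) - (x - D x)) \<bullet> ((y - D y) - (x - D x)) \<le> (y - x) \<bullet> (y - x)"
proof -
  have "(y - D y) - (x - D x) = (y - x) - (D y - D x)" by simp
  then have "((y - D y) - (x - D x)) \<bullet> ((y - D y) - (x - D x)) =
    (y - x) \<bullet> (y - x) - 2 * ((D y - D x) \<bullet> (y - x)) + (D y - D x) \<bullet> (D y - D x)"
    by (simp only: inner_diff_left[of "y - x"] inner_diff_right[of _ "y - x"] inner_commute[of "y - x" "D y - D x"])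
  \<comment> \<open>Cocoercivity, from the hypothesis for both orders of the points. Its constant is
    exactly what a unit step needs.\<close>
  moreover have "(D y - D x) \<bullet> (D y - D x) \<le> 2 * ((D y - D x) \<bullet> (y - x))"
    using coco[of x y] coco[of y x]
    by (simp add: inner_diff_left inner_diff_right inner_commute) argo
  ultimately show ?thesis by linarith
qed

lemma prox_firmly_nonexpansive:
  fixes P :: "'a::real_inner \<Rightarrow> 'a"
  assumes prox: "\<And>w w'. R (P w') \<ge> R (P w) + (w - P w) \<bullet> (P w' - P w)"
  shows "(P w' - P w) \<bullet> (P w' - P w) \<le> (w' - w) \<bullet> (P w' - P w)"
  using prox[where w = w and w' = w'] prox[where w = w' and w' = w]
  by (simp add: inner_diff_left inner_diff_right inner_commute)

text \<open>For each index the change of \<open>\<phi> j\<close> and of the squared residual is at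
  most \<open>\<theta>\<close> times \<open>increment_form\<close> plus a linear term, and the
  linear terms cancel in the sum. The certificate dominates the increments by a form in the path
  \<open>q\<close> with steps \<open>H\<close>; \<open>path_form\<close> collapses that to the end
  point, where the second half of the certificate makes it nonpositive.\<close>

lemma epoch_descent:
  fixes \<phi> :: "nat \<Rightarrow> 'a::real_inner \<Rightarrow> real" and R :: "'a \<Rightarrow> real"
  assumes n: "n \<ge> 2" and th: "0 < \<theta>" "\<theta> < 1" and om: "0 \<le> \<omega>" "\<omega> * \<theta> \<le> 1"
    and certificate: "\<And>d f :: 'a. certificate \<theta> b m \<omega> d f"
    and coco: "\<And>j x y. j < n \<Longrightarrow> \<phi> j y \<ge> \<phi> j x + D j x \<bullet> (y - x)
        + 1 / 4 * ((D j y - D j x) \<bullet> (D j y - D j x))"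
    and prox: "\<And>w w'. R (P w') \<ge> R (P w) + (w - P w) \<bullet> (P w' - P w)"
    and w0: "w 0 = (\<Sum>j<n. \<zeta> j) /\<^sub>R real n" and wS: "\<And>j. j < n \<Longrightarrow> w (Suc j)
        = w j + e j /\<^sub>R real n"
    and e: "\<And>j. j < n \<Longrightarrow> e j = P (w j) - D j (P (w j)) - \<zeta> j"
    and x: "x = P (w 0)" and x': "x' = P (w 0 + \<theta> *\<^sub>R (w n - w 0))"
  shows "(\<Sum>j<n. \<phi> j x') + real n * R x'
      + b * (\<Sum>j<n. (\<zeta> j + \<theta> *\<^sub>R e j - (x' - D j x')) \<bullet> (\<zeta> j + \<theta> *\<^sub>R e j - (x' - D j x')))
      + m * \<theta> * (1 - \<theta>) * (\<Sum>j<n. e j \<bullet> e j)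
    \<le> (\<Sum>j<n. \<phi> j x) + real n * R x
      + b * (\<Sum>j<n. (\<zeta> j - (x - D j x)) \<bullet> (\<zeta> j - (x - D j x)))"
proof -
  define N where "N = real n"
  have N: "N \<ge> 2" using n by (simp add: N_def)
  define w' where "w' = w 0 + \<theta> *\<^sub>R (w n - w 0)"
  define \<Delta> where "\<Delta> = x' - x"
  define d where "d = \<Delta> /\<^sub>R \<theta>"
  define y where "y j = P (w j)" for j
  \<comment> \<open>\<open>d\<close> is the displacement kept by the damping and \<open>f\<close>
    the one discarded, each rescaled to a full epoch. The undamped displacement \<open>q n\<close>
    is therefore their convex combination.\<close>
  define f where "f = (y n - x') /\<^sub>R (1 - \<theta>)"
  define H where "H j = N *\<^sub>R (y (Suc j) - y j)" for j
  define G where "G j z = z - D j z" for j z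
  define c where "c j = G j (y j) - G j x" for j
  define k where "k j = (G j x - G j x') /\<^sub>R \<theta>" for j
  define q where "q j = (\<Sum>l<j. H l) /\<^sub>R real n" for j
  define E where "E = (\<Sum>j<n. e j)"
  have xy: "x = y 0" by (simp add: x y_def)
  have qy: "q j = y j - x" for j
  proof -
    have "(\<Sum>l<j. H l) = N *\<^sub>R (y j - x)"
      unfolding H_def scaleR_sum_right[symmetric] xy by (simp add: sum_lessThan_telescope)
    then show ?thesis using N by (simp add: q_def N_def)
  qed
  have \<Delta>: "\<Delta> = \<theta> *\<^sub>R d" using th by (simp add: d_def)
  have g: "q n = \<theta> *\<^sub>R d + (1 - \<theta>) *\<^sub>R f"
    using th unfolding \<Delta>[symmetric] by (simp add: f_def qy \<Delta>_def)
  have wsum: "w j = w 0 + (\<Sum>l<j. e l) /\<^sub>R N" if "j \<le> n" for j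
    using that by (induction j) (auto simp: wS N_def scaleR_right_distrib)
  have wn: "N *\<^sub>R (w n - w 0) = E" using wsum[of n] N by (simp add: E_def)
  have w'0: "N *\<^sub>R (w' - w 0) = \<theta> *\<^sub>R E" unfolding wn[symmetric] w'_def by simp
  have wn': "N *\<^sub>R (w n - w') = (1 - \<theta>) *\<^sub>R E"
    unfolding wn[symmetric] w'_def by (simp add: algebra_simps)
  note fne = prox_firmly_nonexpansive[of R P, OF prox]
  have Ed: "N * (d \<bullet> d) \<le> E \<bullet> d"
  proof -
    have "\<Delta> \<bullet> \<Delta> \<le> (w' - w 0) \<bullet> \<Delta>"
      using fne[of w' "w 0"] by (simp add: \<Delta>_def x x' w'_def)
    then have "N * (\<Delta> \<bullet> \<Delta>) \<le> (N *\<^sub>R (w' - w 0)) \<bullet> \<Delta>" using N by simp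
    then have "\<theta> * \<theta> * (N * (d \<bullet> d)) \<le> \<theta> * \<theta> * (E \<bullet> d)"
        unfolding w'0 \<Delta> by (simp add: mult_ac)
    then show ?thesis using th by simp
  qed
  have Ef: "N * (f \<bullet> f) \<le> E \<bullet> f"
  proof -
    have f': "y n - x' = (1 - \<theta>) *\<^sub>R f" using th by (simp add: f_def)
    have "(y n - x') \<bullet> (y n - x') \<le> (w n - w') \<bullet> (y n - x')"
      using fne[of "w n" w'] by (simp add: x' w'_def y_def)
    then have "N * ((y n - x') \<bullet> (y n - x')) \<le> (N *\<^sub>R (w n - w')) \<bullet> (y n - x')" using N by simp
    then have "(1 - \<theta>) * (1 - \<theta>) * (N * (f \<bullet> f)) \<le> (1 - \<theta>) * (1
        - \<theta>) * (E \<bullet> f)" unfolding wn' f' by (simp add: mult_ac)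
    then show ?thesis using th by (simp add: mult_le_cancel_left)
  qed
  have ne: "(G j y' - G j x'') \<bullet> (G j y' - G j x'') \<le> (y' - x'') \<bullet> (y' - x'')" if "j < n" for j y' x''
    unfolding G_def by (rule grad_step_nonexpansive) (rule coco[OF that])
  have ga: "G j (y j) - G j x' = c j + \<theta> *\<^sub>R k j" for j using th by (simp add: c_def k_def)
  have c1: "c j \<bullet> c j \<le> q j \<bullet> q j" if "j < n" for j using ne[OF that, of "y j" x] by (simp add: c_def qy)
  have c2: "k j \<bullet> k j \<le> d \<bullet> d" if "j < n" for j
  proof -
    have "(\<theta> *\<^sub>R k j) \<bullet> (\<theta> *\<^sub>R k j) \<le> \<Delta> \<bullet> \<Delta>"
      using ne[OF that, of x x'] th by (simp add: k_def \<Delta>_def inner_diff inner_commute)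
    then show ?thesis using th unfolding \<Delta> by (simp add: mult_le_cancel_left)
  qed
  have c3: "c j \<bullet> c j + 2 * \<theta> * (k j \<bullet> c j) + \<theta>\<^sup>2 * (k j \<bullet> k j)
      \<le> q j \<bullet> q j - 2 * \<theta> * (q j \<bullet> d) + \<theta>\<^sup>2 * (d \<bullet> d)" if "j < n" for j
  proof -
    have "y j - x' = q j - \<theta> *\<^sub>R d" unfolding \<Delta>[symmetric] by (simp add: qy \<Delta>_def)
    then have "(c j + \<theta> *\<^sub>R k j) \<bullet> (c j + \<theta> *\<^sub>R k j) \<le> (q j
        - \<theta> *\<^sub>R d) \<bullet> (q j - \<theta> *\<^sub>R d)"
      using ne[OF that, of "y j" x'] by (simp only: ga)
    then show ?thesis by (simp add: inner_add inner_diff inner_commute power2_eq_square algebra_simps)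
  qed
  have c4: "H j \<bullet> H j \<le> e j \<bullet> H j" if "j < n" for j
  proof -
    have "(y (Suc j) - y j) \<bullet> (y (Suc j) - y j) \<le> (w (Suc j) - w j) \<bullet> (y (Suc j) - y j)"
      unfolding y_def by (rule fne)
    then have "N * N * ((y (Suc j) - y j) \<bullet> (y (Suc j) - y j)) \<le> N * N * ((w (Suc j) - w j) \<bullet> (y (Suc j) - y j))"
      using N by simp
    also have "\<dots> = (N *\<^sub>R (w (Suc j) - w j)) \<bullet> H j" by (simp add: H_def)
    also have "N *\<^sub>R (w (Suc j) - w j) = e j" using N wS[OF that] by (simp add: N_def)
    finally show ?thesis by (simp add: H_def mult_ac)
  qed
  have it: "\<phi> j x' - \<phi> j x + (w' - x') \<bullet> \<Delta>
      + b * ((\<zeta> j + \<theta> *\<^sub>R e j - G j x') \<bullet> (\<zeta> j + \<theta> *\<^sub>R e j - G j x')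
          - (\<zeta> j - G j x) \<bullet> (\<zeta> j - G j x))
    \<le> \<theta> * increment_form \<theta> b \<omega> (k j) (c j) (e j) (q j) d + (w' - \<zeta> j
        - \<theta> *\<^sub>R e j) \<bullet> \<Delta>" if j: "j < n" for j
  proof -
    define a where "a = c j + \<theta> *\<^sub>R k j"
    have Gy: "G j (y j) = \<zeta> j + e j" using e[OF j] by (simp add: G_def y_def)
    have Gx: "G j x = \<zeta> j + e j - c j" and Gx': "G j x' = \<zeta> j + e j - a"
      using ga[of j] by (simp_all add: c_def Gy[symmetric] a_def algebra_simps)
    have Dy: "D j (y j) = y j - \<zeta> j - e j" using Gy by (simp add: G_def algebra_simps)
    have Dx: "D j x = x - \<zeta> j - e j + c j" using Gx by (simp add: G_def algebra_simps)
    have Dx': "D j x' = x' - \<zeta> j - e j + a" using Gx' by (simp add: G_def algebra_simps)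
    have yq: "y j = x + q j" by (simp add: qy)
    have x'D: "x' = x + \<Delta>" by (simp add: \<Delta>_def)
    define s where "s = q j - c j"
    define t where "t = q j - \<Delta> - a"
    have dd: "D j x - D j x' = - (s - t)" "D j x - D j (y j) = - s" "D j (y j) - D j x' = t"
      unfolding Dx Dx' Dy s_def t_def using yq x'D by (simp_all add: algebra_simps)
    \<comment> \<open>Two upper bounds for the same difference: directly between x and x', and, in
      \<open>three\<close>, through the point at which the gradient was evaluated. They are
      interpolated with weight \<open>\<omega> * \<theta>\<close>, which therefore has to lie
      between 0 and 1.\<close>
    have pair: "\<phi> j x' - \<phi> j x \<le> D j x' \<bullet> \<Delta> - 1 / 4 * ((s - t) \<bullet> (s - t))"
      using coco[OF j, of x' x] unfolding dd inner_minus_left inner_minus_right minus_minus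
      by (simp add: \<Delta>_def inner_diff_right[of "D j x'"])
    have "\<phi> j x' - \<phi> j x \<le> D j (y j) \<bullet> q j + D j x' \<bullet> (\<Delta> - q j)
        - 1 / 4 * (s \<bullet> s) - 1 / 4 * (t \<bullet> t)"
      using coco[OF j, of "y j" x] coco[OF j, of x' "y j"] unfolding dd
      by (simp add: x'D yq inner_diff_right inner_add_right)
    also have "\<dots> = D j x' \<bullet> \<Delta> + (D j (y j) - D j x') \<bullet> q j - 1 / 4 * (s \<bullet> s) - 1 / 4 * (t \<bullet> t)"
      by (simp add: inner_diff)
    also have "\<dots> = D j x' \<bullet> \<Delta> - 1 / 4 * ((s - t) \<bullet> (s - t)) + 1 / 2 * ((q j + c j) \<bullet> t)"
      unfolding dd by (simp add: s_def inner_diff inner_add inner_commute algebra_simps)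
    finally have three: "\<phi> j x' - \<phi> j x \<le> D j x' \<bullet> \<Delta> - 1 / 4 * ((s - t) \<bullet> (s
        - t)) + 1 / 2 * ((q j + c j) \<bullet> t)" .
    have conv: "p \<le> X + l * Y" if "p \<le> X" "p \<le> X + Y" "0 \<le> l" "l \<le> 1" for p X Y l :: real
    proof -
      have "(1 - l) * p + l * p \<le> (1 - l) * X + l * (X + Y)"
        using that by (intro add_mono mult_left_mono) auto
      then show ?thesis by (simp add: algebra_simps)
    qed
    have "\<phi> j x' - \<phi> j x \<le> D j x' \<bullet> \<Delta> - 1 / 4 * ((s - t) \<bullet> (s - t))
        + (\<omega> * \<theta>) * (1 / 2 * ((q j + c j) \<bullet> t))"
      using om th by (intro conv[OF pair three]) auto
    also have "D j x' \<bullet> \<Delta> = (w' - \<zeta> j - \<theta> *\<^sub>R e j) \<bullet> \<Delta> - (w'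
        - x') \<bullet> \<Delta> - (1 - \<theta>) * (e j \<bullet> \<Delta>) + a \<bullet> \<Delta>"
      by (simp add: Dx' inner_diff_left inner_add_left algebra_simps)
    finally have 1: "\<phi> j x' - \<phi> j x + (w' - x') \<bullet> \<Delta> \<le> (w' - \<zeta> j
        - \<theta> *\<^sub>R e j) \<bullet> \<Delta> - (1 - \<theta>) * (e j \<bullet> \<Delta>) + a \<bullet> \<Delta>
      - 1 / 4 * ((s - t) \<bullet> (s - t)) + (\<omega> * \<theta>) * (1 / 2 * ((q j + c j) \<bullet> t))" by simp
    have st: "s - t = \<theta> *\<^sub>R (d + k j)" by (simp add: s_def t_def a_def \<Delta> algebra_simps)
    have t': "t = q j - c j - \<theta> *\<^sub>R (d + k j)" by (simp add: t_def a_def \<Delta> algebra_simps)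
    have 2: "- (1 - \<theta>) * (e j \<bullet> \<Delta>) + a \<bullet> \<Delta> - 1 / 4 * ((s - t) \<bullet> (s
        - t)) + (\<omega> * \<theta>) * (1 / 2 * ((q j + c j) \<bullet> t))
       + b * ((\<zeta> j + \<theta> *\<^sub>R e j - G j x') \<bullet> (\<zeta> j + \<theta> *\<^sub>R e j - G j x')
           - (\<zeta> j - G j x) \<bullet> (\<zeta> j - G j x))
      = \<theta> * increment_form \<theta> b \<omega> (k j) (c j) (e j) (q j) d"
    proof -
      have "\<zeta> j + \<theta> *\<^sub>R e j - G j x' = c j + \<theta> *\<^sub>R k j - (1 - \<theta>) *\<^sub>R e j"
        by (simp add: Gx' a_def algebra_simps)
      moreover have "\<zeta> j - G j x = c j - e j" by (simp add: Gx)
      moreover have "- (1 - \<theta>) * (e \<bullet> (\<theta> *\<^sub>R d)) + (c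
          + \<theta> *\<^sub>R k) \<bullet> (\<theta> *\<^sub>R d) - 1 / 4 * ((\<theta> *\<^sub>R (d
          + k)) \<bullet> (\<theta> *\<^sub>R (d + k)))
          + (\<omega> * \<theta>) * (1 / 2 * ((q + c) \<bullet> (q - c - \<theta> *\<^sub>R (d + k))))
       + b * ((c + \<theta> *\<^sub>R k - (1 - \<theta>) *\<^sub>R e) \<bullet> (c + \<theta> *\<^sub>R k - (1
           - \<theta>) *\<^sub>R e) - (c - e) \<bullet> (c - e))
         = \<theta> * increment_form \<theta> b \<omega> k c e q d" for k c e q :: 'a
        unfolding increment_form_def
        by (simp only: inner_add_left inner_add_right inner_diff_left inner_diff_right inner_scaleR_left inner_scaleR_right
            inner_commute[of c e] inner_commute[of e k] inner_commute[of c k] inner_commute[of d k] inner_commute[of d e]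
            inner_commute[of c q] inner_commute[of q k] inner_commute[of d c]) (simp add: field_simps)
      ultimately show ?thesis unfolding st unfolding t' a_def \<Delta> by simp
    qed
    show ?thesis using 1 2 by linarith
  qed
  obtain A B K \<tau> v wv C0 ze ch where AB: "A \<ge> 0" "B \<ge> 0" "\<tau> > 0" "A / 8 + \<tau> \<le> K" "ze \<ge> 0" "ch \<ge> 0"
    and itm: "\<And>k c e q H. c \<bullet> c \<le> q \<bullet> q \<Longrightarrow> k \<bullet> k \<le> d \<bullet> d \<Longrightarrow>
        c \<bullet> c + 2 * \<theta> * (k \<bullet> c) + \<theta>\<^sup>2 * (k \<bullet> k) \<le> q \<bullet> q
            - 2 * \<theta> * (q \<bullet> d) + \<theta>\<^sup>2 * (d \<bullet> d) \<Longrightarrow>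
        H \<bullet> H \<le> e \<bullet> H \<Longrightarrow>
        increment_form \<theta> b \<omega> k c e q d + m * (1 - \<theta>) * (e \<bullet> e) + ze * (e \<bullet> d
            - d \<bullet> d) + ch * (e \<bullet> f - f \<bullet> f)
          \<le> A * (q \<bullet> q) + B * (q \<bullet> H) - K * (H \<bullet> H) + q \<bullet> v + H \<bullet> wv + C0"
    and fin: "\<And>u g. 0 \<le> u \<Longrightarrow> u \<le> 1 / 2 \<Longrightarrow> g = \<theta> *\<^sub>R d + (1
        - \<theta>) *\<^sub>R f \<Longrightarrow>
        A * (g \<bullet> g) * ((1 - u) * (2 - u) / 6) + g \<bullet> v * ((1 - u) / 2)
        + B / 2 * (1 - u) * (g \<bullet> g) + g \<bullet> wv - K * (g \<bullet> g)
        + 1 / (4 * \<tau>) * ((A *\<^sub>R g + v) \<bullet> (A *\<^sub>R g + v) * (1 - u\<^sup>2) / 12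
          + A\<^sup>2 * (g \<bullet> g) * (1 - 4 * u\<^sup>2) / 180) + C0 \<le> 0"
    using certificate[of d f] unfolding certificate_def by blast
  let ?I = "\<lambda>j. increment_form \<theta> b \<omega> (k j) (c j) (e j) (q j) d"
  have "(\<Sum>j<n. ?I j + m * (1 - \<theta>) * (e j \<bullet> e j) + ze * (e j \<bullet> d - d \<bullet> d)
      + ch * (e j \<bullet> f - f \<bullet> f))
      \<le> (\<Sum>j<n. (A * (q j \<bullet> q j) + B * (q j \<bullet> H j) - K * (H j \<bullet> H j)
          + q j \<bullet> v + H j \<bullet> wv) + C0)"
    by (intro sum_mono itm c1 c2 c3 c4) auto
  also have "\<dots> = (\<Sum>j<n. A * (q j \<bullet> q j) + B * (q j \<bullet> H j) - K * (H j \<bullet> H j)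
      + q j \<bullet> v + H j \<bullet> wv) + N * C0"
    unfolding sum.distrib[of _ "\<lambda>j. C0"] by (simp add: N_def)
  also have "\<dots> \<le> N * (A * (q n \<bullet> q n) * ((1 - 1/N) * (2 - 1/N) / 6) + q n \<bullet> v * ((1 - 1/N) / 2)
        + B / 2 * (1 - 1/N) * (q n \<bullet> q n) + q n \<bullet> wv - K * (q n \<bullet> q n)
        + 1 / (4 * \<tau>) * ((A *\<^sub>R q n + v) \<bullet> (A *\<^sub>R q n + v) * (1 - (1/N)\<^sup>2) / 12
          + A\<^sup>2 * (q n \<bullet> q n) * (1 - 4 * (1/N)\<^sup>2) / 180) + C0)"
    unfolding distrib_left[of N _ C0] unfolding N_def q_def by (intro add_right_mono path_form n AB)
  also have "\<dots> \<le> 0"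
    using N by (intro mult_nonneg_nonpos fin g) (auto simp: field_simps)
  finally have "(\<Sum>j<n. ?I j) + m * (1 - \<theta>) * (\<Sum>j<n. e j \<bullet> e j) + ze * (E \<bullet> d
      - N * (d \<bullet> d)) + ch * (E \<bullet> f - N * (f \<bullet> f)) \<le> 0"
    by (simp add: sum.distrib sum_subtractf sum_distrib_left[symmetric] E_def inner_sum_left N_def)
  moreover have "0 \<le> ze * (E \<bullet> d - N * (d \<bullet> d))" "0 \<le> ch * (E \<bullet> f
      - N * (f \<bullet> f))" using AB Ed Ef by auto
  ultimately have "(\<Sum>j<n. ?I j) + m * (1 - \<theta>) * (\<Sum>j<n. e j \<bullet> e j) \<le> 0" by linarith
  then have "\<theta> * ((\<Sum>j<n. ?I j) + m * (1 - \<theta>) * (\<Sum>j<n. e j \<bullet> e j)) \<le> 0"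
    using th by (intro mult_nonneg_nonpos) auto
  then have I0: "\<theta> * (\<Sum>j<n. ?I j) + m * \<theta> * (1 - \<theta>) * (\<Sum>j<n. e j \<bullet> e j) \<le> 0"
    by (simp add: algebra_simps)
  have "(\<Sum>j<n. \<phi> j x' - \<phi> j x + (w' - x') \<bullet> \<Delta>
      + b * ((\<zeta> j + \<theta> *\<^sub>R e j - G j x') \<bullet> (\<zeta> j + \<theta> *\<^sub>R e j - G j x')
          - (\<zeta> j - G j x) \<bullet> (\<zeta> j - G j x)))
    \<le> (\<Sum>j<n. \<theta> * ?I j + (w' - \<zeta> j - \<theta> *\<^sub>R e j) \<bullet> \<Delta>)"
    by (intro sum_mono it) auto
  also have "\<dots> = \<theta> * (\<Sum>j<n. ?I j) + (\<Sum>j<n. (w' - \<zeta> j - \<theta> *\<^sub>R e j)) \<bullet> \<Delta>"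
    by (simp add: sum.distrib sum_distrib_left inner_sum_left)
  \<comment> \<open>n times the damped average \<open>w'\<close> is the sum of the damped table
    entries.\<close>
  also have "(\<Sum>j<n. (w' - \<zeta> j - \<theta> *\<^sub>R e j)) = N *\<^sub>R w' - N *\<^sub>R w 0 - \<theta> *\<^sub>R E"
    using N by (simp add: sum_subtractf scaleR_sum_right[symmetric] E_def w0 N_def sum_constant_scaleR)
  also have "\<dots> = 0" using w'0 by (simp add: algebra_simps)
  finally have "(\<Sum>j<n. \<phi> j x') - (\<Sum>j<n. \<phi> j x) + N * ((w' - x') \<bullet> \<Delta>)
      + b * (\<Sum>j<n. (\<zeta> j + \<theta> *\<^sub>R e j - G j x') \<bullet> (\<zeta> j + \<theta> *\<^sub>R e j - G j x'))
      - b * (\<Sum>j<n. (\<zeta> j - G j x) \<bullet> (\<zeta> j - G j x)) \<le> \<theta> * (\<Sum>j<n. ?I j)"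
    by (simp add: sum.distrib sum_subtractf sum_distrib_left[symmetric] right_diff_distrib N_def)
  \<comment> \<open>\<open>R\<close> is linearised at the new point. The term with
    \<open>w' - x'\<close> that \<open>it\<close> adds to every index pays for it.\<close>
  moreover have "N * (R x' - R x) \<le> N * ((w' - x') \<bullet> \<Delta>)"
  proof (intro mult_left_mono)
    have "R (P (w 0)) \<ge> R (P w') + (w' - P w') \<bullet> (P (w 0) - P w')" by (rule prox)
    then show "R x' - R x \<le> (w' - x') \<bullet> \<Delta>"
      by (simp add: x x' w'_def \<Delta>_def inner_diff_right)
  qed (use N in auto)
  ultimately show ?thesis using I0
    unfolding G_def N_def by (simp add: right_diff_distrib)
qed

text \<open>The weights of the telescoping potential satisfy a discrete Riccati inequality; \<open>\<kappa> / t - a t\<close> is a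
  truncation of the cotangent that solves the continuous Riccati equation. The optimal constant, in the limit of
  large \<open>n\<close>, is about 2.351.\<close>

lemma hardy_partial_sums:
  fixes e :: "nat \<Rightarrow> real"
  shows "(\<Sum>j<n. (e j + (\<Sum>l<j. e l) / real n)\<^sup>2) \<le> 2367 / 1000 * (\<Sum>j<n. (e j)\<^sup>2)"
proof (cases "n = 0")
  case False
  define U where "U j = (\<Sum>l<j. e l) / real n" for j
  define h where "h = 1 / real n"
  \<comment> \<open>\<open>a\<close> rounds up (sqrt 3 - 1) / 2, the positive root of a^2 = (1 +
    a)(3 a - 1): this is \<open>disc\<close> in the worst case t = 1. The choice
    \<open>\<kappa>\<close> = 1 + a makes \<open>c 1\<close> vanish, so that no terminal term is
    left, and the constant obtained is 1 + \<open>\<kappa>\<close>.\<close>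
  define a :: real where "a = 367 / 1000"
  define \<kappa> :: real where "\<kappa> = 1367 / 1000"
  define c where "c t = \<kappa> / t - a * t - 1" for t
  have h: "h > 0" "h * real n = 1" using False by (auto simp: h_def)
  have "(\<Sum>j<m. (e j + U j)\<^sup>2) + c (real m * h) * (U m)\<^sup>2 / h \<le> 2367 / 1000 * (\<Sum>j<m. (e j)\<^sup>2)"
    if "1 \<le> m" "m \<le> n" for m
    using that
  proof (induction m rule: dec_induct)
    case base
    have "c h \<le> \<kappa> / h" using h by (simp add: c_def a_def)
    then have "c h * h \<le> \<kappa>" using h by (simp add: field_simps)
    then have "(e 0)\<^sup>2 * (c h * h) \<le> (e 0)\<^sup>2 * \<kappa>" by (intro mult_left_mono) auto
    moreover have "U 1 = h * e 0" by (simp add: U_def h_def)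
    then have "c h * (U 1)\<^sup>2 / h = (e 0)\<^sup>2 * (c h * h)" using h by (simp add: power2_eq_square)
    moreover have "U 0 = 0" by (simp add: U_def)
    ultimately show ?case by (simp add: \<kappa>_def)
  next
    case (step m)
    define x where "x = real m * h"
    define t where "t = x + h"
    define u where "u = e m"
    define v where "v = U m"
    have x: "x > 0" using step h by (simp add: x_def)
    have t: "real (Suc m) * h = t" "t > 0" using x h by (simp_all add: t_def x_def algebra_simps)
    have t1: "t \<le> 1"
      unfolding t(1)[symmetric] using step.prems h mult_right_mono[of "real (Suc m)" "real n" h] by (simp add: mult.commute)
    have xt: "x = t - h" by (simp add: t_def)
    have US: "U (Suc m) = v + u * h" using False by (simp add: U_def v_def u_def h_def add_divide_distrib)
    define \<alpha> where "\<alpha> = \<kappa> - h * c t"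
    define \<beta> where "\<beta> = 1 + c t"
    define \<gamma> where "\<gamma> = (c x - c t) / h - 1"
    have \<alpha>: "\<alpha> = \<kappa> * x / t + h * (1 + a * t)"
    proof -
      have "\<kappa> * x / t = \<kappa> - h * (\<kappa> / t)"
        using t by (simp add: xt right_diff_distrib diff_divide_distrib mult.commute)
      then show ?thesis by (simp add: \<alpha>_def c_def right_diff_distrib distrib_left)
    qed
    have \<gamma>: "\<gamma> = \<kappa> / (t * x) - (1 - a)"
    proof -
      have "\<kappa> / x - \<kappa> / t = (\<kappa> * t - \<kappa> * x) / (x * t)"
        using t x by (intro diff_frac_eq) auto
      also have "\<kappa> * t - \<kappa> * x = h * \<kappa>" by (simp add: xt algebra_simps)
      finally have "\<kappa> / x - \<kappa> / t = h * (\<kappa> / (t * x))" by (simp add: mult.commute)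
      moreover have "c x - c t = (\<kappa> / x - \<kappa> / t) + h * a" by (simp add: c_def xt algebra_simps)
      ultimately have "c x - c t = h * (\<kappa> / (t * x) + a)" by (simp only: distrib_left)
      then show ?thesis using h by (simp add: \<gamma>_def)
    qed
    have "t * x \<le> 1 * 1" using t t1 x h by (intro mult_mono) (auto simp: t_def)
    then have "\<kappa> / 1 \<le> \<kappa> / (t * x)" using t x by (intro divide_left_mono) (auto simp: \<kappa>_def)
    then have g0: "\<gamma> \<ge> 0" by (simp add: \<gamma> \<kappa>_def a_def)
    have a0: "\<alpha> > 0" unfolding \<alpha> using t x h by (intro add_pos_pos mult_pos_pos divide_pos_pos) (auto simp: \<kappa>_def a_def intro: add_pos_pos)
    have "\<alpha> * \<gamma> = \<kappa>\<^sup>2 / t\<^sup>2 - \<kappa> * (1 - a) * (x / t) + h * (1 + a * t) * \<gamma>"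
    proof -
      have "\<kappa> * x / t * (\<kappa> / (t * x)) = \<kappa>\<^sup>2 / t\<^sup>2" using x by (simp add: power2_eq_square)
      moreover have "\<kappa> * x / t * (1 - a) = \<kappa> * (1 - a) * (x / t)" by (simp add: field_simps)
      ultimately have "\<kappa> * x / t * \<gamma> = \<kappa>\<^sup>2 / t\<^sup>2 - \<kappa> * (1 - a) * (x / t)"
        unfolding \<gamma> right_diff_distrib[of "\<kappa> * x / t"] by (simp only:)
      then show ?thesis unfolding \<alpha> distrib_right by simp
    qed
    also have "\<dots> \<ge> \<kappa>\<^sup>2 / t\<^sup>2 - \<kappa> * (1 - a) * 1 + 0"
      using x t h g0 by (intro add_mono diff_mono mult_left_mono mult_nonneg_nonneg) (auto simp: \<kappa>_def a_def t_def)
    finally have ag: "\<alpha> * \<gamma> \<ge> \<kappa>\<^sup>2 / t\<^sup>2 - \<kappa> * (1 - a)" by simp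
    have "\<beta>\<^sup>2 = (\<kappa> / t - a * t)\<^sup>2" by (simp add: \<beta>_def c_def)
    also have "\<dots> = \<kappa>\<^sup>2 / t\<^sup>2 - 2 * a * \<kappa> + a\<^sup>2 * t\<^sup>2"
      using t by (simp add: power2_diff power_divide power_mult_distrib)
    also have "\<dots> \<le> \<kappa>\<^sup>2 / t\<^sup>2 - \<kappa> * (1 - a)"
      using power_le_one[of t 2] t t1 by (simp add: \<kappa>_def a_def power2_eq_square)
    also note ag
    finally have disc: "\<beta>\<^sup>2 \<le> \<alpha> * \<gamma>" .
    have "0 \<le> (\<alpha> * u - \<beta> * v)\<^sup>2 + (\<alpha> * \<gamma> - \<beta>\<^sup>2) * v\<^sup>2"
        using disc by (intro add_nonneg_nonneg mult_nonneg_nonneg) auto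
    also have "\<dots> = \<alpha> * (\<alpha> * u\<^sup>2 - 2 * \<beta> * (u * v) + \<gamma> * v\<^sup>2)" by algebra
    finally have "0 \<le> \<alpha> * u\<^sup>2 - 2 * \<beta> * (u * v) + \<gamma> * v\<^sup>2" using a0 by (simp add: zero_le_mult_iff)
    moreover have "(u + v)\<^sup>2 + ct * (v + u * h)\<^sup>2 / h - cx * v\<^sup>2 / h =
        2367 / 1000 * u\<^sup>2 - ((1367 / 1000 - h * ct) * u\<^sup>2 - 2 * (1 + ct) * (u * v) + ((cx - ct) / h - 1) * v\<^sup>2)" for cx ct
      using h by (simp add: field_simps power2_eq_square)
    note this[of "c t" "c x"]
    ultimately have "(u + v)\<^sup>2 + c t * (v + u * h)\<^sup>2 / h \<le> 2367 / 1000 * u\<^sup>2 + c x * v\<^sup>2 / h"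
      unfolding \<alpha>_def \<beta>_def \<gamma>_def \<kappa>_def by linarith
    moreover have "(\<Sum>j<m. (e j + U j)\<^sup>2) + c x * v\<^sup>2 / h \<le> 2367 / 1000 * (\<Sum>j<m. (e j)\<^sup>2)"
      using step unfolding x_def v_def by simp
    ultimately show ?case unfolding t US sum.lessThan_Suc distrib_left u_def[symmetric] v_def[symmetric] by linarith
  qed
  from this[of n] False h have "(\<Sum>j<n. (e j + U j)\<^sup>2) + c 1 * (U n)\<^sup>2 / h \<le> 2367 / 1000 * (\<Sum>j<n. (e j)\<^sup>2)"
    by (simp add: mult.commute)
  then show ?thesis by (simp add: c_def a_def \<kappa>_def U_def)
qed simp

text \<open>The functions and table entries are numbered from \<open>0\<close> in the order in which the epoch visits them.\<close>

locale epoch_path =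
  fixes n :: nat and \<phi> :: "nat \<Rightarrow> 'a::real_inner \<Rightarrow> real" and D :: "nat \<Rightarrow> 'a \<Rightarrow> 'a"
    and P :: "'a \<Rightarrow> 'a" and R :: "'a \<Rightarrow> real" and w \<zeta> e zs :: "nat \<Rightarrow> 'a" and xs :: 'a
  assumes n: "n \<ge> 1"
    and coco: "\<And>j x y. j < n \<Longrightarrow> \<phi> j y \<ge> \<phi> j x + D j x \<bullet> (y - x)
        + 1 / 4 * ((D j y - D j x) \<bullet> (D j y - D j x))"
    and prox: "\<And>w w'. R (P w') \<ge> R (P w) + (w - P w) \<bullet> (P w' - P w)"
    and w0: "w 0 = (\<Sum>j<n. \<zeta> j) /\<^sub>R real n" and wS: "\<And>j. j < n \<Longrightarrow> w (Suc j)
        = w j + e j /\<^sub>R real n"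
    and e: "\<And>j. j < n \<Longrightarrow> e j = P (w j) - D j (P (w j)) - \<zeta> j"
    and zs: "\<And>j. j < n \<Longrightarrow> zs j = xs - D j xs" and xs: "P ((\<Sum>j<n. zs j) /\<^sub>R real n) = xs"
begin

definition ws where "ws = (\<Sum>j<n. zs j) /\<^sub>R real n"
definition table where "table j l = (if l < j then \<zeta> l + e l else \<zeta> l) - zs l"
definition energy where "energy j = (\<Sum>l<n. table j l \<bullet> table j l)"
text \<open>By \<open>table_sum\<close> the centre \<open>w j - ws\<close> is the mean of the
  entries, so this is their variance.\<close>

definition var where "var j = (\<Sum>l<n. (table j l - (w j - ws)) \<bullet> (table j l - (w j - ws))) / real n"
definition \<gamma> where "\<gamma> j = w j - ws - (P (w j) - xs)"
text \<open>The squared norm lost in the proximal map: that of \<open>w j - ws\<close> minus that of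
  \<open>P (w j) - xs\<close>, whose difference is \<open>\<gamma> j\<close>.\<close>

definition loss_r where "loss_r j = 2 * (\<gamma> j \<bullet> (P (w j) - xs)) + \<gamma> j \<bullet> \<gamma> j"
text \<open>The squared norm lost in the gradient step: that of \<open>P (w j) - xs\<close> minus
  that of the error of the new table entry.\<close>

definition loss_f where "loss_f j = 2 * ((D j (P (w j)) - D j xs) \<bullet> (P (w j) - xs))
  - (D j (P (w j)) - D j xs) \<bullet> (D j (P (w j)) - D j xs)"

lemma firm: "(P u' - P u) \<bullet> (P u' - P u) \<le> (u' - u) \<bullet> (P u' - P u)"
  using prox by (rule prox_firmly_nonexpansive)

lemma w_eq: "j \<le> n \<Longrightarrow> w j = w 0 + (\<Sum>l<j. e l) /\<^sub>R real n"
  by (induction j) (auto simp: wS scaleR_right_distrib)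

lemma table_sum: assumes "j \<le> n" shows "(\<Sum>l<n. table j l) = real n *\<^sub>R (w j - ws)"
proof -
  have "(\<Sum>l<n. table j l) = (\<Sum>l<n. \<zeta> l) + (\<Sum>l<n. if l < j then e l else 0) - (\<Sum>l<n. zs l)"
    unfolding sum.distrib[symmetric] sum_subtractf[symmetric] by (intro sum.cong) (auto simp: table_def)
  also have "(\<Sum>l<n. if l < j then e l else 0) = (\<Sum>l<j. e l)"
    using assms by (intro sum.mono_neutral_cong_right) auto
  finally show ?thesis using w_eq[OF assms] n by (simp add: w0 ws_def algebra_simps)
qed

lemma gamma_nonneg: "\<gamma> j \<bullet> (P (w j) - xs) \<ge> 0"
  using firm[of "w j" ws] xs unfolding ws_def[symmetric] by (simp add: \<gamma>_def inner_diff_left)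

lemma loss_r_nonneg: "loss_r j \<ge> 0"
  using gamma_nonneg[of j] by (simp add: loss_r_def)

lemma loss_f_nonneg: "j < n \<Longrightarrow> loss_f j \<ge> 0"
  using grad_step_nonexpansive[OF coco, of j "P (w j)" xs]
  by (simp add: loss_f_def inner_diff_left inner_diff_right inner_commute)

lemma var_nonneg: "var j \<ge> 0"
  by (simp add: var_def sum_nonneg)

text \<open>The update replaces one entry, which still has its initial value. The squared error of
  the new entry is that of the mean \<open>w j - ws\<close> minus both losses, and the squared mean
  is the energy over n minus the variance.\<close>

lemma energy_Suc:
  assumes j: "j < n"
  shows "energy (Suc j) = (1 + 1 / real n) * energy j - table 0 j \<bullet> table 0 j - (var j + loss_r j + loss_f j)"
proof -
  define c where "c = \<zeta> j + e j - zs j"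
  define wt where "wt = w j - ws"
  have "energy (Suc j) = (\<Sum>l\<in>{..<n} - {j}. table (Suc j) l \<bullet> table (Suc j) l) + c \<bullet> c"
    unfolding energy_def using j by (subst sum.remove[of _ j]) (auto simp: table_def c_def)
  also have "(\<Sum>l\<in>{..<n} - {j}. table (Suc j) l \<bullet> table (Suc j) l) = (\<Sum>l\<in>{..<n}
      - {j}. table j l \<bullet> table j l)"
    by (intro sum.cong) (auto simp: table_def less_Suc_eq)
  also have "\<dots> = energy j - table 0 j \<bullet> table 0 j"
    unfolding energy_def using j by (subst sum.remove[of "{..<n}" j]) (auto simp: table_def)
  finally have 1: "energy (Suc j) = energy j - table 0 j \<bullet> table 0 j + c \<bullet> c" .
  have "real n * var j = energy j - 2 * ((\<Sum>l<n. table j l) \<bullet> wt) + real n * (wt \<bullet> wt)"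
  proof -
    have "(table j l - wt) \<bullet> (table j l - wt) = table j l \<bullet> table j l
        - 2 * (table j l \<bullet> wt) + wt \<bullet> wt" for l
      by (simp add: inner_diff inner_commute)
    then show ?thesis using n
      by (simp add: var_def wt_def[symmetric] energy_def sum.distrib sum_subtractf sum_distrib_left[symmetric] inner_sum_left)
  qed
  also have "\<dots> = energy j - real n * (wt \<bullet> wt)"
    using j by (simp add: table_sum wt_def)
  finally have 2: "wt \<bullet> wt = energy j / real n - var j" using n by (simp add: field_simps)
  have "c = (P (w j) - xs) - (D j (P (w j)) - D j xs)"
    using e[OF j] zs[OF j] by (simp add: c_def)
  then have 3: "c \<bullet> c = (P (w j) - xs) \<bullet> (P (w j) - xs) - loss_f j"
    by (simp only: loss_f_def inner_diff_left[of "P (w j) - xs"] inner_diff_right[of _ "P (w j)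
        - xs"] inner_commute[of "P (w j) - xs" "D j (P (w j)) - D j xs"])
  have "wt = \<gamma> j + (P (w j) - xs)" by (simp add: \<gamma>_def wt_def)
  then have 4: "wt \<bullet> wt = loss_r j + (P (w j) - xs) \<bullet> (P (w j) - xs)"
    by (simp only: loss_r_def inner_add_left[of "\<gamma> j"] inner_add_right[of _ "\<gamma> j"] inner_commute[of "P (w j) - xs" "\<gamma> j"])
  show ?thesis using 1 2 3 4 by (simp add: distrib_right)
qed

lemma norm_w_diff: assumes "j \<le> n" shows "norm (w j - w 0) \<le> (\<Sum>l<j. norm (e l)) / real n"
  using w_eq[OF assms] norm_sum[of e "{..<j}"] by (simp add: divide_inverse mult.commute mult_left_mono)

lemma norm_P_diff: "norm (P w' - P w'') \<le> norm (w' - w'')"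
proof -
  have "norm (P w' - P w'') * norm (P w' - P w'') \<le> norm (w' - w'') * norm (P w' - P w'')"
    using firm[of w' w''] norm_cauchy_schwarz[of "w' - w''" "P w' - P w''"] by (simp add: dot_square_norm power2_eq_square)
  then show ?thesis by (cases "norm (P w' - P w'') = 0") (auto simp: mult_le_cancel_right)
qed

text \<open>Up to \<open>- e j\<close>, the residual is the change of a nonexpansive map between the
  starting point and the point of the visit. This is at most the distance that the average has
  moved, and so at most the sum of the norms of the earlier increments over n. The Hardy inequality
  does the rest.\<close>

lemma residual_bound:
  "(\<Sum>j<n. (\<zeta> j - (P (w 0) - D j (P (w 0)))) \<bullet> (\<zeta> j - (P (w 0) - D j (P (w 0)))))
    \<le> 2367 / 1000 * (\<Sum>j<n. e j \<bullet> e j)"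
proof -
  have "(\<zeta> j - (P (w 0) - D j (P (w 0)))) \<bullet> (\<zeta> j - (P (w 0) - D j (P (w 0))))
     \<le> (norm (e j) + (\<Sum>l<j. norm (e l)) / real n)\<^sup>2" if j: "j < n" for j
  proof -
    let ?x = "P (w 0)" and ?y = "P (w j)"
    have "norm ((?y - D j ?y) - (?x - D j ?x)) \<le> norm (?y - ?x)"
      unfolding norm_le by (rule grad_step_nonexpansive) (rule coco[OF j])
    also have "\<dots> \<le> norm (w j - w 0)" by (rule norm_P_diff)
    also have "\<dots> \<le> (\<Sum>l<j. norm (e l)) / real n" using j by (intro norm_w_diff) simp
    finally have 1: "norm ((?y - D j ?y) - (?x - D j ?x)) \<le> (\<Sum>l<j. norm (e l)) / real n" .
    have eq: "\<zeta> j - (?x - D j ?x) = ((?y - D j ?y) - (?x - D j ?x)) - e j" using e[OF j] by simp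
    have "norm (\<zeta> j - (?x - D j ?x)) \<le> norm (e j) + (\<Sum>l<j. norm (e l)) / real n"
      unfolding eq using norm_triangle_ineq4[of "(?y - D j ?y) - (?x - D j ?x)" "e j"] 1 by linarith
    then show ?thesis by (simp add: power2_norm_eq_inner[symmetric] power_mono)
  qed
  then have "(\<Sum>j<n. (\<zeta> j - (P (w 0) - D j (P (w 0)))) \<bullet> (\<zeta> j - (P (w 0) - D j (P (w 0)))))
    \<le> (\<Sum>j<n. (norm (e j) + (\<Sum>l<j. norm (e l)) / real n)\<^sup>2)" by (intro sum_mono) auto
  also have "\<dots> \<le> 2367 / 1000 * (\<Sum>j<n. (norm (e j))\<^sup>2)" by (rule hardy_partial_sums)
  finally show ?thesis by (simp add: power2_norm_eq_inner)
qed

text \<open>The left side adds the Bregman distances of \<open>\<phi> j\<close> and \<open>R\<close>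
  from the optimum to x. The estimate goes through \<open>y\<close>, the point at which the index is
  visited, because there \<open>e j\<close> ties the gradient to the table. The distance of
  \<open>y\<close> to the optimum then appears only inside the losses.\<close>

lemma gap_item:
  assumes j: "j < n"
  defines "x \<equiv> P (w 0)"
  shows "\<phi> j x - \<phi> j xs - D j xs \<bullet> (x - xs) + R x - R xs - (ws - xs) \<bullet> (x - xs)
    \<le> 3055 / 1000 * (loss_r j + loss_f j) + 27233 / 100000 * (norm (w j - w 0) + norm (\<zeta> j - zs j - (w 0 - ws) + e j))\<^sup>2"
proof -
  define y where "y = P (w j)"
  define yt where "yt = y - xs"
  define q where "q = y - x"
  define p where "p = w j - w 0"
  define v where "v = \<zeta> j - zs j - (w 0 - ws) + e j"
  define d where "d = D j y - D j xs"
  define u where "u = D j x - D j y"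
  have d: "d = p - v - \<gamma> j"
    using e[OF j] zs[OF j] by (simp add: d_def p_def v_def \<gamma>_def y_def[symmetric])
  have xq: "x - xs = yt - q" by (simp add: yt_def q_def)
  have 1: "\<phi> j y - \<phi> j xs \<le> D j y \<bullet> yt - 1 / 4 * (d \<bullet> d)"
    using coco[OF j, of y xs] by (simp add: yt_def d_def inner_diff inner_commute) argo
  have 2: "\<phi> j x - \<phi> j y \<le> - (D j x \<bullet> q) - 1 / 4 * (u \<bullet> u)"
    using coco[OF j, of x y] by (simp add: q_def u_def inner_diff inner_commute) argo
  have "0 \<le> (q + (1/2) *\<^sub>R u) \<bullet> (q + (1/2) *\<^sub>R u)" by simp
  then have 3: "- (u \<bullet> q) - 1 / 4 * (u \<bullet> u) \<le> q \<bullet> q"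
    by (simp add: inner_add inner_commute)
  have 4: "R x \<le> R y - (w 0 - x) \<bullet> q"
    using prox[of "w 0" "w j"] by (simp add: x_def y_def q_def)
  have 5: "R y \<le> R xs + (w j - y) \<bullet> yt"
    using prox[of "w j" ws] xs unfolding ws_def[symmetric] by (simp add: y_def yt_def inner_diff_right)
  have "\<phi> j x - \<phi> j xs - D j xs \<bullet> (x - xs) + R x - R xs - (ws - xs) \<bullet> (x - xs)
     \<le> d \<bullet> yt - 1 / 4 * (d \<bullet> d) - d \<bullet> q + q \<bullet> q + (w j - y - (ws
         - xs)) \<bullet> yt - (w 0 - x - (ws - xs)) \<bullet> q"
  proof -
    have dy: "D j y \<bullet> yt = d \<bullet> yt + D j xs \<bullet> yt" by (simp add: d_def inner_diff_left)
    have dx: "D j x \<bullet> q = u \<bullet> q + d \<bullet> q + D j xs \<bullet> q" by (simp add: d_def u_def inner_diff_left)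
    have "(w j - y - (ws - xs)) \<bullet> yt = (w j - y) \<bullet> yt - (ws - xs) \<bullet> yt" "(w 0 - x - (ws
        - xs)) \<bullet> q = (w 0 - x) \<bullet> q - (ws - xs) \<bullet> q"
      by (simp_all only: inner_diff_left)
    then show ?thesis using 1 2 3 4 5 unfolding xq inner_diff_right dy dx by linarith
  qed
  also have "\<dots> = (1 / 2 * loss_f j + \<gamma> j \<bullet> yt) + (1 / 4 * (d \<bullet> d) + v \<bullet> q)"
  proof -
    have "w 0 - x - (ws - xs) = \<gamma> j - p + q"
      by (simp add: \<gamma>_def p_def q_def y_def)
    moreover have "w j - y - (ws - xs) = \<gamma> j" by (simp add: \<gamma>_def y_def)
    moreover have "d \<bullet> q = p \<bullet> q - v \<bullet> q - \<gamma> j \<bullet> q" by (simp add: d inner_diff_left)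
    ultimately show ?thesis
      by (simp add: loss_f_def y_def[symmetric] d_def[symmetric] yt_def[symmetric] inner_add_left inner_diff_left) argo
  qed
  also have "1 / 4 * (d \<bullet> d) + v \<bullet> q \<le> 1 / 4 * (norm p + norm v)\<^sup>2 + 1 / 2 * (norm p
      + norm v) * norm (\<gamma> j) + 1 / 4 * (norm (\<gamma> j))\<^sup>2"
  proof -
    \<comment> \<open>Firm nonexpansiveness puts \<open>q\<close> in the ball with diameter from 0
      to \<open>p\<close>. The resulting half of \<open>p \<bullet> v\<close> is cancelled by the
      cross term in a quarter of \<open>d \<bullet> d\<close>.\<close>
    have "q \<bullet> q \<le> p \<bullet> q" using firm[of "w j" "w 0"] by (simp add: q_def p_def y_def x_def)
    then have "(norm (q - (1/2) *\<^sub>R p))\<^sup>2 \<le> (norm ((1/2) *\<^sub>R p))\<^sup>2"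
      unfolding power2_norm_eq_inner by (simp add: inner_diff inner_commute)
    then have "norm (q - (1/2) *\<^sub>R p) \<le> 1/2 * norm p" by (simp add: power2_le_iff_abs_le)
    then have "v \<bullet> (q - (1/2) *\<^sub>R p) \<le> norm v * (1/2 * norm p)"
      by (rule order_trans[OF norm_cauchy_schwarz mult_left_mono]) simp
    then have a: "v \<bullet> q \<le> 1/2 * (p \<bullet> v) + 1/2 * (norm p * norm v)"
      by (simp add: inner_diff_right inner_commute mult.commute)
    have b: "d \<bullet> d = (norm p)\<^sup>2 - 2 * (p \<bullet> v) + (norm v)\<^sup>2 - 2 * ((p
        - v) \<bullet> \<gamma> j) + (norm (\<gamma> j))\<^sup>2"
      unfolding power2_norm_eq_inner by (simp add: d inner_diff inner_commute)
    have "- ((p - v) \<bullet> \<gamma> j) \<le> norm (p - v) * norm (\<gamma> j)"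
      using Cauchy_Schwarz_ineq2[of "p - v" "\<gamma> j"] by linarith
    also have "\<dots> \<le> (norm p + norm v) * norm (\<gamma> j)"
      by (intro mult_right_mono norm_triangle_ineq4) auto
    finally show ?thesis using a unfolding b power2_sum by argo
  qed
  also have "\<dots> \<le> 305 / 100 * (norm (\<gamma> j))\<^sup>2 + 27233 / 100000 * (norm p + norm v)\<^sup>2"
  proof -
    define X where "X = norm p + norm v"
    \<comment> \<open>Young's inequality with weight 28/10: 305/100 is 1/4 + 28/10, and 27233/100000
      rounds up 1/4 + 10/448. The growth condition on \<open>C\<close> limits the coefficient of the
      losses to (11/10) / (36/100) as \<open>\<theta>\<close> tends to 0; 3055/1000 lies just
      below.\<close>
    have "0 \<le> 28 / 10 * (norm (\<gamma> j) - X * (10 / 112))\<^sup>2" by simp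
    also have "\<dots> = 28 / 10 * (norm (\<gamma> j))\<^sup>2 - 1 / 2 * X * norm (\<gamma> j) + 10 / 448 * X\<^sup>2"
      by (simp add: power2_eq_square algebra_simps)
    finally show ?thesis using zero_le_power2[of X] unfolding X_def[symmetric] by argo
  qed
  also have "1 / 2 * loss_f j + \<gamma> j \<bullet> yt + (305 / 100 * (norm (\<gamma> j))\<^sup>2
      + 27233 / 100000 * (norm p + norm v)\<^sup>2)
    \<le> 3055 / 1000 * (loss_r j + loss_f j) + 27233 / 100000 * (norm p + norm v)\<^sup>2"
    using loss_f_nonneg[OF j] gamma_nonneg[of j]
    by (simp add: loss_r_def yt_def[symmetric] y_def[symmetric] power2_norm_eq_inner)
  finally show ?thesis by (simp add: p_def v_def)
qed

lemma gap_bound: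
  defines "x \<equiv> P (w 0)"
  shows "(\<Sum>j<n. \<phi> j x) + real n * R x - (\<Sum>j<n. \<phi> j xs) - real n * R xs
    \<le> 785 / 1000 * (\<Sum>j<n. e j \<bullet> e j) + 3055 / 1000 * (\<Sum>j<n. loss_r j + loss_f j)
      + 15275 / 10000 * (\<Sum>j<n. (table 0 j - (w 0 - ws)) \<bullet> (table 0 j - (w 0 - ws)))"
proof -
  define \<rho> where "\<rho> j = norm (e j) + (\<Sum>l<j. norm (e l)) / real n" for j
  define u where "u j = norm (table 0 j - (w 0 - ws))" for j
  have "(\<Sum>j<n. D j xs) = (\<Sum>j<n. xs - zs j)" by (intro sum.cong) (auto simp: zs)
  \<comment> \<open>Stationarity: the slopes of the \<open>\<phi> j\<close> and of \<open>R\<close>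
    at the optimum add up to zero, so that the Bregman distances sum to the gap.\<close>
  then have Dsum: "(\<Sum>j<n. D j xs) + real n *\<^sub>R (ws - xs) = 0"
    using n by (simp add: sum_subtractf ws_def algebra_simps sum_constant_scaleR)
  have "(\<Sum>j<n. \<phi> j x) + real n * R x - (\<Sum>j<n. \<phi> j xs) - real n * R xs
    = (\<Sum>j<n. \<phi> j x - \<phi> j xs - D j xs \<bullet> (x - xs) + R x - R xs - (ws - xs) \<bullet> (x - xs))
       + ((\<Sum>j<n. D j xs) + real n *\<^sub>R (ws - xs)) \<bullet> (x - xs)"
    by (simp add: sum.distrib sum_subtractf inner_sum_left inner_add_left)
  also have "\<dots> = (\<Sum>j<n. \<phi> j x - \<phi> j xs - D j xs \<bullet> (x - xs) + R x - R xs - (ws - xs) \<bullet> (x - xs))"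
    by (simp add: Dsum)
  also have "\<dots> \<le> (\<Sum>j<n. 3055 / 1000 * (loss_r j + loss_f j) + (33154 / 100000 * (\<rho> j)\<^sup>2
      + 15275 / 10000 * (u j)\<^sup>2))"
  proof (intro sum_mono)
    fix j assume "j \<in> {..<n}"
    then have j: "j < n" by simp
    have "norm (\<zeta> j - zs j - (w 0 - ws) + e j) \<le> u j + norm (e j)"
      unfolding u_def by (rule order_trans[OF norm_triangle_ineq]) (simp add: table_def)
    then have "norm (w j - w 0) + norm (\<zeta> j - zs j - (w 0 - ws) + e j) \<le> \<rho> j + u j"
      using norm_w_diff[of j] j by (simp add: \<rho>_def)
    then have "(norm (w j - w 0) + norm (\<zeta> j - zs j - (w 0 - ws) + e j))\<^sup>2 \<le> (\<rho> j + u j)\<^sup>2"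
      by (intro power_mono) auto
    \<comment> \<open>This weight trades the increments against the spread of the table. The spread
      may get 15275/10000, half of 3055/1000, because \<open>expected_dissipation\<close> recovers
      half of the spread from the variances; 33154/100000 times the Hardy constant stays below
      785/1000.\<close>
    moreover have "0 \<le> 2174 / 10000 * (\<rho> j - 10000 / 2174 * u j)\<^sup>2" by simp
    then have "(\<rho> j + u j)\<^sup>2 \<le> 12174 / 10000 * (\<rho> j)\<^sup>2 + 56 / 10 * (u j)\<^sup>2"
    proof -
      assume "0 \<le> 2174 / 10000 * (\<rho> j - 10000 / 2174 * u j)\<^sup>2"
      also have "\<dots> = 2174 / 10000 * (\<rho> j)\<^sup>2 - 2 * (\<rho> j * u j) + 5000 / 1087 * (u j)\<^sup>2"
        by (simp add: power2_eq_square algebra_simps)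
      finally show ?thesis using zero_le_power2[of "u j"] unfolding power2_sum by linarith
    qed
    ultimately show "\<phi> j x - \<phi> j xs - D j xs \<bullet> (x - xs) + R x - R xs - (ws - xs) \<bullet> (x - xs)
      \<le> 3055 / 1000 * (loss_r j + loss_f j) + (33154 / 100000 * (\<rho> j)\<^sup>2 + 15275 / 10000 * (u j)\<^sup>2)"
      using gap_item[OF j] zero_le_power2[of "u j"] zero_le_power2[of "\<rho> j"] unfolding x_def by argo
  qed
  also have "\<dots> = 3055 / 1000 * (\<Sum>j<n. loss_r j + loss_f j)
      + (33154 / 100000 * (\<Sum>j<n. (\<rho> j)\<^sup>2) + 15275 / 10000 * (\<Sum>j<n. (u j)\<^sup>2))"
    by (simp only: sum.distrib[of "\<lambda>j. 3055 / 1000 * (loss_r j + loss_f j)"]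
        sum.distrib[of "\<lambda>j. 33154 / 100000 * (\<rho> j)\<^sup>2"] sum_distrib_left[symmetric])
  also have "(\<Sum>j<n. (\<rho> j)\<^sup>2) \<le> 2367 / 1000 * (\<Sum>j<n. (norm (e j))\<^sup>2)"
    unfolding \<rho>_def by (rule hardy_partial_sums)
  finally show ?thesis
    using sum_nonneg[of "{..<n}" "\<lambda>j. e j \<bullet> e j"] by (simp add: u_def power2_norm_eq_inner)
qed

text \<open>Discard the visited entries. The unvisited ones still have their initial errors, and
  their pairwise distances are controlled by the sum of squares about any centre. What results
  depends on the order only through the indices at given positions, so it can be averaged.\<close>

lemma var_ge:
  assumes j: "j < n"
  shows "(\<Sum>l\<in>{j..<n}. \<Sum>l'\<in>{j..<n}. (table 0 l - table 0 l') \<bullet> (table 0 l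
      - table 0 l')) \<le> 2 * real (n - j) * real n * var j"
proof -
  define a where "a l = table 0 l - (w j - ws)" for l
  define S where "S = (\<Sum>l\<in>{j..<n}. a l)"
  have "(\<Sum>l\<in>{j..<n}. \<Sum>l'\<in>{j..<n}. (table 0 l - table 0 l') \<bullet> (table 0 l - table 0 l'))
     = (\<Sum>l\<in>{j..<n}. \<Sum>l'\<in>{j..<n}. a l \<bullet> a l + a l' \<bullet> a l' - 2 * (a l \<bullet> a l'))"
  proof (intro sum.cong refl)
    fix l l'
    have "table 0 l - table 0 l' = a l - a l'" by (simp add: a_def)
    then show "(table 0 l - table 0 l') \<bullet> (table 0 l - table 0 l') = a l \<bullet> a l
        + a l' \<bullet> a l' - 2 * (a l \<bullet> a l')"
      by (simp add: inner_diff inner_commute)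
  qed
  also have "\<dots> = 2 * real (n - j) * (\<Sum>l\<in>{j..<n}. a l \<bullet> a l)
      - 2 * (\<Sum>l\<in>{j..<n}. \<Sum>l'\<in>{j..<n}. a l \<bullet> a l')"
    by (simp add: sum.distrib sum_subtractf sum_distrib_left[symmetric] del: of_nat_diff)
  also have "(\<Sum>l\<in>{j..<n}. \<Sum>l'\<in>{j..<n}. a l \<bullet> a l') = S \<bullet> S"
    unfolding inner_sum_right[symmetric] S_def[symmetric] inner_sum_left[symmetric] ..
  finally have 1: "(\<Sum>l\<in>{j..<n}. \<Sum>l'\<in>{j..<n}. (table 0 l - table 0 l') \<bullet> (table 0 l - table 0 l'))
    \<le> 2 * real (n - j) * (\<Sum>l\<in>{j..<n}. a l \<bullet> a l)" using inner_ge_zero[of S] by linarith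
  have "(\<Sum>l\<in>{j..<n}. a l \<bullet> a l) = (\<Sum>l\<in>{j..<n}. (table j l - (w j - ws)) \<bullet> (table j l - (w j - ws)))"
    by (intro sum.cong) (auto simp: a_def table_def)
  also have "\<dots> \<le> real n * var j"
    unfolding var_def using n by (simp, intro sum_mono2) auto
  finally have "2 * real (n - j) * (\<Sum>l\<in>{j..<n}. a l \<bullet> a l) \<le> 2 * real (n - j) * (real n * var j)"
    by (intro mult_left_mono) auto
  with 1 show ?thesis by (simp add: mult.assoc del: of_nat_diff)
qed

end

section \<open>Averaging over the visiting order\<close>

text \<open>In a uniform order each position holds a uniform index: composing with a transposition
  moves the position, and the sum over all positions is the same for every permutation. Expectations
  are kept as plain sums, whence the factorial.\<close>

lemma sum_permutes_at:
  fixes h :: "'i \<Rightarrow> real"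
  assumes A: "finite A" "a \<in> A"
  shows "real (card A) * (\<Sum>p | p permutes A. h (p a)) = fact (card A) * (\<Sum>i\<in>A. h i)"
proof -
  have eq: "(\<Sum>p | p permutes A. h (p b)) = (\<Sum>p | p permutes A. h (p a))" if "b \<in> A" for b
  proof (rule sum.reindex_bij_witness[where i = "\<lambda>p. p \<circ> Transposition.transpose a b" and j
      = "\<lambda>p. p \<circ> Transposition.transpose a b"])
    fix p assume "p \<in> {p. p permutes A}"
    then show "p \<circ> Transposition.transpose a b \<in> {p. p permutes A}" "p \<circ> Transposition.transpose a b \<in> {p. p permutes A}"
      using permutes_compose[OF permutes_swap_id[OF A(2) that]] by simp_all
  qed (auto simp: comp_assoc transpose_comp_involutory)
  have "real (card A) * (\<Sum>p | p permutes A. h (p a)) = (\<Sum>b\<in>A. \<Sum>p | p permutes A. h (p b))"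
    by (simp add: eq)
  also have "\<dots> = (\<Sum>p | p permutes A. \<Sum>b\<in>A. h (p b))" by (rule sum.swap)
  also have "\<dots> = (\<Sum>p | p permutes A. \<Sum>i\<in>A. h i)"
  proof (rule sum.cong[OF refl])
    fix p assume "p \<in> {p. p permutes A}"
    then show "(\<Sum>b\<in>A. h (p b)) = (\<Sum>i\<in>A. h i)" using sum.permute[of p A h] by (simp add: comp_def)
  qed
  also have "\<dots> = fact (card A) * (\<Sum>i\<in>A. h i)" using A by (simp add: card_permutations)
  finally show ?thesis .
qed

text \<open>Two positions hold a uniform pair of distinct indices. A transposition moves one
  position, \<open>sym\<close> exchanges the two so that the other can be moved as well, and
  \<open>diag\<close> lets the sums run over all pairs.\<close>

lemma sum_permutes_at2:
  fixes h :: "'i \<Rightarrow> 'i \<Rightarrow> real"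
  assumes A: "finite A" and ab: "a \<in> A" "b \<in> A" "a \<noteq> b"
    and sym: "\<And>i i'. h i i' = h i' i" and diag: "\<And>i. h i i = 0"
  shows "real (card A) * (real (card A) - 1) * (\<Sum>p | p permutes A. h (p a) (p b)) =
    fact (card A) * (\<Sum>i\<in>A. \<Sum>i'\<in>A. h i i')"
proof -
  define T where "T c d = (\<Sum>p | p permutes A. h (p c) (p d))" for c d
  have T1: "T c d = T c' d" if "c \<in> A" "c' \<in> A" "c \<noteq> d" "c' \<noteq> d" for c c' d
    unfolding T_def
  proof (rule sum.reindex_bij_witness[where i = "\<lambda>p. p \<circ> Transposition.transpose c c'" and j
      = "\<lambda>p. p \<circ> Transposition.transpose c c'"])
    fix p assume "p \<in> {p. p permutes A}"
    then show "p \<circ> Transposition.transpose c c' \<in> {p. p permutes A}" "p \<circ> Transposition.transpose c c' \<in> {p. p permutes A}"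
      using permutes_compose[OF permutes_swap_id[OF that(1,2)]] by simp_all
  qed (use that in \<open>auto simp: comp_assoc transpose_comp_involutory transpose_apply_other\<close>)
  have Ts: "T c d = T d c" for c d unfolding T_def by (simp add: sym)
  have T: "T c d = T a b" if "c \<in> A" "d \<in> A" "c \<noteq> d" for c d
    using T1 Ts that ab by metis
  have T0: "T c c = 0" for c by (simp add: T_def diag)
  have "(\<Sum>d\<in>A. T c d) = (real (card A) - 1) * T a b" if c: "c \<in> A" for c
  proof -
    have "(\<Sum>d\<in>A. T c d) = T c c + (\<Sum>d\<in>A - {c}. T c d)" using A c by (rule sum.remove)
    also have "(\<Sum>d\<in>A - {c}. T c d) = (\<Sum>d\<in>A - {c}. T a b)" using c T by (intro sum.cong) auto
    also have "\<dots> = (real (card A) - 1) * T a b"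
      using A c card_gt_0_iff[of A] by (auto simp: of_nat_diff Suc_leI)
    finally show ?thesis by (simp add: T0)
  qed
  then have "real (card A) * ((real (card A) - 1) * T a b) = (\<Sum>c\<in>A. \<Sum>d\<in>A. T c d)" by simp
  also have "\<dots> = (\<Sum>c\<in>A. \<Sum>p | p permutes A. \<Sum>d\<in>A. h (p c) (p d))"
    unfolding T_def by (intro sum.cong refl) (rule sum.swap)
  also have "\<dots> = (\<Sum>p | p permutes A. \<Sum>c\<in>A. \<Sum>d\<in>A. h (p c) (p d))" by (rule sum.swap)
  also have "\<dots> = (\<Sum>p | p permutes A. \<Sum>i\<in>A. \<Sum>i'\<in>A. h i i')"
  proof (rule sum.cong[OF refl])
    fix p assume "p \<in> {p. p permutes A}"
    then have p: "p permutes A" by simp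
    have "(\<Sum>d\<in>A. h (p c) (p d)) = (\<Sum>i'\<in>A. h (p c) i')" for c
      using sum.permute[OF p, of "h (p c)"] by (simp add: comp_def)
    then have "(\<Sum>c\<in>A. \<Sum>d\<in>A. h (p c) (p d)) = (\<Sum>c\<in>A. \<Sum>i'\<in>A. h (p c) i')" by simp
    also have "\<dots> = (\<Sum>i\<in>A. \<Sum>i'\<in>A. h i i')"
      by (rule sum.permute[OF p, where g = "\<lambda>i. \<Sum>i'\<in>A. h i i'", symmetric, unfolded comp_def])
    finally show "(\<Sum>c\<in>A. \<Sum>d\<in>A. h (p c) (p d)) = (\<Sum>i\<in>A. \<Sum>i'\<in>A. h i i')" .
  qed
  also have "\<dots> = fact (card A) * (\<Sum>i\<in>A. \<Sum>i'\<in>A. h i i')" using A by (simp add: card_permutations)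
  finally show ?thesis by (simp add: T_def mult.assoc)
qed

lemma sum_pairwise_dist:
  fixes a :: "'i \<Rightarrow> 'a::real_inner"
  shows "(\<Sum>i\<in>A. \<Sum>i'\<in>A. (a i - a i') \<bullet> (a i - a i')) =
    2 * real (card A) * (\<Sum>i\<in>A. a i \<bullet> a i) - 2 * ((\<Sum>i\<in>A. a i) \<bullet> (\<Sum>i\<in>A. a i))"
proof -
  have "(\<Sum>i\<in>A. \<Sum>i'\<in>A. (a i - a i') \<bullet> (a i - a i'))
      = (\<Sum>i\<in>A. \<Sum>i'\<in>A. a i \<bullet> a i + a i' \<bullet> a i' - 2 * (a i \<bullet> a i'))"
    by (intro sum.cong refl) (simp add: inner_diff inner_commute)
  also have "\<dots> = 2 * real (card A) * (\<Sum>i\<in>A. a i \<bullet> a i) - 2 * (\<Sum>i\<in>A. \<Sum>i'\<in>A. a i \<bullet> a i')"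
    by (simp add: sum.distrib sum_subtractf sum_distrib_left[symmetric])
  finally show ?thesis unfolding inner_sum_right[symmetric] inner_sum_left[symmetric] .
qed

text \<open>E is the exponential, continued beyond \<open>z1\<close> by its tangent. Increments are
  compared with E at the right end of the step, as in an implicit Euler scheme, because the descent
  of the Lyapunov function is multiplied by the weight of the following epoch.\<close>

lemma exp_linear_extension:
  fixes z1 :: real
  assumes z1: "z1 \<ge> 0"
  obtains E where "E 0 = 1" "\<And>z. z \<ge> 0 \<Longrightarrow> E z \<ge> 1" "\<And>z. E z \<ge> exp z1 * (1 + z - z1)"
    "\<And>z s. s \<ge> 0 \<Longrightarrow> E z \<le> E (z + s)"
    "\<And>z s. s \<ge> 0 \<Longrightarrow> E (z + s) - E z \<le> s * E (z
        + s)" "\<And>z s. s \<ge> 0 \<Longrightarrow> E (z + s) - E z \<le> s * exp z1"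
proof -
  define E where "E z = (if z \<le> z1 then exp z else exp z1 * (1 + z - z1))" for z
  have tang: "exp a * (1 + b - a) \<le> exp b" for a b :: real
  proof -
    have "exp a * (1 + (b - a)) \<le> exp a * exp (b - a)" by (intro mult_left_mono exp_ge_add_one_self) auto
    also have "\<dots> = exp b" by (simp add: exp_add[symmetric])
    finally show ?thesis by (simp add: algebra_simps)
  qed
  have lin: "exp z1 * (1 + z - z1) \<le> E z" for z using tang[of z1 z] by (simp add: E_def)
  have e: "exp a - exp b \<le> (a - b) * exp a" for a b :: real
    using tang[of a b] by (simp add: algebra_simps)
  show thesis
  proof (rule that[of E])
    show "E 0 = 1" using z1 by (simp add: E_def)
    show mono: "E z \<le> E (z + s)" if "s \<ge> 0" for z s
    proof (cases "z + s \<le> z1")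
      case False
      have "exp z \<le> exp z1 * 1" if "z \<le> z1" using that by simp
      also have "\<dots> \<le> exp z1 * (1 + (z + s) - z1)" using False by (intro mult_left_mono) auto
      finally show ?thesis using False that by (auto simp: E_def intro: mult_left_mono)
    qed (use that in \<open>auto simp: E_def\<close>)
    show "E z \<ge> 1" if "z \<ge> 0" for z using mono[OF that, of 0] z1 by (simp add: E_def)
    show c: "E (z + s) - E z \<le> s * exp z1" if "s \<ge> 0" for z s
    proof (cases "z + s \<le> z1")
      case True
      have "exp (z + s) - exp z \<le> s * exp (z + s)" using e[of "z + s" z] by simp
      also have "\<dots> \<le> s * exp z1" using True that by (intro mult_left_mono) auto
      finally show ?thesis using True that by (simp add: E_def)
    next
      case False
      then have "E (z + s) = exp z1 * (1 + z - z1) + s * exp z1" by (simp add: E_def algebra_simps)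
      then show ?thesis using lin[of z] by simp
    qed
    show "E (z + s) - E z \<le> s * E (z + s)" if "s \<ge> 0" for z s
    proof (cases "z + s \<le> z1")
      case True
      then show ?thesis using e[of "z + s" z] that by (simp add: E_def)
    next
      case False
      have "exp z1 * 1 \<le> exp z1 * (1 + (z + s) - z1)" using False by (intro mult_left_mono) auto
      then have "exp z1 \<le> E (z + s)" using False by (simp add: E_def)
      then show ?thesis using c[OF that, of z] mult_left_mono[of "exp z1" "E (z + s)" s] that by simp
    qed
  qed (rule lin)
qed

text \<open>\<open>C k\<close> is the weight of the Lyapunov function \<open>\<psi>\<close> in epoch \<open>k\<close>. It may grow exponentially
  until its slope reaches \<open>36/100 / b\<close>, and linearly from then on; \<open>36/100 = (3/5)^2\<close> is the constant
  of the theorem.\<close>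

lemma growth_sequence:
  fixes b m \<sigma> \<theta> r z1 :: real
  assumes b: "b > 0" and m: "m > 0" and \<sigma>: "\<sigma> > 0" and r: "r = 785 / 1000 + 2367 / 1000 * b"
    and c: "1 \<le> 36 / 100 * r / b" "36 / 100 * r / b \<le> exp z1"
    and k: "b / m * (1 - 36 / 100 * r / b * (1 - z1)) \<le> 1 / 4 - 36 / 100 * \<sigma>"
    and th: "36 / 100 / b * 3055 / 1000 * \<sigma> \<le> \<theta>"
  obtains C where "C 0 = 0" "\<And>k. C k \<ge> 0" "\<And>k. C k \<le> C (Suc k)"
    "\<And>k. (C (Suc k) - C k) * (785 / 1000 + 2367 / 1000 * b) \<le> 1 + m * \<sigma> * C (Suc k)"
    "\<And>k. (C (Suc k) - C k) * (3055 / 1000) * \<sigma> \<le> \<theta>"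
    "\<And>k. 36 / 100 * \<sigma> * (real k + 1) \<le> 1 / 4 + \<sigma> * b * C k"
proof -
  define c where "c = 36 / 100 * r / b"
  \<comment> \<open>Switching from the exponential to its tangent at ln c caps the slope of
    \<open>C\<close> at c / r, that is (36/100) / b. The hypotheses on \<open>z1\<close> only need
    an upper bound of this logarithm.\<close>
  define z where "z = ln c"
  have r0: "r > 0" using b r by simp
  have c1: "c \<ge> 1" "exp z = c" using assms(5) by (simp_all add: c_def z_def)
  then have z0: "z \<ge> 0" by (simp add: z_def)
  have zz: "z \<le> z1" using assms(6) c1 unfolding c_def[symmetric] by (metis exp_le_cancel_iff)
  from exp_linear_extension[OF z0] obtain E where E: "E 0 = 1" "\<And>z. z \<ge> 0 \<Longrightarrow> E z \<ge> 1"
    "\<And>y. E y \<ge> c * (1 + y - z)" "\<And>z s. s \<ge> 0 \<Longrightarrow> E z \<le> E (z + s)"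
    "\<And>z s. s \<ge> 0 \<Longrightarrow> E (z + s) - E z \<le> s * E (z
        + s)" "\<And>z s. s \<ge> 0 \<Longrightarrow> E (z + s) - E z \<le> s * c"
    unfolding c1 by blast
  define s where "s = m * \<sigma> / r"
  have s: "s > 0" using m \<sigma> r0 by (simp add: s_def)
  define C where "C k = (E (real k * s) - 1) / (m * \<sigma>)" for k
  have ms: "m * \<sigma> > 0" using m \<sigma> by simp
  have d: "C (Suc k) - C k = (E (real k * s + s) - E (real k * s)) / (m * \<sigma>)" for k
    by (simp add: C_def diff_divide_distrib algebra_simps)
  have ES: "E (real k * s + s) = 1 + m * \<sigma> * C (Suc k)" for k
  proof -
    have "m * \<sigma> * C (Suc k) = E (real (Suc k) * s) - 1" using m \<sigma> by (simp add: C_def)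
    then show ?thesis by (simp add: algebra_simps)
  qed
  show thesis
  proof (rule that[of C])
    show "C 0 = 0" using E by (simp add: C_def)
    show "C k \<ge> 0" for k using E(2)[of "real k * s"] s ms by (simp add: C_def)
    show "C k \<le> C (Suc k)" for k
    proof -
      have "0 \<le> C (Suc k) - C k"
        unfolding d using E(4)[of s "real k * s"] s ms by (intro divide_nonneg_pos) auto
      then show ?thesis by simp
    qed
    show "(C (Suc k) - C k) * (785 / 1000 + 2367 / 1000 * b) \<le> 1 + m * \<sigma> * C (Suc k)" for k
    proof -
      have "(C (Suc k) - C k) \<le> s * E (real k * s + s) / (m * \<sigma>)"
        unfolding d using E(5)[of s "real k * s"] s ms by (intro divide_right_mono) auto
      also have "\<dots> = E (real k * s + s) / r" using m \<sigma> by (simp add: s_def)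
      finally show ?thesis unfolding r[symmetric] ES using r0 by (simp add: field_simps)
    qed
    show "(C (Suc k) - C k) * (3055 / 1000) * \<sigma> \<le> \<theta>" for k
    proof -
      have "(C (Suc k) - C k) \<le> s * c / (m * \<sigma>)"
        unfolding d using E(6)[of s "real k * s"] s ms by (intro divide_right_mono) auto
      also have "\<dots> = 36 / 100 / b" using m \<sigma> r0 b by (simp add: s_def c_def)
      finally have "(C (Suc k) - C k) * (3055 / 1000 * \<sigma>) \<le> 36 / 100 / b * (3055 / 1000 * \<sigma>)"
        using \<sigma> by (intro mult_right_mono) auto
      also have "\<dots> = 36 / 100 / b * 3055 / 1000 * \<sigma>" by simp
      finally have "(C (Suc k) - C k) * (3055 / 1000 * \<sigma>) \<le> \<theta>" using th by linarith
      then show ?thesis by (simp only: mult.assoc)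
    qed
    show "36 / 100 * \<sigma> * (real k + 1) \<le> 1 / 4 + \<sigma> * b * C k" for k
    proof -
      have "c * (1 - z1) + c * (real k * s) \<le> c * (1 + real k * s - z)"
        unfolding distrib_left[symmetric] using zz c1 by (intro mult_left_mono) auto
      also note E(3)[of "real k * s"]
      finally have "b / m * (c * (1 - z1) + c * (real k * s) - 1) \<le> b / m * (E (real k * s) - 1)"
        using b m by (intro mult_left_mono) auto
      also have "\<dots> = \<sigma> * b * C k" using \<sigma> m by (simp add: C_def)
      also have "b / m * (c * (1 - z1) + c * (real k * s) - 1) = 36 / 100 * \<sigma> * real k - b / m * (1 - c * (1 - z1))"
        using m \<sigma> r0 b by (simp add: s_def c_def field_simps)
      finally show ?thesis using k unfolding c_def[symmetric] by (simp add: algebra_simps)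
    qed
  qed
qed

text \<open>The step size is absorbed: \<open>\<phi> i\<close> and \<open>R\<close> stand for \<open>\<alpha> f i\<close> and \<open>\<alpha> r\<close>, so that \<open>\<phi> i\<close> is
  2-smooth and the step size is 1.\<close>

locale finite_sum =
  fixes n :: nat and \<phi> :: "nat \<Rightarrow> 'a::real_inner \<Rightarrow> real" and D :: "nat \<Rightarrow> 'a \<Rightarrow> 'a"
    and P :: "'a \<Rightarrow> 'a" and R :: "'a \<Rightarrow> real" and zs :: "nat \<Rightarrow> 'a" and xs :: 'a
  assumes n: "n \<ge> 1"
    and coco: "\<And>i x y. i \<in> {1..n} \<Longrightarrow> \<phi> i y \<ge> \<phi> i x + D i x \<bullet> (y - x)
        + 1 / 4 * ((D i y - D i x) \<bullet> (D i y - D i x))"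
    and prox: "\<And>w w'. R (P w') \<ge> R (P w) + (w - P w) \<bullet> (P w' - P w)"
    and zs: "\<And>i. i \<in> {1..n} \<Longrightarrow> zs i = xs - D i xs"
    and xs: "P ((\<Sum>i=1..n. zs i) /\<^sub>R real n) = xs"
begin

definition avg :: "(nat \<Rightarrow> 'a) \<Rightarrow> 'a" where "avg z = (\<Sum>i=1..n. z i) /\<^sub>R real n"

primrec path :: "(nat \<Rightarrow> nat) \<Rightarrow> (nat \<Rightarrow> 'a) \<Rightarrow> nat \<Rightarrow> 'a" where
  "path p z 0 = avg z"
| "path p z (Suc j) = path p z j
     + (P (path p z j) - D (p (Suc j)) (P (path p z j)) - z (p (Suc j))) /\<^sub>R real n"

definition incr where
  "incr p z j = P (path p z j) - D (p (Suc j)) (P (path p z j)) - z (p (Suc j))"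

text \<open>A relation rather than a function: for a permutation p it fixes just the entries 1, ...,
  n, the ones that \<open>V\<close>, \<open>J\<close> and \<open>gap\<close> see.\<close>

definition epoch where
  "epoch \<theta> p z z' \<longleftrightarrow> (\<forall>j<n. z' (p (Suc j)) = z (p (Suc j)) + \<theta> *\<^sub>R incr p z j)"

definition V where "V z = (\<Sum>i=1..n. (z i - zs i) \<bullet> (z i - zs i))"
definition J where "J z = (\<Sum>i=1..n. (z i - (P (avg z) - D i (P (avg z)))) \<bullet> (z i - (P (avg z) - D i (P (avg z)))))"
definition gap where "gap z = (\<Sum>i=1..n. \<phi> i (P (avg z))) + real n * R (P (avg z)) - (\<Sum>i=1..n. \<phi> i xs) - real n * R xs"
definition \<Phi> where "\<Phi> p z = (\<Sum>j<n. incr p z j \<bullet> incr p z j)"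

lemma sum_visit:
  assumes "p permutes {1..n}"
  shows "(\<Sum>j<n. h (p (Suc j))) = (\<Sum>i=1..n. h i)"
proof -
  have "(\<Sum>i=1..n. h i) = (\<Sum>i=1..n. h (p i))" using sum.permute[OF assms, of h] by (simp add: comp_def)
  also have "\<dots> = (\<Sum>j<n. h (p (Suc j)))"
    using sum.atLeast_Suc_lessThan_Suc_shift[of "\<lambda>i. h (p i)" 0 n]
    by (simp add: atLeastLessThanSuc_atLeastAtMost lessThan_atLeast0)
  finally show ?thesis ..
qed

lemma visit_mem: "p permutes {1..n} \<Longrightarrow> j < n \<Longrightarrow> p (Suc j) \<in> {1..n}"
  using permutes_in_image[of p "{1..n}" "Suc j"] by auto

declare One_nat_def [simp del]

lemma P_avg_zs: "P (avg zs) = xs" by (simp add: avg_def xs)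

lemma epoch_path:
  assumes p: "p permutes {1..n}"
  shows "epoch_path n (\<lambda>j. \<phi> (p (Suc j))) (\<lambda>j. D (p (Suc j))) P R (path p z) (\<lambda>j. z (p (Suc j))) (incr p z)
    (\<lambda>j. zs (p (Suc j))) xs"
proof
  show "path p z 0 = (\<Sum>j<n. z (p (Suc j))) /\<^sub>R real n" by (simp add: avg_def sum_visit[OF p])
  show "P ((\<Sum>j<n. zs (p (Suc j))) /\<^sub>R real n) = xs" by (simp add: sum_visit[OF p, of zs] xs)
  fix j x y assume "j < n"
  show "\<phi> (p (Suc j)) x + D (p (Suc j)) x \<bullet> (y - x) + 1 / 4 * ((D (p (Suc j)) y
      - D (p (Suc j)) x) \<bullet> (D (p (Suc j)) y - D (p (Suc j)) x)) \<le> \<phi> (p (Suc j)) y"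
    by (rule coco[OF visit_mem[OF p \<open>j < n\<close>]])
qed (auto simp: n incr_def intro!: prox zs visit_mem[OF p])

lemma avg_epoch:
  assumes p: "p permutes {1..n}" and z': "epoch \<theta> p z z'"
  shows "avg z' = path p z 0 + \<theta> *\<^sub>R (path p z n - path p z 0)"
proof -
  interpret ep: epoch_path n "\<lambda>j. \<phi> (p (Suc j))" "\<lambda>j. D (p (Suc j))" P R "path p z" "\<lambda>j. z (p (Suc j))" "incr p z"
    "\<lambda>j. zs (p (Suc j))" xs by (rule epoch_path[OF p])
  have "(\<Sum>i=1..n. z' i) = (\<Sum>j<n. z (p (Suc j)) + \<theta> *\<^sub>R incr p z j)"
    using z' unfolding sum_visit[OF p, symmetric] epoch_def by (intro sum.cong) auto
  also have "\<dots> = (\<Sum>i=1..n. z i) + \<theta> *\<^sub>R (\<Sum>j<n. incr p z j)"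
    by (simp add: sum.distrib sum_visit[OF p, of z] scaleR_sum_right)
  finally show ?thesis using ep.w_eq[of n] by (simp add: avg_def scaleR_right_distrib)
qed

lemma Phi_nonneg: "\<Phi> p z \<ge> 0" by (simp add: \<Phi>_def sum_nonneg)
lemma J_nonneg: "J z \<ge> 0" by (simp add: J_def sum_nonneg)

lemma psi_descent:
  assumes n2: "n \<ge> 2" and th: "0 < \<theta>" "\<theta> < 1" and om: "0 \<le> \<omega>" "\<omega> * \<theta> \<le> 1"
    and certificate: "\<And>d f :: 'a. certificate \<theta> b m \<omega> d f"
    and p: "p permutes {1..n}" and z': "epoch \<theta> p z z'"
  shows "gap z' + b * J z' + m * \<theta> * (1 - \<theta>) * \<Phi> p z \<le> gap z + b * J z"
proof -
  interpret ep: epoch_path n "\<lambda>j. \<phi> (p (Suc j))" "\<lambda>j. D (p (Suc j))" P R "path p z" "\<lambda>j. z (p (Suc j))" "incr p z"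
    "\<lambda>j. zs (p (Suc j))" xs by (rule epoch_path[OF p])
  note d = epoch_descent[of n \<theta> \<omega> b m "\<lambda>j. \<phi> (p (Suc j))" "\<lambda>j. D (p (Suc j))" R P "path p z" "\<lambda>j. z (p (Suc j))" "incr p z" "P (avg z)" "P (avg z')",
      OF n2 th om certificate ep.coco prox ep.w0 ep.wS ep.e]
  have e: "z (p (Suc j)) + \<theta> *\<^sub>R incr p z j = z' (p (Suc j))" if "j < n" for j using z' that by (simp add: epoch_def)
  have "(\<Sum>j<n. (z (p (Suc j)) + \<theta> *\<^sub>R incr p z j - (P (avg z') - D (p (Suc j)) (P (avg z')))) \<bullet>
        (z (p (Suc j)) + \<theta> *\<^sub>R incr p z j - (P (avg z') - D (p (Suc j)) (P (avg z'))))) = J z'"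
    unfolding J_def sum_visit[OF p, symmetric] by (intro sum.cong refl) (simp add: e)
  moreover have "(\<Sum>j<n. (z (p (Suc j)) - (P (avg z) - D (p (Suc j)) (P (avg z)))) \<bullet>
        (z (p (Suc j)) - (P (avg z) - D (p (Suc j)) (P (avg z))))) = J z"
    unfolding J_def sum_visit[OF p, symmetric] ..
  moreover have "(\<Sum>j<n. \<phi> (p (Suc j)) y) = (\<Sum>i=1..n. \<phi> i y)" for y
    by (rule sum_visit[OF p, of "\<lambda>i. \<phi> i y"])
  ultimately show ?thesis
    using d by (simp add: avg_epoch[OF p z'] gap_def \<Phi>_def)
qed

lemma D_sum: "(\<Sum>i=1..n. D i xs) = real n *\<^sub>R (xs - avg zs)"
proof -
  have "(\<Sum>i=1..n. D i xs) = (\<Sum>i=1..n. xs - zs i)" by (intro sum.cong) (auto simp: zs)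
  then show ?thesis using n by (simp add: sum_subtractf avg_def algebra_simps sum_constant_scaleR)
qed

text \<open>Add the tangent inequalities of the \<open>\<phi> i\<close> and of \<open>R\<close> at
  \<open>xs\<close>; by \<open>D_sum\<close> their slopes cancel.\<close>

lemma gap_nonneg: "gap z \<ge> 0"
proof -
  define x where "x = P (avg z)"
  have "\<phi> i xs + D i xs \<bullet> (x - xs) \<le> \<phi> i x" if "i \<in> {1..n}" for i
    using coco[OF that, of xs x] inner_ge_zero[of "D i x - D i xs"] by linarith
  then have "(\<Sum>i=1..n. \<phi> i xs + D i xs \<bullet> (x - xs)) \<le> (\<Sum>i=1..n. \<phi> i x)" by (intro sum_mono)
  then have "(\<Sum>i=1..n. \<phi> i xs) + real n * ((xs - avg zs) \<bullet> (x - xs)) \<le> (\<Sum>i=1..n. \<phi> i x)"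
    by (simp add: sum.distrib inner_sum_left[symmetric] D_sum)
  moreover have "R xs + (avg zs - xs) \<bullet> (x - xs) \<le> R x"
    using prox[of "avg zs" "avg z"] by (simp add: P_avg_zs x_def)
  then have "real n * (R xs + (avg zs - xs) \<bullet> (x - xs)) \<le> real n * R x" by (intro mult_left_mono) auto
  ultimately show ?thesis
    unfolding gap_def x_def[symmetric] by (simp add: distrib_left inner_diff_left algebra_simps)
qed

text \<open>The residual is the error \<open>a i\<close> minus a vector no longer than
  \<open>x - xs\<close>, and the parallelogram inequality gives the factor 2 twice. The distance of
  \<open>x\<close> to \<open>xs\<close> is in turn at most that of the averages, which Jensen's
  inequality bounds by \<open>V\<close>.\<close>

lemma J_le_V: "J z \<le> 4 * V z"
proof -
  define x where "x = P (avg z)"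
  define a where "a i = z i - zs i" for i
  have firm: "(P u' - P u) \<bullet> (P u' - P u) \<le> (u' - u) \<bullet> (P u' - P u)" for u u'
    using prox by (rule prox_firmly_nonexpansive)
  have "(z i - (x - D i x)) \<bullet> (z i - (x - D i x)) \<le> 2 * (a i \<bullet> a i) + 2 * ((x
      - xs) \<bullet> (x - xs))" if i: "i \<in> {1..n}" for i
  proof -
    define c where "c = (x - D i x) - (xs - D i xs)"
    have eq: "z i - (x - D i x) = a i - c" by (simp add: a_def c_def zs[OF i])
    have "c \<bullet> c \<le> (x - xs) \<bullet> (x - xs)" unfolding c_def by (rule grad_step_nonexpansive) (rule coco[OF i])
    moreover have "0 \<le> (a i + c) \<bullet> (a i + c)" by simp
    ultimately show ?thesis unfolding eq by (simp add: inner_add inner_diff inner_commute)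
  qed
  then have "J z \<le> (\<Sum>i=1..n. 2 * (a i \<bullet> a i) + 2 * ((x - xs) \<bullet> (x - xs)))"
    unfolding J_def x_def[symmetric] by (intro sum_mono)
  also have "\<dots> = 2 * V z + 2 * (real n * ((x - xs) \<bullet> (x - xs)))"
    by (simp add: sum.distrib sum_distrib_left V_def a_def)
  also have "real n * ((x - xs) \<bullet> (x - xs)) \<le> V z"
  proof -
    define w where "w = avg z - avg zs"
    have aw: "(\<Sum>i=1..n. a i) = real n *\<^sub>R w" using n by (simp add: a_def w_def avg_def sum_subtractf algebra_simps)
    have "(x - xs) \<bullet> (x - xs) \<le> w \<bullet> (x - xs)"
      using firm[of "avg z" "avg zs"] by (simp add: P_avg_zs w_def x_def)
    moreover have "0 \<le> (w - (x - xs)) \<bullet> (w - (x - xs))" by simp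
    ultimately have "(x - xs) \<bullet> (x - xs) \<le> w \<bullet> w"
      by (simp add: inner_diff_left[of w] inner_diff_right[of _ w] inner_commute[of "x - xs" w])
    then have "real n * ((x - xs) \<bullet> (x - xs)) \<le> real n * (w \<bullet> w)" by (intro mult_left_mono) auto
    also have "0 \<le> (\<Sum>i=1..n. (a i - w) \<bullet> (a i - w))" by (simp add: sum_nonneg)
    then have "real n * (w \<bullet> w) \<le> V z"
    proof -
      assume "0 \<le> (\<Sum>i=1..n. (a i - w) \<bullet> (a i - w))"
      also have "\<dots> = (\<Sum>i=1..n. a i \<bullet> a i - 2 * (a i \<bullet> w) + w \<bullet> w)"
        by (intro sum.cong refl) (simp add: inner_diff inner_commute)
      also have "\<dots> = V z - 2 * ((\<Sum>i=1..n. a i) \<bullet> w) + real n * (w \<bullet> w)"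
        unfolding inner_sum_left V_def a_def[symmetric] by (simp add: sum.distrib sum_subtractf sum_distrib_left)
      finally show ?thesis by (simp add: aw)
    qed
    finally show ?thesis .
  qed
  finally show ?thesis by simp
qed

text \<open>The vector on the left is the mean of the residuals, so this is Jensen's inequality.
  Divided by \<open>\<alpha>\<close>, it becomes the gradient of F plus the subgradient that the
  proximal map provides.\<close>

lemma residual_le_J: "real n * ((avg z - P (avg z) + avg (\<lambda>i. D i (P (avg z)))) \<bullet> (avg z
    - P (avg z) + avg (\<lambda>i. D i (P (avg z))))) \<le> J z"
proof -
  define a where "a i = z i - (P (avg z) - D i (P (avg z)))" for i
  define w where "w = avg z - P (avg z) + avg (\<lambda>i. D i (P (avg z)))"
  have aw: "(\<Sum>i=1..n. a i) = real n *\<^sub>R w"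
  proof -
    have "(\<Sum>i=1..n. a i) = (\<Sum>i=1..n. z i) - real n *\<^sub>R P (avg z) + (\<Sum>i=1..n. D i (P (avg z)))"
      by (simp add: a_def sum_subtractf sum_constant_scaleR)
    then show ?thesis using n by (simp add: w_def avg_def scaleR_add_right scaleR_diff_right)
  qed
  have "0 \<le> (\<Sum>i=1..n. (a i - w) \<bullet> (a i - w))" by (simp add: sum_nonneg)
  also have "\<dots> = (\<Sum>i=1..n. a i \<bullet> a i - 2 * (a i \<bullet> w) + w \<bullet> w)"
    by (intro sum.cong refl) (simp add: inner_diff inner_commute)
  also have "\<dots> = J z - 2 * ((\<Sum>i=1..n. a i) \<bullet> w) + real n * (w \<bullet> w)"
    unfolding inner_sum_left J_def a_def[symmetric] by (simp add: sum.distrib sum_subtractf sum_distrib_left)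
  finally show ?thesis by (simp add: aw w_def)
qed

abbreviation S where "S \<equiv> {p. p permutes {1..n}}"

lemma card_S: "card S = fact n" using card_permutations[of "{1..n}" n] by simp

text \<open>The locale \<open>epoch_path\<close> is interpreted for one order at a time. Existential
  quantifiers export what averaging needs, so that the facts are available for all orders
  simultaneously.\<close>

lemma epoch_facts:
  assumes p: "p \<in> S"
  shows "\<exists>en lo va. en 0 = V z \<and>
    (\<forall>j<n. en (Suc j) = (1 + 1 / real n) * en j - (z (p (Suc j)) - zs (p (Suc j))) \<bullet> (z (p (Suc j))
        - zs (p (Suc j))) - (va j + lo j)
       \<and> lo j \<ge> 0 \<and> va j \<ge> 0
       \<and> (\<Sum>l\<in>{j..<n}. \<Sum>l'\<in>{j..<n}. (z (p (Suc l)) - zs (p (Suc l)) - (z (p (Suc l')) - zs (p (Suc l')))) \<bullet>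
            (z (p (Suc l)) - zs (p (Suc l)) - (z (p (Suc l')) - zs (p (Suc l'))))) \<le> 2 * real (n - j) * real n * va j)
    \<and> (\<forall>\<theta> z'. epoch \<theta> p z z' \<longrightarrow> V z' = (1 - \<theta>) * V z
        + \<theta> * en n - \<theta> * (1 - \<theta>) * \<Phi> p z)
    \<and> gap z \<le> 785 / 1000 * \<Phi> p z + 3055 / 1000 * (\<Sum>j<n. lo j)
        + 15275 / 10000 * (\<Sum>i=1..n. (z i - zs i - (avg z - avg zs)) \<bullet> (z i - zs i - (avg z - avg zs)))
    \<and> J z \<le> 2367 / 1000 * \<Phi> p z"
proof -
  from p have p: "p permutes {1..n}" by simp
  interpret ep: epoch_path n "\<lambda>j. \<phi> (p (Suc j))" "\<lambda>j. D (p (Suc j))" P R "path p z" "\<lambda>j. z (p (Suc j))" "incr p z"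
    "\<lambda>j. zs (p (Suc j))" xs by (rule epoch_path[OF p])
  have t0: "ep.table 0 j = z (p (Suc j)) - zs (p (Suc j))" for j by (simp add: ep.table_def)
  have ws: "ep.ws = avg zs" by (simp add: ep.ws_def sum_visit[OF p, of zs] avg_def)
  have e0: "ep.energy 0 = V z"
    unfolding ep.energy_def t0 V_def sum_visit[OF p, of "\<lambda>i. (z i - zs i) \<bullet> (z i - zs i)", symmetric] ..
  show ?thesis
  proof (rule exI[of _ "ep.energy"], rule exI[of _ "\<lambda>j. ep.loss_r j + ep.loss_f j"], rule exI[of _ "ep.var"], intro conjI allI impI)
    show "ep.energy 0 = V z" by (rule e0)
  next
    fix j assume j: "j < n"
    show "ep.energy (Suc j) = (1 + 1 / real n) * ep.energy j - (z (p (Suc j))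
        - zs (p (Suc j))) \<bullet> (z (p (Suc j)) - zs (p (Suc j))) - (ep.var j + (ep.loss_r j + ep.loss_f j))"
      using ep.energy_Suc[OF j] by (simp add: t0)
    show "ep.loss_r j + ep.loss_f j \<ge> 0" using ep.loss_r_nonneg ep.loss_f_nonneg[OF j] by simp
    show "ep.var j \<ge> 0" by (rule ep.var_nonneg)
    show "(\<Sum>l\<in>{j..<n}. \<Sum>l'\<in>{j..<n}. (z (p (Suc l)) - zs (p (Suc l)) - (z (p (Suc l')) - zs (p (Suc l')))) \<bullet>
            (z (p (Suc l)) - zs (p (Suc l)) - (z (p (Suc l')) - zs (p (Suc l'))))) \<le> 2 * real (n - j) * real n * ep.var j"
      using ep.var_ge[OF j] by (simp only: t0)
  next
    fix \<theta> z' assume z': "epoch \<theta> p z z'"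
    have "V z' = (\<Sum>j<n. (z' (p (Suc j)) - zs (p (Suc j))) \<bullet> (z' (p (Suc j)) - zs (p (Suc j))))"
      unfolding V_def sum_visit[OF p, of "\<lambda>i. (z' i - zs i) \<bullet> (z' i - zs i)", symmetric] ..
    also have "\<dots> = (\<Sum>j<n. (1 - \<theta>) * (ep.table 0 j \<bullet> ep.table 0 j)
        + \<theta> * (ep.table n j \<bullet> ep.table n j) - \<theta> * (1 - \<theta>) * (incr p z j \<bullet> incr p z j))"
    proof (intro sum.cong refl)
      fix j assume "j \<in> {..<n}"
      then have j: "j < n" by simp
      have "z' (p (Suc j)) - zs (p (Suc j)) = ep.table 0 j + \<theta> *\<^sub>R incr p z j"
        using z' j by (simp add: epoch_def t0)
      moreover have "ep.table n j = ep.table 0 j + incr p z j" using j by (simp add: ep.table_def)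
      moreover have "(a + \<theta> *\<^sub>R b) \<bullet> (a + \<theta> *\<^sub>R b) = (1
          - \<theta>) * (a \<bullet> a) + \<theta> * ((a + b) \<bullet> (a + b)) - \<theta> * (1
          - \<theta>) * (b \<bullet> b)" for a b :: 'a
        by (simp add: inner_add inner_commute algebra_simps)
      ultimately show "(z' (p (Suc j)) - zs (p (Suc j))) \<bullet> (z' (p (Suc j)) - zs (p (Suc j))) =
        (1 - \<theta>) * (ep.table 0 j \<bullet> ep.table 0 j) + \<theta> * (ep.table n j \<bullet> ep.table n j)
            - \<theta> * (1 - \<theta>) * (incr p z j \<bullet> incr p z j)" by simp
    qed
    also have "\<dots> = (1 - \<theta>) * V z + \<theta> * ep.energy n - \<theta> * (1 - \<theta>) * \<Phi> p z"
      unfolding e0[symmetric] ep.energy_def \<Phi>_def by (simp add: sum.distrib sum_subtractf sum_distrib_left)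
    finally show "V z' = (1 - \<theta>) * V z + \<theta> * ep.energy n - \<theta> * (1 - \<theta>) * \<Phi> p z" .
  next
    have s: "(\<Sum>j<n. \<phi> (p (Suc j)) y) = (\<Sum>i=1..n. \<phi> i y)" for y
      by (rule sum_visit[OF p, of "\<lambda>i. \<phi> i y"])
    have "(\<Sum>j<n. (z (p (Suc j)) - zs (p (Suc j)) - (avg z - avg zs)) \<bullet> (z (p (Suc j)) - zs (p (Suc j)) - (avg z - avg zs)))
       = (\<Sum>i=1..n. (z i - zs i - (avg z - avg zs)) \<bullet> (z i - zs i - (avg z - avg zs)))"
      by (rule sum_visit[OF p, of "\<lambda>i. (z i - zs i - (avg z - avg zs)) \<bullet> (z i - zs i - (avg z - avg zs))"])
    then show "gap z \<le> 785 / 1000 * \<Phi> p z + 3055 / 1000 * (\<Sum>j<n. ep.loss_r j + ep.loss_f j)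
        + 15275 / 10000 * (\<Sum>i=1..n. (z i - zs i - (avg z - avg zs)) \<bullet> (z i - zs i - (avg z - avg zs)))"
      using ep.gap_bound unfolding t0 ws s by (simp add: gap_def \<Phi>_def)
  next
    show "J z \<le> 2367 / 1000 * \<Phi> p z"
      using ep.residual_bound
      unfolding J_def \<Phi>_def sum_visit[OF p, of "\<lambda>i. (z i - (P (avg z)
          - D i (P (avg z)))) \<bullet> (z i - (P (avg z) - D i (P (avg z))))", symmetric]
      by simp
  qed
qed

text \<open>\<open>Loss\<close> collects the variances and the losses of the epoch, summed over all
  orders. The factor 1 + 1/n of \<open>energy_Suc\<close> is harmless: the initial entry that is
  replaced contributes V / n in the mean, and the mean energy never exceeds V.\<close>

lemma expected_dissipation:
  assumes n2: "n \<ge> 2" and nx: "\<And>p. p \<in> S \<Longrightarrow> epoch \<theta> p z (nx p)" and th: "0 \<le> \<theta>"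
  obtains Loss where "Loss \<ge> 0"
    "(\<Sum>p\<in>S. V (nx p)) \<le> fact n * V z - \<theta> * Loss - \<theta> * (1 - \<theta>) * (\<Sum>p\<in>S. \<Phi> p z)"
    "fact n * gap z \<le> 785 / 1000 * (\<Sum>p\<in>S. \<Phi> p z) + 3055 / 1000 * Loss"
    "fact n * J z \<le> 2367 / 1000 * (\<Sum>p\<in>S. \<Phi> p z)"
proof -
  define a where "a i = z i - zs i" for i
  define S0 where "S0 = (\<Sum>i=1..n. (a i - (avg z - avg zs)) \<bullet> (a i - (avg z - avg zs)))"
  \<comment> \<open>The witnesses are packed into triples and chosen for all orders at once, so that
    they can be summed over \<open>S\<close>.\<close>
  have "\<forall>p\<in>S. \<exists>q. case q of (en, lo, va) \<Rightarrow> en 0 = V z \<and>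
    (\<forall>j<n. en (Suc j) = (1 + 1 / real n) * en j - a (p (Suc j)) \<bullet> a (p (Suc j)) - (va j + lo j)
       \<and> lo j \<ge> 0 \<and> va j \<ge> 0
       \<and> (\<Sum>l\<in>{j..<n}. \<Sum>l'\<in>{j..<n}. (a (p (Suc l)) - a (p (Suc l'))) \<bullet> (a (p (Suc l))
           - a (p (Suc l')))) \<le> 2 * real (n - j) * real n * va j)
    \<and> (\<forall>\<theta> z'. epoch \<theta> p z z' \<longrightarrow> V z' = (1 - \<theta>) * V z
        + \<theta> * en n - \<theta> * (1 - \<theta>) * \<Phi> p z)
    \<and> gap z \<le> 785 / 1000 * \<Phi> p z + 3055 / 1000 * (\<Sum>j<n. lo j) + 15275 / 10000 * S0
    \<and> J z \<le> 2367 / 1000 * \<Phi> p z"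
    using epoch_facts[of _ z] unfolding a_def S0_def split_paired_Ex case_prod_conv by blast
  from bchoice[OF this] obtain q where q: "\<forall>p\<in>S. case q p of (en, lo, va) \<Rightarrow> en 0 = V z \<and>
    (\<forall>j<n. en (Suc j) = (1 + 1 / real n) * en j - a (p (Suc j)) \<bullet> a (p (Suc j)) - (va j + lo j)
       \<and> lo j \<ge> 0 \<and> va j \<ge> 0
       \<and> (\<Sum>l\<in>{j..<n}. \<Sum>l'\<in>{j..<n}. (a (p (Suc l)) - a (p (Suc l'))) \<bullet> (a (p (Suc l))
           - a (p (Suc l')))) \<le> 2 * real (n - j) * real n * va j)
    \<and> (\<forall>\<theta> z'. epoch \<theta> p z z' \<longrightarrow> V z' = (1 - \<theta>) * V z
        + \<theta> * en n - \<theta> * (1 - \<theta>) * \<Phi> p z)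
    \<and> gap z \<le> 785 / 1000 * \<Phi> p z + 3055 / 1000 * (\<Sum>j<n. lo j) + 15275 / 10000 * S0
    \<and> J z \<le> 2367 / 1000 * \<Phi> p z" by blast
  define en lo va where "en p = fst (q p)" and "lo p = fst (snd (q p))" and "va p = snd (snd (q p))" for p
  have F: "en p 0 = V z"
    "j < n \<Longrightarrow> en p (Suc j) = (1 + 1 / real n) * en p j - a (p (Suc j)) \<bullet> a (p (Suc j)) - (va p j + lo p j)"
    "j < n \<Longrightarrow> lo p j \<ge> 0" "j < n \<Longrightarrow> va p j \<ge> 0"
    "j < n \<Longrightarrow> (\<Sum>l\<in>{j..<n}. \<Sum>l'\<in>{j..<n}. (a (p (Suc l))
        - a (p (Suc l'))) \<bullet> (a (p (Suc l)) - a (p (Suc l')))) \<le> 2 * real (n - j) * real n * va p j"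
    "epoch \<theta> p z z' \<Longrightarrow> V z' = (1 - \<theta>) * V z + \<theta> * en p n - \<theta> * (1 - \<theta>) * \<Phi> p z"
    "gap z \<le> 785 / 1000 * \<Phi> p z + 3055 / 1000 * (\<Sum>j<n. lo p j) + 15275 / 10000 * S0"
    "J z \<le> 2367 / 1000 * \<Phi> p z"
    if "p \<in> S" for p j \<theta> z'
    using bspec[OF q that] by (simp_all add: en_def lo_def va_def case_prod_unfold)
  define N where "N = real n"
  have N: "N \<ge> 2" using n2 by (simp add: N_def)
  define Lj where "Lj j = (\<Sum>p\<in>S. va p j + lo p j)" for j
  define Va where "Va j = (\<Sum>p\<in>S. va p j)" for j
  have L0: "Lj j \<ge> 0" if "j < n" for j unfolding Lj_def using F that by (intro sum_nonneg add_nonneg_nonneg) auto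
  have at: "(\<Sum>p\<in>S. a (p (Suc j)) \<bullet> a (p (Suc j))) = fact n * V z / N" if "j < n" for j
    using sum_permutes_at[of "{1..n}" "Suc j" "\<lambda>i. a i \<bullet> a i"] that N by (simp add: V_def a_def N_def field_simps)
  have "(\<Sum>p\<in>S. en p m) \<le> fact n * V z - (\<Sum>j<m. Lj j)" if "m \<le> n" for m
    using that
  proof (induction m)
    case 0
    have "(\<Sum>p\<in>S. en p 0) = (\<Sum>p\<in>S. V z)" by (intro sum.cong) (auto simp: F)
    then show ?case by (simp add: card_S)
  next
    case (Suc m)
    then have m: "m < n" and IH: "(\<Sum>p\<in>S. en p m) \<le> fact n * V z - (\<Sum>j<m. Lj j)" by auto
    have "(\<Sum>p\<in>S. en p (Suc m)) = (\<Sum>p\<in>S. (1 + 1 / N) * en p m - a (p (Suc m)) \<bullet> a (p (Suc m)) - (va p m + lo p m))"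
      unfolding N_def by (intro sum.cong refl F(2) m)
    also have "\<dots> = (1 + 1 / N) * (\<Sum>p\<in>S. en p m) - fact n * V z / N - Lj m"
      by (simp only: sum_subtractf sum_distrib_left[symmetric] at[OF m] Lj_def)
    also have "(1 + 1 / N) * (\<Sum>p\<in>S. en p m) \<le> (fact n * V z - (\<Sum>j<m. Lj j)) + fact n * V z / N"
    proof -
      have "0 \<le> (\<Sum>j<m. Lj j)" using L0 m by (intro sum_nonneg) auto
      then have "(\<Sum>p\<in>S. en p m) / N \<le> fact n * V z / N" using IH N by (intro divide_right_mono) auto
      then show ?thesis using IH by (simp add: distrib_right)
    qed
    finally show ?case by simp
  qed
  from this[of n] have en: "(\<Sum>p\<in>S. en p n) \<le> fact n * V z - (\<Sum>j<n. Lj j)" by simp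
  \<comment> \<open>The squared distance of the errors at two fixed distinct positions, summed over
    all orders.\<close>
  define T where "T = fact n * (2 * N * S0) / (N * (N - 1))"
  have pw: "(\<Sum>i=1..n. \<Sum>i'=1..n. (a i - a i') \<bullet> (a i - a i')) = 2 * N * S0"
  proof -
    define w where "w = avg z - avg zs"
    have sw: "(\<Sum>i=1..n. a i - w) = 0"
      using n by (simp add: w_def a_def avg_def sum_subtractf sum_constant_scaleR scaleR_diff_right)
    have "(\<Sum>i=1..n. \<Sum>i'=1..n. ((a i - w) - (a i' - w)) \<bullet> ((a i - w) - (a i' - w))) = 2 * N * S0"
      unfolding sum_pairwise_dist sw by (simp add: S0_def w_def N_def)
    then show ?thesis by simp
  qed
  have at2: "(\<Sum>p\<in>S. (a (p (Suc l)) - a (p (Suc l'))) \<bullet> (a (p (Suc l)) - a (p (Suc l')))) = (if l = l' then 0 else T)"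
    if "l < n" "l' < n" for l l'
  proof (cases "l = l'")
    case False
    have "N * (N - 1) * (\<Sum>p\<in>S. (a (p (Suc l)) - a (p (Suc l'))) \<bullet> (a (p (Suc l))
        - a (p (Suc l')))) = fact n * (2 * N * S0)"
    proof -
      have h: "(a i - a i') \<bullet> (a i - a i') = (a i' - a i) \<bullet> (a i' - a i)" for i i'
        by (simp add: inner_diff inner_commute)
      show ?thesis
        using sum_permutes_at2[of "{1..n}" "Suc l" "Suc l'" "\<lambda>i i'. (a i - a i') \<bullet> (a i - a i')", OF _ _ _ _ h] that False
        by (simp add: pw N_def)
    qed
    then show ?thesis using False N by (simp add: T_def field_simps)
  qed simp
  have T0: "T \<ge> 0" using N by (simp add: T_def S0_def sum_nonneg)
  have Va: "(real n - real j - 1) * T / (2 * N) \<le> Va j" if j: "j < n" for j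
  proof -
    define m where "m = real (n - j)"
    have m: "m > 0" using j by (simp add: m_def)
    have "m * (m - 1) * T = (\<Sum>l\<in>{j..<n}. \<Sum>l'\<in>{j..<n}. if l = l' then 0 else T)"
    proof -
      have "(\<Sum>l'\<in>{j..<n}. if l = l' then 0 else T) = (m - 1) * T" if l: "l \<in> {j..<n}" for l
      proof -
        have "(\<Sum>l'\<in>{j..<n}. if l = l' then 0 else T) = (\<Sum>l'\<in>{j..<n}. T - (if l = l' then T else 0))"
          by (intro sum.cong) auto
        also have "\<dots> = m * T - T" unfolding sum_subtractf using l by (simp add: m_def del: of_nat_diff)
        finally show ?thesis by (simp add: algebra_simps)
      qed
      then show ?thesis by (simp add: m_def del: of_nat_diff)
    qed
    also have "\<dots> = (\<Sum>l\<in>{j..<n}. \<Sum>l'\<in>{j..<n}. \<Sum>p\<in>S. (a (p (Suc l))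
        - a (p (Suc l'))) \<bullet> (a (p (Suc l)) - a (p (Suc l'))))"
      by (intro sum.cong refl at2[symmetric]) auto
    also have "\<dots> = (\<Sum>l\<in>{j..<n}. \<Sum>p\<in>S. \<Sum>l'\<in>{j..<n}. (a (p (Suc l))
        - a (p (Suc l'))) \<bullet> (a (p (Suc l)) - a (p (Suc l'))))"
      by (intro sum.cong refl sum.swap)
    also have "\<dots> = (\<Sum>p\<in>S. \<Sum>l\<in>{j..<n}. \<Sum>l'\<in>{j..<n}. (a (p (Suc l))
        - a (p (Suc l'))) \<bullet> (a (p (Suc l)) - a (p (Suc l'))))"
      by (rule sum.swap)
    also have "\<dots> \<le> (\<Sum>p\<in>S. 2 * m * N * va p j)"
      unfolding m_def N_def by (intro sum_mono F(5) j)
    also have "\<dots> = m * (2 * N * Va j)" by (simp add: Va_def sum_distrib_left mult_ac)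
    finally have "(m - 1) * T \<le> 2 * N * Va j" using m by (simp add: mult.assoc)
    then show ?thesis using N j by (simp add: m_def field_simps of_nat_diff)
  qed
  \<comment> \<open>At time j the n - j unvisited entries contribute in proportion to n - j - 1.
    Over the epoch these factors add up to n (n - 1) / 2, which leaves exactly half of the initial
    spread.\<close>
  have "fact n * S0 / 2 \<le> (\<Sum>j<n. Va j)"
  proof -
    have "fact n * S0 / 2 = (\<Sum>j<n. (real n - real j - 1)) * (T / (2 * N))"
    proof -
      have sj: "(\<Sum>j<n. (real n - real j - 1)) = N * (N - 1) / 2"
      proof -
        have "(\<Sum>j<n. (real n - real j - 1)) = (\<Sum>j<n. (real n - 1) - real j)"
          by (intro sum.cong) auto
        also have "\<dots> = N * (N - 1) - (\<Sum>j<n. real j)"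
          unfolding sum_subtractf N_def sum_constant card_lessThan by argo
        finally show ?thesis unfolding sum_nat_real N_def by argo
      qed
      have "T / (2 * N) = fact n * S0 / (N * (N - 1))" using N by (simp add: T_def)
      then show ?thesis unfolding sj using N by simp
    qed
    also have "\<dots> = (\<Sum>j<n. (real n - real j - 1) * T / (2 * N))" by (simp add: sum_distrib_right sum_divide_distrib)
    also have "\<dots> \<le> (\<Sum>j<n. Va j)" by (intro sum_mono Va) auto
    finally show ?thesis .
  qed
  then have S0: "fact n * (15275 / 10000 * S0) \<le> 3055 / 1000 * (\<Sum>j<n. Va j)" by linarith
  have Lsplit: "(\<Sum>j<n. Lj j) = (\<Sum>j<n. Va j) + (\<Sum>p\<in>S. \<Sum>j<n. lo p j)"
    unfolding Lj_def Va_def sum.distrib by (simp add: sum.swap[of _ S])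
  show thesis
  proof (rule that[of "\<Sum>j<n. Lj j"])
    show "0 \<le> (\<Sum>j<n. Lj j)" using L0 by (intro sum_nonneg) auto
    have "(\<Sum>p\<in>S. V (nx p)) = (\<Sum>p\<in>S. (1 - \<theta>) * V z + \<theta> * en p n - \<theta> * (1 - \<theta>) * \<Phi> p z)"
      by (intro sum.cong refl F(6) nx)
    also have "\<dots> = fact n * ((1 - \<theta>) * V z) + \<theta> * (\<Sum>p\<in>S. en p n) - \<theta> * (1
        - \<theta>) * (\<Sum>p\<in>S. \<Phi> p z)"
      by (simp only: sum.distrib sum_subtractf sum_distrib_left[symmetric] sum_constant card_S of_nat_fact) (simp add: mult_ac)
    also have "\<dots> \<le> fact n * ((1 - \<theta>) * V z) + \<theta> * (fact n * V z - (\<Sum>j<n. Lj j))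
        - \<theta> * (1 - \<theta>) * (\<Sum>p\<in>S. \<Phi> p z)"
      using mult_left_mono[OF en th] by simp
    finally show "(\<Sum>p\<in>S. V (nx p)) \<le> fact n * V z - \<theta> * (\<Sum>j<n. Lj j) - \<theta> * (1
        - \<theta>) * (\<Sum>p\<in>S. \<Phi> p z)"
      by (simp add: algebra_simps)
    have "fact n * gap z = (\<Sum>p\<in>S. gap z)" by (simp add: card_S)
    also have "\<dots> \<le> (\<Sum>p\<in>S. 785 / 1000 * \<Phi> p z + 3055 / 1000 * (\<Sum>j<n. lo p j) + 15275 / 10000 * S0)"
      by (intro sum_mono F(7))
    also have "\<dots> = 785 / 1000 * (\<Sum>p\<in>S. \<Phi> p z)
        + 3055 / 1000 * (\<Sum>p\<in>S. \<Sum>j<n. lo p j) + fact n * (15275 / 10000 * S0)"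
      by (simp only: sum.distrib sum_distrib_left[symmetric] sum_constant card_S of_nat_fact)
    finally show "fact n * gap z \<le> 785 / 1000 * (\<Sum>p\<in>S. \<Phi> p z) + 3055 / 1000 * (\<Sum>j<n. Lj j)"
      using S0 unfolding Lsplit distrib_left by linarith
    have "fact n * J z = (\<Sum>p\<in>S. J z)" by (simp add: card_S)
    also have "\<dots> \<le> (\<Sum>p\<in>S. 2367 / 1000 * \<Phi> p z)" by (intro sum_mono F(8))
    finally show "fact n * J z \<le> 2367 / 1000 * (\<Sum>p\<in>S. \<Phi> p z)" by (simp add: sum_distrib_left)
  qed
qed

end

section \<open>Choice of the constants and the supermartingale\<close>

lemma exp_ge_quartic: "0 \<le> x \<Longrightarrow> (1 + x / 4 + (x / 4)\<^sup>2 / 2) ^ 4 \<le> exp x" for x :: real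
proof -
  assume "0 \<le> x"
  then have "(1 + x / 4 + (x / 4)\<^sup>2 / 2) ^ 4 \<le> exp (x / 4) ^ 4"
    by (intro power_mono exp_lower_Taylor_quadratic) auto
  also have "\<dots> = exp x" by (simp add: exp_of_nat_mult[symmetric])
  finally show ?thesis .
qed

text \<open>\<open>z1\<close> is 10354/100000 for b = 11/10 and 355/1000 for b = 1/2, each just
  above the logarithm of the required factor. For b = 11/10 the condition with \<open>1 - z1\<close>
  is nearly tight: about 0.1595 on the left, against 1/4 - 9/100 = 0.16 at \<open>\<theta>\<close> =
  1/2.\<close>

lemma regime:
  fixes \<theta> :: real
  assumes th: "0 < \<theta>" "\<theta> < 1"
  obtains b m \<omega> z1 where "b > 0" "m > 0" "0 \<le> \<omega>" "\<omega> * \<theta>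
      \<le> 1" "\<And>d f :: 'a::real_inner. certificate \<theta> b m \<omega> d f"
    "1 \<le> 36 / 100 * (785 / 1000 + 2367 / 1000 * b) / b" "36 / 100 * (785 / 1000 + 2367 / 1000 * b) / b \<le> exp z1"
    "b / m * (1 - 36 / 100 * (785 / 1000 + 2367 / 1000 * b) / b * (1 - z1)) \<le> 1 / 4 - 36 / 100 * (\<theta> * (1 - \<theta>))"
    "36 / 100 / b * 3055 / 1000 * (\<theta> * (1 - \<theta>)) \<le> \<theta>"
proof -
  have "0 \<le> (\<theta> - 1 / 2)\<^sup>2" by simp
  then have s4: "\<theta> * (1 - \<theta>) \<le> 1 / 4" by (simp add: power2_eq_square algebra_simps)
  have e1: "36 / 100 * (785 / 1000 + 2367 / 1000 * (11 / 10)) / (11 / 10) \<le> exp (10354 / 100000 :: real)"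
    by (rule order_trans[OF _ exp_ge_quartic]) (simp_all add: power2_eq_square power4_eq_xxxx)
  have t: "\<theta> * (1 - \<theta>) * c \<le> \<theta>" if "0 \<le> c" "c * (1 - \<theta>) \<le> 1" for c
    using mult_left_mono[OF that(2), of \<theta>] th by (simp add: mult_ac)
  have c1: "36 / 100 / (11 / 10) * 3055 / 1000 * (\<theta> * (1 - \<theta>)) \<le> \<theta>"
    using t[of "36 / 100 / (11 / 10) * 3055 / 1000"] th by (simp add: algebra_simps)
  consider "\<theta> \<le> 2 / 5" | "2 / 5 \<le> \<theta>" "\<theta> \<le> 7 / 10" | "7 / 10 \<le> \<theta>" by linarith
  then show thesis
  proof cases
    case 1
    show ?thesis
      by (rule that[of "11 / 10" "1 / 25" "101 / 50" "10354 / 100000"])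
        (use 1 th s4 e1 c1 in \<open>auto intro!: certificate_a\<close>)
  next
    case 2
    show ?thesis
      by (rule that[of "11 / 10" "1 / 25" "7 / 5" "10354 / 100000"])
        (use 2 th s4 e1 c1 in \<open>auto intro!: certificate_b\<close>)
  next
    case 3
    have e2: "36 / 100 * (785 / 1000 + 2367 / 1000 * (1 / 2)) / (1 / 2) \<le> exp (355 / 1000 :: real)"
      by (rule order_trans[OF _ exp_ge_quartic]) (simp_all add: power2_eq_square power4_eq_xxxx)
    \<comment> \<open>For b = 1/2 the general bound 1/4 would be too weak: the left side of the
      condition with \<open>1 - z1\<close> is about 0.172, above 0.16.\<close>
    have "0 \<le> (\<theta> - 7 / 10) * (\<theta> - 3 / 10)" using 3 by simp
    then have s3: "\<theta> * (1 - \<theta>) \<le> 21 / 100" by (simp add: algebra_simps)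
    have c2: "36 / 100 / (1 / 2) * 3055 / 1000 * (\<theta> * (1 - \<theta>)) \<le> \<theta>"
      using t[of "36 / 100 / (1 / 2) * 3055 / 1000"] 3 by (simp add: algebra_simps)
    show ?thesis
      by (rule that[of "1 / 2" "1 / 4" 1 "355 / 1000"])
        (use 3 th s3 e2 c2 in \<open>auto intro!: certificate_c\<close>)
  qed
qed

context finite_sum
begin

text \<open>The path estimates assume 1/n at most 1/2, so n = 1 is treated by itself. There
  \<open>\<Phi>\<close> equals \<open>J\<close>, and the new residual is 1 - \<open>\<theta>\<close>
  times the old one plus the change of a nonexpansive map over a distance of at most
  \<open>\<theta>\<close> times its norm. Thus \<open>J\<close> alone does not increase.\<close>

lemma lyapunov_single:
  assumes th: "0 < \<theta>" "\<theta> < 1" and n1: "n = 1" and p: "p \<in> S" and z': "epoch \<theta> p z z'"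
  shows "V z' \<le> V z - \<theta> * (1 - \<theta>) * J z" and "J z' \<le> J z"
proof -
  have p1: "p 1 = 1" using p permutes_in_image[of p "{1..n}" 1] n1 by simp
  have av: "avg y = y 1" for y unfolding avg_def using n1 by simp
  define x where "x = P (avg z)"
  define x' where "x' = P (avg z')"
  define e where "e = x - D 1 x - z 1"
  have inc: "incr p z 0 = e" by (simp add: incr_def p1 x_def e_def One_nat_def[symmetric])
  have z1: "z' 1 = z 1 + \<theta> *\<^sub>R e" 
  proof -
    have "z' (p (Suc 0)) = z (p (Suc 0)) + \<theta> *\<^sub>R incr p z 0" using z' n unfolding epoch_def by simp
    then show ?thesis using p1 inc by (simp add: One_nat_def[symmetric])
  qed
  have Phi: "\<Phi> p z = e \<bullet> e" unfolding \<Phi>_def using n1 inc by (simp add: One_nat_def)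
  have Jz: "J z = e \<bullet> e"
    unfolding J_def x_def[symmetric] using n1 by (simp add: e_def inner_diff inner_commute)
  obtain en lo va where en: "en 0 = V z"
    "\<forall>j<n. en (Suc j) = (1 + 1 / real n) * en j - (z (p (Suc j)) - zs (p (Suc j))) \<bullet> (z (p (Suc j))
        - zs (p (Suc j))) - (va j + lo j)
       \<and> lo j \<ge> 0 \<and> va j \<ge> 0"
    "V z' = (1 - \<theta>) * V z + \<theta> * en n - \<theta> * (1 - \<theta>) * \<Phi> p z"
    using epoch_facts[OF p, of z] z' by blast
  have "V z = (z 1 - zs 1) \<bullet> (z 1 - zs 1)" unfolding V_def using n1 by simp
  then have "en 1 \<le> V z" using en(1) spec[OF en(2), of 0] n1 p1 by (simp add: One_nat_def[symmetric])
  then have "\<theta> * en n \<le> \<theta> * V z" using n1 th by simp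
  then show "V z' \<le> V z - \<theta> * (1 - \<theta>) * J z" unfolding en(3) Phi Jz by (simp add: algebra_simps)
  have "norm (x' - x) \<le> norm (avg z' - avg z)"
  proof -
    have "(x' - x) \<bullet> (x' - x) \<le> (avg z' - avg z) \<bullet> (x' - x)"
      unfolding x_def x'_def using prox by (rule prox_firmly_nonexpansive)
    moreover have "0 \<le> ((avg z' - avg z) - (x' - x)) \<bullet> ((avg z' - avg z) - (x' - x))" by simp
    ultimately show ?thesis unfolding norm_le
      by (simp only: inner_diff_left[of "avg z' - avg z"] inner_diff_right[of _ "avg z'
          - avg z"] inner_commute[of "x' - x" "avg z' - avg z"])
  qed
  also have "\<dots> = \<theta> * norm e" using th by (simp add: av z1)
  finally have xx: "norm (x' - x) \<le> \<theta> * norm e" .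
  have "norm ((x - D 1 x) - (x' - D 1 x')) \<le> norm (x - x')"
    unfolding norm_le by (rule grad_step_nonexpansive) (rule coco, use n1 in simp)
  then have "norm ((x - D 1 x) - (x' - D 1 x')) \<le> \<theta> * norm e" using xx by (simp add: norm_minus_commute)
  moreover have eq: "z' 1 - (x' - D 1 x') = ((x - D 1 x) - (x' - D 1 x')) - (1 - \<theta>) *\<^sub>R e"
    unfolding z1 by (simp add: e_def algebra_simps)
  have "norm (z' 1 - (x' - D 1 x')) \<le> norm ((x - D 1 x) - (x' - D 1 x')) + (1 - \<theta>) * norm e"
    unfolding eq using norm_triangle_ineq4[of "(x - D 1 x) - (x' - D 1 x')" "(1 - \<theta>) *\<^sub>R e"] th by simp
  ultimately have "norm (z' 1 - (x' - D 1 x')) \<le> norm e" by (simp add: algebra_simps)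
  then show "J z' \<le> J z"
    unfolding Jz unfolding J_def x'_def[symmetric] using n1 by (simp add: norm_le)
qed

text \<open>Raising the weight from \<open>C k\<close> to \<open>C (Suc k)\<close> costs a multiple
  of \<open>\<psi>\<close>, which is bounded by \<open>\<Phi>\<close> and the loss. The
  \<open>\<Phi>\<close> part is paid by the damping term of \<open>V\<close> together with the
  descent of \<open>\<psi>\<close> at the new weight, the other part by the loss term of
  \<open>V\<close>; these are the two growth conditions on \<open>C\<close>.\<close>

lemma lyapunov:
  assumes th: "0 < \<theta>" "\<theta> < 1"
  obtains W where "\<And>z. W 0 z = V z"
    "\<And>k z nx. (\<And>p. p \<in> S \<Longrightarrow> epoch \<theta> p z (nx p)) \<Longrightarrow> (\<Sum>p\<in>S. W (Suc k) (nx p)) \<le> fact n * W k z"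
    "\<And>k z. 36 / 100 * (\<theta> * (1 - \<theta>)) * (real k + 1) * J z \<le> W k z"
proof (cases "n = 1")
  case n1: True
  define \<sigma> where "\<sigma> = \<theta> * (1 - \<theta>)"
  have "0 \<le> (\<theta> - 1 / 2)\<^sup>2" by simp
  then have s4: "\<sigma> \<le> 1 / 4" by (simp add: \<sigma>_def power2_eq_square algebra_simps)
  have s0: "\<sigma> > 0" using th by (simp add: \<sigma>_def)
  show thesis
  proof (rule that[of "\<lambda>k z. V z + \<sigma> * real k * J z"])
    fix k z nx assume nx: "\<And>p. p \<in> S \<Longrightarrow> epoch \<theta> p z (nx p)"
    have "(\<Sum>p\<in>S. V (nx p) + \<sigma> * real (Suc k) * J (nx p)) \<le> (\<Sum>p\<in>S. V z + \<sigma> * real k * J z)"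
    proof (intro sum_mono)
      fix p assume p: "p \<in> S"
      have "\<sigma> * real (Suc k) * J (nx p) \<le> \<sigma> * real (Suc k) * J z"
        using lyapunov_single(2)[OF th n1 p nx[OF p]] s0 by (intro mult_left_mono) auto
      then show "V (nx p) + \<sigma> * real (Suc k) * J (nx p) \<le> V z + \<sigma> * real k * J z"
        using lyapunov_single(1)[OF th n1 p nx[OF p]] unfolding \<sigma>_def[symmetric] by (simp add: algebra_simps)
    qed
    then show "(\<Sum>p\<in>S. V (nx p) + \<sigma> * real (Suc k) * J (nx p)) \<le> fact n * (V z + \<sigma> * real k * J z)"
      by (simp only: sum_constant card_S of_nat_fact)
  next
    fix k z
    have "36 / 100 * \<sigma> * J z \<le> V z"
      using mult_right_mono[OF s4 J_nonneg[of z]] J_le_V[of z] J_nonneg[of z] by simp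
    moreover have "36 / 100 * (\<sigma> * real k * J z) \<le> 1 * (\<sigma> * real k * J z)"
      using s0 J_nonneg by (intro mult_right_mono) auto
    ultimately show "36 / 100 * (\<theta> * (1 - \<theta>)) * (real k + 1) * J z \<le> V z + \<sigma> * real k * J z"
      unfolding \<sigma>_def[symmetric] by (simp add: algebra_simps)
  qed simp
next
  case False
  then have n2: "n \<ge> 2" using n by simp
  define \<sigma> where "\<sigma> = \<theta> * (1 - \<theta>)"
  have s0: "\<sigma> > 0" using th by (simp add: \<sigma>_def)
  obtain b m \<omega> z1 where par: "b > 0" "m > 0" "0 \<le> \<omega>" "\<omega> * \<theta> \<le> 1"
      and certificate: "\<And>d f :: 'a. certificate \<theta> b m \<omega> d f"
    and gr: "1 \<le> 36 / 100 * (785 / 1000 + 2367 / 1000 * b) / b" "36 / 100 * (785 / 1000 + 2367 / 1000 * b) / b \<le> exp z1"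
    "b / m * (1 - 36 / 100 * (785 / 1000 + 2367 / 1000 * b) / b * (1 - z1)) \<le> 1 / 4 - 36 / 100 * \<sigma>"
    "36 / 100 / b * 3055 / 1000 * \<sigma> \<le> \<theta>"
    using regime[OF th] unfolding \<sigma>_def by blast
  obtain C where C: "C 0 = 0" "\<And>k. C k \<ge> 0" "\<And>k. C k \<le> C (Suc k)"
    "\<And>k. (C (Suc k) - C k) * (785 / 1000 + 2367 / 1000 * b) \<le> 1 + m * \<sigma> * C (Suc k)"
    "\<And>k. (C (Suc k) - C k) * (3055 / 1000) * \<sigma> \<le> \<theta>"
    "\<And>k. 36 / 100 * \<sigma> * (real k + 1) \<le> 1 / 4 + \<sigma> * b * C k"
    using growth_sequence[OF par(1,2) s0 refl gr] by blast
  define \<psi> where "\<psi> z = gap z + b * J z" for z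
  show thesis
  proof (rule that[of "\<lambda>k z. V z + \<sigma> * C k * \<psi> z"])
    fix k z nx assume nx: "\<And>p. p \<in> S \<Longrightarrow> epoch \<theta> p z (nx p)"
    from th have "0 \<le> \<theta>" by simp
    from expected_dissipation[OF n2 nx this] obtain Loss where L: "Loss \<ge> 0"
      "(\<Sum>p\<in>S. V (nx p)) \<le> fact n * V z - \<theta> * Loss - \<theta> * (1 - \<theta>) * (\<Sum>p\<in>S. \<Phi> p z)"
      "fact n * gap z \<le> 785 / 1000 * (\<Sum>p\<in>S. \<Phi> p z) + 3055 / 1000 * Loss"
      "fact n * J z \<le> 2367 / 1000 * (\<Sum>p\<in>S. \<Phi> p z)" by blast
    define Ph where "Ph = (\<Sum>p\<in>S. \<Phi> p z)"
    have Ph0: "Ph \<ge> 0" unfolding Ph_def by (intro sum_nonneg Phi_nonneg)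
    have "(\<Sum>p\<in>S. \<psi> (nx p)) \<le> (\<Sum>p\<in>S. \<psi> z - m * \<theta> * (1 - \<theta>) * \<Phi> p z)"
    proof (intro sum_mono)
      fix p assume p: "p \<in> S"
      show "\<psi> (nx p) \<le> \<psi> z - m * \<theta> * (1 - \<theta>) * \<Phi> p z"
        using psi_descent[OF n2 th par(3,4) certificate _ nx[OF p]] p unfolding \<psi>_def by simp
    qed
    also have "\<dots> = fact n * \<psi> z - m * \<sigma> * Ph"
      by (simp only: sum_subtractf sum_constant card_S of_nat_fact sum_distrib_left[symmetric] Ph_def \<sigma>_def mult.assoc)
    finally have "\<sigma> * C (Suc k) * (\<Sum>p\<in>S. \<psi> (nx p))
        \<le> \<sigma> * C (Suc k) * (fact n * \<psi> z - m * \<sigma> * Ph)"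
      using s0 C(2) by (intro mult_left_mono) auto
    then have 1: "\<sigma> * C (Suc k) * (\<Sum>p\<in>S. \<psi> (nx p))
        \<le> \<sigma> * C (Suc k) * (fact n * \<psi> z) - \<sigma> * (m * \<sigma> * C (Suc k)) * Ph"
      by (simp add: algebra_simps)
    have "fact n * \<psi> z = fact n * gap z + b * (fact n * J z)" by (simp add: \<psi>_def algebra_simps)
    also have "\<dots> \<le> (785 / 1000 + 2367 / 1000 * b) * Ph + 3055 / 1000 * Loss"
    proof -
      have "b * (fact n * J z) \<le> b * (2367 / 1000 * Ph)"
        using L(4) par unfolding Ph_def by (intro mult_left_mono) auto
      then show ?thesis using L(3) unfolding Ph_def[symmetric] distrib_right by simp
    qed
    finally have "\<sigma> * (C (Suc k) - C k) * (fact n * \<psi> z) \<le> \<sigma> * (C (Suc k)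
        - C k) * ((785 / 1000 + 2367 / 1000 * b) * Ph + 3055 / 1000 * Loss)"
      using s0 C(3)[of k] by (intro mult_left_mono) auto
    also have "\<dots> = \<sigma> * (((C (Suc k) - C k) * (785 / 1000 + 2367 / 1000 * b)) * Ph) + ((C (Suc k)
        - C k) * (3055 / 1000) * \<sigma>) * Loss"
      by (simp add: algebra_simps)
    also have "\<dots> \<le> \<sigma> * ((1 + m * \<sigma> * C (Suc k)) * Ph) + \<theta> * Loss"
      using s0 Ph0 L(1) by (intro add_mono mult_left_mono mult_right_mono C(4,5)) auto
    finally have 2: "\<sigma> * C (Suc k) * (fact n * \<psi> z) - \<sigma> * C k * (fact n * \<psi> z)
        \<le> \<sigma> * Ph + \<sigma> * (m * \<sigma> * C (Suc k)) * Ph + \<theta> * Loss"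
      by (simp add: algebra_simps)
    have "(\<Sum>p\<in>S. V (nx p) + \<sigma> * C (Suc k) * \<psi> (nx p)) = (\<Sum>p\<in>S. V (nx p))
        + \<sigma> * C (Suc k) * (\<Sum>p\<in>S. \<psi> (nx p))"
      by (simp only: sum.distrib sum_distrib_left[symmetric])
    also have "\<dots> \<le> fact n * V z + \<sigma> * C k * (fact n * \<psi> z)"
      using L(2) 1 2 unfolding Ph_def[symmetric] \<sigma>_def[symmetric] by linarith
    finally show "(\<Sum>p\<in>S. V (nx p) + \<sigma> * C (Suc k) * \<psi> (nx p)) \<le> fact n * (V z + \<sigma> * C k * \<psi> z)"
      by (simp add: algebra_simps)
  next
    fix k z
    have "36 / 100 * \<sigma> * (real k + 1) * J z \<le> (1 / 4 + \<sigma> * b * C k) * J z"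
      by (intro mult_right_mono C J_nonneg)
    also have "\<dots> = J z / 4 + \<sigma> * C k * (b * J z)" by (simp add: algebra_simps)
    also have "\<dots> \<le> V z + \<sigma> * C k * \<psi> z"
      using J_le_V[of z] gap_nonneg[of z] s0 C(2) by (intro add_mono mult_left_mono) (auto simp: \<psi>_def)
    finally show "36 / 100 * (\<theta> * (1 - \<theta>)) * (real k + 1) * J z \<le> V z + \<sigma> * C k * \<psi> z"
      by (simp add: \<sigma>_def)
  qed (simp add: C)
qed

end

section \<open>The proximal map\<close>

lemma ccp_dom: "closed_convex_proper r \<Longrightarrow> r x \<noteq> \<infinity> \<Longrightarrow> r x = ereal (real_of_ereal (r x))"
  by (cases "r x") (auto simp: closed_convex_proper_def)

lemma ccp_convex:
  assumes r: "closed_convex_proper r" and fin: "r x \<noteq> \<infinity>" "r y \<noteq> \<infinity>" and t: "0 \<le> t" "t \<le> 1"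
  shows "r ((1 - t) *\<^sub>R x + t *\<^sub>R y) \<le> ereal ((1 - t) * real_of_ereal (r x) + t * real_of_ereal (r y))"
proof -
  have "(x, real_of_ereal (r x)) \<in> epi r" "(y, real_of_ereal (r y)) \<in> epi r"
    using ccp_dom[OF r] fin by (auto simp: epi_def)
  then have "(1 - t) *\<^sub>R (x, real_of_ereal (r x)) + t *\<^sub>R (y, real_of_ereal (r y)) \<in> epi r"
    using r t by (intro convexD) (auto simp: closed_convex_proper_def)
  then show ?thesis by (simp add: epi_def)
qed

lemma minimizer_finite:
  assumes r: "closed_convex_proper r" and a: "0 < a"
    and min: "\<And>y. ereal a * r p + ereal (\<Psi> p) \<le> ereal a * r y + ereal (\<Psi> y)"
  shows "r p \<noteq> \<infinity>"
proof
  assume "r p = \<infinity>"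
  from r obtain y where "r y \<noteq> \<infinity>" by (auto simp: closed_convex_proper_def)
  with ccp_dom[OF r] obtain c where "r y = ereal c" by blast
  then show False using min[of y] \<open>r p = \<infinity>\<close> a by simp
qed

text \<open>Fermat's rule: compare \<open>p\<close> with the points of the segment to y, divide by t
  and let t tend to 0. \<open>\<Psi>\<close> enters only through a quadratic upper expansion, so the
  rule serves both for the square in the proximal map and for F at \<open>xstar\<close>.\<close>

lemma minimizer_subdiff:
  fixes r :: "'a::euclidean_space \<Rightarrow> ereal"
  assumes r: "closed_convex_proper r" and a: "0 < a"
    and min: "\<And>y. ereal a * r p + ereal (\<Psi> p) \<le> ereal a * r y + ereal (\<Psi> y)"
    and \<Psi>: "\<And>y t. 0 \<le> t \<Longrightarrow> t \<le> 1 \<Longrightarrow> \<Psi> ((1 - t) *\<^sub>R p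
        + t *\<^sub>R y) \<le> \<Psi> p + t * (G \<bullet> (y - p)) + t\<^sup>2 * K y"
  shows "(- (1 / a)) *\<^sub>R G \<in> subdiff r p"
  unfolding subdiff_def
proof (intro CollectI allI)
  fix y
  have rp: "r p \<noteq> \<infinity>" by (rule minimizer_finite[OF r a min])
  define c where "c = real_of_ereal (r p)"
  have c: "r p = ereal c" unfolding c_def by (rule ccp_dom[OF r rp])
  show "r p + ereal ((- (1 / a)) *\<^sub>R G \<bullet> (y - p)) \<le> r y"
  proof (cases "r y = \<infinity>")
    case False
    define d where "d = real_of_ereal (r y)"
    have d: "r y = ereal d" unfolding d_def by (rule ccp_dom[OF r False])
    have key: "0 \<le> a * (d - c) + G \<bullet> (y - p) + t * K y" if t: "0 < t" "t \<le> 1" for t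
    proof -
      define q where "q = (1 - t) *\<^sub>R p + t *\<^sub>R y"
      have rq: "r q \<le> ereal ((1 - t) * c + t * d)"
        unfolding q_def c_def d_def using t by (intro ccp_convex[OF r rp False]) auto
      then have "r q \<noteq> \<infinity>" by auto
      from ccp_dom[OF r this] obtain e where e: "r q = ereal e" by blast
      have "a * c + \<Psi> p \<le> a * e + \<Psi> q" using min[of q] by (simp add: c e)
      moreover have "e \<le> (1 - t) * c + t * d" using rq by (simp add: e)
      moreover have "\<Psi> q \<le> \<Psi> p + t * (G \<bullet> (y - p)) + t\<^sup>2 * K y" unfolding q_def using t by (intro \<Psi>) auto
      ultimately have "a * c + \<Psi> p \<le> a * ((1 - t) * c + t * d) + (\<Psi> p + t * (G \<bullet> (y - p)) + t\<^sup>2 * K y)"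
        using a mult_left_mono[of e "(1 - t) * c + t * d" a] by linarith
      then have "0 \<le> t * (a * (d - c) + G \<bullet> (y - p) + t * K y)"
        by (simp add: algebra_simps power2_eq_square)
      then show ?thesis using t by (simp add: zero_le_mult_iff)
    qed
    have "0 \<le> a * (d - c) + G \<bullet> (y - p)"
    proof (rule tendsto_lowerbound[where F = "at_right 0"])
      show "((\<lambda>t. a * (d - c) + G \<bullet> (y - p) + t * K y) \<longlongrightarrow> a * (d - c)
          + G \<bullet> (y - p)) (at_right 0)"
        by (auto intro!: tendsto_eq_intros)
      show "\<forall>\<^sub>F t in at_right 0. 0 \<le> a * (d - c) + G \<bullet> (y - p) + t * K y"
        using key by (intro eventually_at_rightI[of 0 1]) auto
    qed simp
    then have "c + - (1 / a) * (G \<bullet> (y - p)) \<le> d" using a by (simp add: field_simps)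
    then show ?thesis by (simp only: c d inner_scaleR_left plus_ereal.simps ereal_less_eq)
  qed simp
qed

text \<open>Minimise over the epigraph instead: there the objective is a continuous real function of
  (y, t) and the constraint is closed. The affine minorant bounds the sublevel sets.\<close>

lemma prox_exists:
  fixes r :: "'a::euclidean_space \<Rightarrow> ereal"
  assumes r: "closed_convex_proper r" and a: "0 < a" and minorant: "\<And>y. ereal (c + g \<bullet> y) \<le> r y"
  obtains p where "\<And>y. ereal a * r p + ereal ((norm (p - w))\<^sup>2 / 2) \<le> ereal a * r y + ereal ((norm (y - w))\<^sup>2 / 2)"
proof -
  define h where "h = (\<lambda>(y, t). a * t + (norm (y - w))\<^sup>2 / 2)"
  have cont: "continuous_on UNIV h" unfolding h_def case_prod_unfold by (intro continuous_intros) auto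
  from r obtain y0 where y0: "r y0 \<noteq> \<infinity>" by (auto simp: closed_convex_proper_def)
  define M where "M = h (y0, real_of_ereal (r y0))"
  define K where "K = epi r \<inter> {z. h z \<le> M}"
  have y0K: "(y0, real_of_ereal (r y0)) \<in> K"
    using ccp_dom[OF r y0] by (auto simp: K_def epi_def M_def)
  have "closed {z. h z \<le> M}"
    using cont by (intro closed_Collect_le) auto
  then have clK: "closed K" using r by (auto simp: K_def closed_convex_proper_def)
  \<comment> \<open>Completing the square in the sublevel inequality bounds the distance of y from
    \<open>w - a *\<^sub>R g\<close>.\<close>
  define B where "B = sqrt (2 * (M - a * (c + g \<bullet> w)) + a\<^sup>2 * (g \<bullet> g)) + norm (a *\<^sub>R g) + norm w"
  have yB: "norm y \<le> B \<and> c - norm g * B \<le> t \<and> t \<le> M / a" if "(y, t) \<in> K" for y t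
  proof -
    have "ereal (c + g \<bullet> y) \<le> ereal t"
      using that by (intro order_trans[OF minorant[of y]]) (simp add: K_def epi_def)
    then have t: "c + g \<bullet> y \<le> t" by simp
    have hM: "a * t + (norm (y - w))\<^sup>2 / 2 \<le> M" using that by (simp add: K_def h_def)
    have "a * (c + g \<bullet> y) \<le> a * t" using t a by (intro mult_left_mono) auto
    then have "(norm (y - w + a *\<^sub>R g))\<^sup>2 \<le> 2 * (M - a * (c + g \<bullet> w)) + a\<^sup>2 * (g \<bullet> g)"
      using hM unfolding power2_norm_eq_inner
      by (simp add: inner_add inner_diff inner_commute power2_eq_square algebra_simps) argo
    then have "norm (y - w + a *\<^sub>R g) \<le> sqrt (2 * (M - a * (c + g \<bullet> w)) + a\<^sup>2 * (g \<bullet> g))"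
      by (rule real_le_rsqrt)
    moreover have "norm y \<le> norm (y - w + a *\<^sub>R g) + norm (a *\<^sub>R g) + norm w"
      using norm_triangle_ineq4[of "y - w + a *\<^sub>R g" "a *\<^sub>R g"] norm_triangle_ineq[of "y - w" w] by simp
    ultimately have B: "norm y \<le> B" by (simp add: B_def)
    have "- (g \<bullet> y) \<le> norm g * norm y" using Cauchy_Schwarz_ineq2[of g y] by linarith
    also have "\<dots> \<le> norm g * B" using B by (intro mult_left_mono) auto
    finally have "c - norm g * B \<le> t" using t by linarith
    moreover have "a * t \<le> M" using hM zero_le_power2[of "norm (y - w)"] by linarith
    ultimately show ?thesis using B a by (simp add: field_simps)
  qed
  have "K \<subseteq> cball 0 B \<times> {c - norm g * B..M / a}" using yB by auto
  then have "bounded K" by (rule bounded_subset[rotated]) (intro bounded_Times bounded_cball bounded_closed_interval)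
  with clK have "compact K" by (simp add: compact_eq_bounded_closed)
  then obtain z where z: "z \<in> K" "\<And>z'. z' \<in> K \<Longrightarrow> h z \<le> h z'"
    using continuous_attains_inf[of K h] y0K continuous_on_subset[OF cont] by blast
  obtain p t where pt: "z = (p, t)" by (cases z)
  have rp: "r p \<le> ereal t" using z(1) by (simp add: pt K_def epi_def)
  then have "r p \<noteq> \<infinity>" by auto
  from ccp_dom[OF r this] obtain e where e: "r p = ereal e" by blast
  show thesis
  proof (rule that[of p])
    fix y
    show "ereal a * r p + ereal ((norm (p - w))\<^sup>2 / 2) \<le> ereal a * r y + ereal ((norm (y - w))\<^sup>2 / 2)"
    proof (cases "r y = \<infinity>")
      case True
      then show ?thesis using a by simp
    next
      case False
      from ccp_dom[OF r this] obtain d where d: "r y = ereal d" by blast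
      have "h z \<le> h (y, d)"
      proof (cases "h (y, d) \<le> M")
        case True
        then show ?thesis using d by (intro z) (auto simp: K_def epi_def)
      next
        case False
        then show ?thesis using z(1) by (auto simp: K_def)
      qed
      moreover have "h (p, e) \<le> h z" using rp a by (simp add: e pt h_def)
      ultimately show ?thesis by (simp add: d e h_def)
    qed
  qed
qed

lemma prox_minimizes:
  fixes r :: "'a::euclidean_space \<Rightarrow> ereal"
  assumes r: "closed_convex_proper r" and a: "0 < a" and minorant: "\<And>y. ereal (c + g \<bullet> y) \<le> r y"
  shows "ereal a * r (prox a r w) + ereal ((norm (prox a r w - w))\<^sup>2 / 2) \<le> ereal a * r y + ereal ((norm (y - w))\<^sup>2 / 2)"
proof -
  let ?f = "\<lambda>y. ereal a * r y + ereal ((norm (y - w))\<^sup>2 / 2)"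
  obtain p where "\<And>y. ?f p \<le> ?f y" using prox_exists[OF assms, where w = w] by blast
  then have "is_arg_min ?f (\<lambda>_. True) p" by (auto simp: is_arg_min_def not_less)
  then have "is_arg_min ?f (\<lambda>_. True) (prox a r w)" unfolding prox_def arg_min_def by (rule someI)
  then show ?thesis by (auto simp: is_arg_min_def not_less)
qed

lemma prox_subdiff:
  fixes r :: "'a::euclidean_space \<Rightarrow> ereal"
  assumes r: "closed_convex_proper r" and a: "0 < a" and minorant: "\<And>y. ereal (c + g \<bullet> y) \<le> r y"
  shows "(1 / a) *\<^sub>R (w - prox a r w) \<in> subdiff r (prox a r w)"
proof -
  let ?p = "prox a r w"
  have "(- (1 / a)) *\<^sub>R (?p - w) \<in> subdiff r ?p"
  proof (rule minimizer_subdiff[OF r a, where \<Psi> = "\<lambda>y. (norm (y - w))\<^sup>2 / 2" and K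
      = "\<lambda>y. (norm (y - ?p))\<^sup>2 / 2"])
    fix y :: 'a and t :: real
    have "(1 - t) *\<^sub>R ?p + t *\<^sub>R y - w = (?p - w) + t *\<^sub>R (y - ?p)" by (simp add: algebra_simps)
    then have "(norm ((1 - t) *\<^sub>R ?p + t *\<^sub>R y - w))\<^sup>2 = (norm (?p - w))\<^sup>2 + 2 * (t * ((?p
        - w) \<bullet> (y - ?p))) + t\<^sup>2 * (norm (y - ?p))\<^sup>2"
      unfolding power2_norm_eq_inner
      by (simp only: inner_add_left[of "?p - w"] inner_add_right[of _ "?p - w"] inner_scaleR_left inner_scaleR_right
          inner_commute[of "y - ?p" "?p - w"] power2_eq_square) (simp add: distrib_left)
    then show "(norm ((1 - t) *\<^sub>R ?p + t *\<^sub>R y - w))\<^sup>2 / 2 \<le> (norm (?p - w))\<^sup>2 / 2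
        + t * ((?p - w) \<bullet> (y - ?p)) + t\<^sup>2 * ((norm (y - ?p))\<^sup>2 / 2)"
      by simp
  qed (rule prox_minimizes[OF assms])
  then show ?thesis by (simp add: scaleR_diff_right)
qed

lemma prox_finite:
  fixes r :: "'a::euclidean_space \<Rightarrow> ereal"
  assumes r: "closed_convex_proper r" and a: "0 < a" and minorant: "\<And>y. ereal (c + g \<bullet> y) \<le> r y"
  shows "r (prox a r w) \<noteq> \<infinity>"
  by (rule minimizer_finite[OF r a, where \<Psi> = "\<lambda>y. (norm (y - w))\<^sup>2 / 2"]) (rule prox_minimizes[OF assms])

lemma subdiff_real:
  assumes r: "closed_convex_proper r" and "g \<in> subdiff r x" "r x \<noteq> \<infinity>" "r y \<noteq> \<infinity>"
  shows "real_of_ereal (r x) + g \<bullet> (y - x) \<le> real_of_ereal (r y)"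
proof -
  have "r x + ereal (g \<bullet> (y - x)) \<le> r y" using assms by (simp add: subdiff_def)
  then show ?thesis using ccp_dom[OF r assms(3)] ccp_dom[OF r assms(4)]
    by (metis ereal_less_eq(3) plus_ereal.simps(1))
qed

lemma closed_subdiff:
  fixes r :: "'a::euclidean_space \<Rightarrow> ereal"
  assumes r: "closed_convex_proper r" and x: "r x \<noteq> \<infinity>"
  shows "closed (subdiff r x)"
proof -
  have "closed {g. r x + ereal (g \<bullet> (y - x)) \<le> r y}" for y
  proof (cases "r y = \<infinity>")
    case False
    obtain c d where "r x = ereal c" "r y = ereal d" using ccp_dom[OF r] x False by metis
    then have "{g. r x + ereal (g \<bullet> (y - x)) \<le> r y} = {g. c + g \<bullet> (y - x) \<le> d}" by simp
    moreover have "closed {g. c + g \<bullet> (y - x) \<le> d}" by (intro closed_Collect_le continuous_intros)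
    ultimately show ?thesis by simp
  qed simp
  then show ?thesis unfolding subdiff_def Collect_all_eq by (intro closed_INT) auto
qed

text \<open>The minimum is attained at the projection of \<open>- G\<close> onto the closed set of
  subgradients. The given element keeps the real infimum from being one over the empty set.\<close>

lemma nearest_subgradient:
  fixes r :: "'a::euclidean_space \<Rightarrow> ereal"
  assumes r: "closed_convex_proper r" and x: "r x \<noteq> \<infinity>" and g: "g \<in> subdiff r x"
  shows "\<exists>g. is_arg_min (\<lambda>g. (norm (G + g))\<^sup>2) (\<lambda>g. g \<in> subdiff r x) g"
    and "(INF g\<in>subdiff r x. (norm (G + g))\<^sup>2) \<le> (norm (G + g))\<^sup>2"
    and "0 \<le> (INF g\<in>subdiff r x. (norm (G + g))\<^sup>2)"
proof -
  define p where "p = closest_point (subdiff r x) (- G)"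
  have ne: "subdiff r x \<noteq> {}" using g by auto
  note cl = closed_subdiff[OF r x]
  have p: "p \<in> subdiff r x" unfolding p_def by (rule closest_point_in_set[OF cl ne])
  have d: "dist (- G) q = norm (G + q)" for q
    using norm_minus_cancel[of "G + q"] by (simp add: dist_norm)
  have "(norm (G + p))\<^sup>2 \<le> (norm (G + q))\<^sup>2" if "q \<in> subdiff r x" for q
    using closest_point_le[OF cl that, of "- G"] unfolding p_def[symmetric] d by (intro power_mono) auto
  then have "is_arg_min (\<lambda>g. (norm (G + g))\<^sup>2) (\<lambda>g. g \<in> subdiff r x) p"
    using p by (auto simp: is_arg_min_def not_less)
  then show "\<exists>g. is_arg_min (\<lambda>g. (norm (G + g))\<^sup>2) (\<lambda>g. g \<in> subdiff r x) g" ..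
  show "(INF g\<in>subdiff r x. (norm (G + g))\<^sup>2) \<le> (norm (G + g))\<^sup>2"
    using g by (intro cINF_lower bdd_belowI[of _ 0]) auto
  show "0 \<le> (INF g\<in>subdiff r x. (norm (G + g))\<^sup>2)"
    using ne by (intro cINF_greatest) auto
qed

section \<open>Random reshuffling\<close>

locale composite =
  fixes n :: nat and f :: "nat \<Rightarrow> 'a::euclidean_space \<Rightarrow> real"
      and r :: "'a \<Rightarrow> ereal" and L \<alpha> :: real
    and xstar :: 'a and zstar :: "nat \<Rightarrow> 'a"
  assumes n: "n \<ge> 1" and L: "L > 0"
    and convex: "\<And>i. i \<in> {1..n} \<Longrightarrow> convex_on UNIV (f i)"
    and smooth: "\<And>i. i \<in> {1..n} \<Longrightarrow> smooth_fun L (f i)"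
    and r: "closed_convex_proper r" and \<alpha>: "0 < \<alpha>" "\<alpha> \<le> 2 / L"
    and xstar: "is_arg_min (\<lambda>y. ereal (avg_fun n f y) + r y) (\<lambda>_. True) xstar"
    and zstar: "\<And>i. i \<in> {1..n} \<Longrightarrow> zstar i = xstar - \<alpha> *\<^sub>R grad (f i) xstar"
begin

lemma gderiv: "i \<in> {1..n} \<Longrightarrow> GDERIV (f i) x :> grad (f i) x"
  using smooth by (intro grad_GDERIV) (simp add: smooth_fun_def)

lemma lipschitz: "i \<in> {1..n} \<Longrightarrow> L-lipschitz_on UNIV (grad (f i))"
  using smooth by (simp add: smooth_fun_def)

lemma grad_avg: "grad (avg_fun n f) x = (\<Sum>i=1..n. grad (f i) x) /\<^sub>R real n"
proof (rule grad_eqI)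
  have "((\<lambda>x. (\<Sum>i=1..n. f i x)) has_derivative (\<lambda>h. \<Sum>i=1..n. h \<bullet> grad (f i) x)) (at x)"
    using gderiv by (intro has_derivative_sum) (auto simp: gderiv_def)
  then have "((\<lambda>x. (\<Sum>i=1..n. f i x) / real n) has_derivative (\<lambda>h. (\<Sum>i=1..n. h \<bullet> grad (f i) x) / real n)) (at x)"
    by (rule bounded_linear.has_derivative[OF bounded_linear_divide])
  moreover have "(\<lambda>h. (\<Sum>i=1..n. h \<bullet> grad (f i) x) / real n)
      = (\<lambda>h. h \<bullet> ((\<Sum>i=1..n. grad (f i) x) /\<^sub>R real n))"
    by (simp add: inner_sum_right divide_inverse_commute)
  ultimately show "GDERIV (avg_fun n f) x :> (\<Sum>i=1..n. grad (f i) x) /\<^sub>R real n"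
    by (simp add: gderiv_def avg_fun_def[abs_def])
qed

lemma avg_descent:
  "avg_fun n f y \<le> avg_fun n f x + grad (avg_fun n f) x \<bullet> (y - x) + L / 2 * (norm (y - x))\<^sup>2"
proof -
  have "(\<Sum>i=1..n. f i y) \<le> (\<Sum>i=1..n. f i x + grad (f i) x \<bullet> (y - x) + L / 2 * (norm (y - x))\<^sup>2)"
    by (intro sum_mono descent_lemma gderiv lipschitz)
  also have "\<dots> = (\<Sum>i=1..n. f i x) + (\<Sum>i=1..n. grad (f i) x) \<bullet> (y - x) + real n * (L / 2 * (norm (y - x))\<^sup>2)"
    by (simp only: sum.distrib inner_sum_left sum_constant card_atLeastAtMost) simp
  finally have "(\<Sum>i=1..n. f i y) / real n \<le> ((\<Sum>i=1..n. f i x)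
      + (\<Sum>i=1..n. grad (f i) x) \<bullet> (y - x) + real n * (L / 2 * (norm (y - x))\<^sup>2)) / real n"
    by (intro divide_right_mono) auto
  then show ?thesis using n by (simp add: avg_fun_def grad_avg field_simps)
qed

lemma optimality: "- grad (avg_fun n f) xstar \<in> subdiff r xstar" and r_xstar: "r xstar \<noteq> \<infinity>"
proof -
  have min: "ereal 1 * r xstar + ereal (avg_fun n f xstar) \<le> ereal 1 * r y + ereal (avg_fun n f y)" for y
  proof -
    have "ereal (avg_fun n f xstar) + r xstar \<le> ereal (avg_fun n f y) + r y"
      using xstar by (simp add: is_arg_min_def not_less)
    then show ?thesis unfolding one_ereal_def[symmetric] mult_1 add.commute[of _ "ereal _"] .
  qed
  show "r xstar \<noteq> \<infinity>" using minimizer_finite[OF r _ min] by simp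
  have "(- (1 / 1)) *\<^sub>R grad (avg_fun n f) xstar \<in> subdiff r xstar"
  proof (rule minimizer_subdiff[OF r _ min])
    fix y and t :: real
    have "(1 - t) *\<^sub>R xstar + t *\<^sub>R y - xstar = t *\<^sub>R (y - xstar)" by (simp add: algebra_simps)
    then show "avg_fun n f ((1 - t) *\<^sub>R xstar + t *\<^sub>R y) \<le>
      avg_fun n f xstar + t * (grad (avg_fun n f) xstar \<bullet> (y - xstar)) + t\<^sup>2 * (L / 2 * (norm (y - xstar))\<^sup>2)"
      using avg_descent[of "(1 - t) *\<^sub>R xstar + t *\<^sub>R y" xstar] by (simp add: power_mult_distrib mult_ac)
  qed simp
  then show "- grad (avg_fun n f) xstar \<in> subdiff r xstar" by simp
qed

definition P where "P = prox \<alpha> r"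
definition R where "R x = \<alpha> * real_of_ereal (r x)"

text \<open>The subgradient inequality at \<open>xstar\<close>, which optimality provides, is
  affine. It supplies the coercivity behind the existence of the proximal points.\<close>

lemma minorant: "ereal (real_of_ereal (r xstar) + grad (avg_fun n f) xstar \<bullet> xstar
    + (- grad (avg_fun n f) xstar) \<bullet> y) \<le> r y"
proof -
  obtain c where c: "r xstar = ereal c" using ccp_dom[OF r r_xstar] by blast
  have "r xstar + ereal ((- grad (avg_fun n f) xstar) \<bullet> (y - xstar)) \<le> r y"
    using optimality by (simp add: subdiff_def)
  then show ?thesis by (simp add: c inner_diff_right algebra_simps)
qed

lemma P_subdiff: "(1 / \<alpha>) *\<^sub>R (w - P w) \<in> subdiff r (P w)"
  unfolding P_def by (rule prox_subdiff[OF r \<alpha>(1) minorant])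

lemma P_finite: "r (P w) \<noteq> \<infinity>"
  unfolding P_def by (rule prox_finite[OF r \<alpha>(1) minorant])

lemma scaled_subgradient:
  assumes "(1 / \<alpha>) *\<^sub>R g \<in> subdiff r x" "r x \<noteq> \<infinity>" "r y \<noteq> \<infinity>"
  shows "R x + g \<bullet> (y - x) \<le> R y"
proof -
  have "\<alpha> * (real_of_ereal (r x) + ((1 / \<alpha>) *\<^sub>R g) \<bullet> (y - x)) \<le> \<alpha> * real_of_ereal (r y)"
    using subdiff_real[OF r assms] \<alpha> by (intro mult_left_mono) auto
  then show ?thesis using \<alpha> by (simp add: R_def distrib_left)
qed

text \<open>The average of \<open>zstar\<close> minus \<open>xstar\<close> is
  \<open>\<alpha>\<close> times a subgradient at \<open>xstar\<close>, by optimality. Monotonicity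
  of the subdifferential then identifies \<open>xstar\<close> with the proximal point.\<close>

lemma P_zstar: "P ((\<Sum>i=1..n. zstar i) /\<^sub>R real n) = xstar"
proof -
  define w where "w = (\<Sum>i=1..n. zstar i) /\<^sub>R real n"
  have "(\<Sum>i=1..n. zstar i) = (\<Sum>i=1..n. xstar - \<alpha> *\<^sub>R grad (f i) xstar)" by (intro sum.cong) (auto simp: zstar)
  then have "w = xstar - \<alpha> *\<^sub>R grad (avg_fun n f) xstar"
    using n by (simp add: w_def grad_avg sum_subtractf sum_constant_scaleR scaleR_sum_right[symmetric] scaleR_diff_right)
  then have "(1 / \<alpha>) *\<^sub>R (w - xstar) \<in> subdiff r xstar" using optimality \<alpha> by simp
  then have "R xstar + (w - xstar) \<bullet> (P w - xstar) \<le> R (P w)"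
    by (rule scaled_subgradient[OF _ r_xstar P_finite])
  moreover have "R (P w) + (w - P w) \<bullet> (xstar - P w) \<le> R xstar"
    by (rule scaled_subgradient[OF P_subdiff P_finite r_xstar])
  moreover have "(w - xstar) \<bullet> (P w - xstar) + (w - P w) \<bullet> (xstar - P w) = (P w - xstar) \<bullet> (P w - xstar)"
    by (simp add: inner_diff inner_commute)
  ultimately have "(P w - xstar) \<bullet> (P w - xstar) \<le> 0" by linarith
  then show ?thesis unfolding w_def[symmetric] by (metis eq_iff_diff_eq_0 inner_eq_zero_iff inner_ge_zero order_antisym)
qed

sublocale finite_sum n "\<lambda>i x. \<alpha> * f i x" "\<lambda>i x. \<alpha> *\<^sub>R grad (f i) x" P R zstar xstar
proof
  fix i x y assume i: "i \<in> {1..n}"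
  define s where "s = (norm (grad (f i) y - grad (f i) x))\<^sup>2"
  \<comment> \<open>Here \<open>\<alpha> \<le> 2 / L\<close> becomes the coefficient 1/4 of the
    rescaled problem.\<close>
  have "\<alpha> / 4 * s \<le> s / (2 * L)"
  proof -
    have "\<alpha> * L \<le> 2" using \<alpha> L by (simp add: field_simps)
    then have "\<alpha> * L * s \<le> 2 * s" by (intro mult_right_mono) (auto simp: s_def)
    then show ?thesis using L by (simp add: field_simps)
  qed
  then have "f i x + grad (f i) x \<bullet> (y - x) + \<alpha> / 4 * s \<le> f i y"
    using cocoercive[OF convex[OF i] gderiv[OF i] lipschitz[OF i] L, of x y] unfolding s_def by linarith
  then have "\<alpha> * (f i x + grad (f i) x \<bullet> (y - x) + \<alpha> / 4 * s) \<le> \<alpha> * f i y"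
    using \<alpha> by (intro mult_left_mono) auto
  moreover have "(\<alpha> *\<^sub>R grad (f i) y - \<alpha> *\<^sub>R grad (f i) x) \<bullet> (\<alpha> *\<^sub>R grad (f i) y - \<alpha> *\<^sub>R grad (f i) x) = \<alpha> * \<alpha> * s"
    unfolding s_def power2_norm_eq_inner by (simp add: scaleR_diff_right[symmetric] del: scaleR_diff_right)
  ultimately show "\<alpha> * f i x + (\<alpha> *\<^sub>R grad (f i) x) \<bullet> (y - x)
      + 1 / 4 * ((\<alpha> *\<^sub>R grad (f i) y - \<alpha> *\<^sub>R grad (f i) x) \<bullet> (\<alpha> *\<^sub>R grad (f i) y - \<alpha> *\<^sub>R grad (f i) x)) \<le> \<alpha> * f i y"
    by (simp add: distrib_left)
next
  show "R (P w) + (w - P w) \<bullet> (P w' - P w) \<le> R (P w')" for w w'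
    by (rule scaled_subgradient[OF P_subdiff P_finite P_finite])
qed (use n zstar P_zstar in auto)

definition consistent where "consistent s \<longleftrightarrow> snd s = avg (fst s)"

text \<open>Injectivity of \<open>p\<close> is the point: an index is visited once, so the entry
  that a step replaces is still the one from the start of the epoch, which is what
  \<open>incr\<close> subtracts.\<close>

lemma inner_path:
  assumes p: "p \<in> S" and s: "consistent s" and "j \<le> n"
  shows "snd (dfinito_inner n \<alpha> r f p s j) = path p (fst s) j \<and>
    (\<forall>l<n. fst (dfinito_inner n \<alpha> r f p s j) (p (Suc l)) = fst s (p (Suc l)) + (if l < j then incr p (fst s) l else 0))"
  using \<open>j \<le> n\<close>
proof (induction j)
  case 0
  then show ?case using s by (simp add: consistent_def)
next
  case (Suc j)
  obtain z zb where zz: "dfinito_inner n \<alpha> r f p s j = (z, zb)" by fastforce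
  have zb: "zb = path p (fst s) j"
    and z: "l < n \<Longrightarrow> z (p (Suc l)) = fst s (p (Suc l)) + (if l < j then incr p (fst s) l else 0)" for l
    using Suc zz by auto
  have zj: "z (p (Suc j)) = fst s (p (Suc j))" using z[of j] Suc.prems by simp
  have inj: "p (Suc l) = p (Suc j) \<longleftrightarrow> l = j" for l
    using p permutes_inj[of p "{1..n}"] by (auto dest: injD)
  show ?case
    by (auto simp: zz dfinito_step_def Let_def zj zb z inj incr_def P_def[symmetric] less_Suc_eq)
qed

lemma epoch_step:
  fixes s s' :: "(nat \<Rightarrow> 'a) \<times> 'a"
  assumes p: "p \<in> S" and s: "consistent s" and s'_def: "s' = damp \<theta> s (dfinito_inner n \<alpha> r f p s n)"
  shows "epoch \<theta> p (fst s) (fst s')" and "consistent s'"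
proof -
  show e: "epoch \<theta> p (fst s) (fst s')"
    using inner_path[OF p s, of n] by (simp add: epoch_def s'_def damp_def algebra_simps)
  have "snd s' = path p (fst s) 0 + \<theta> *\<^sub>R (path p (fst s) n - path p (fst s) 0)"
    using inner_path[OF p s, of n] s by (simp add: s'_def damp_def consistent_def algebra_simps)
  then show "consistent s'" using avg_epoch[OF _ e] p by (simp add: consistent_def)
qed

lemma residual_eq:
  assumes "consistent s"
  shows "(norm (grad (avg_fun n f) (P (snd s)) + (1 / \<alpha>) *\<^sub>R (snd s - P (snd s))))\<^sup>2
      \<le> J (fst s) / (real n * \<alpha>\<^sup>2)"
proof -
  define w where "w = avg (fst s) - P (avg (fst s)) + avg (\<lambda>i. \<alpha> *\<^sub>R grad (f i) (P (avg (fst s))))"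
  have eq: "grad (avg_fun n f) (P (snd s)) + (1 / \<alpha>) *\<^sub>R (snd s - P (snd s)) = (1 / \<alpha>) *\<^sub>R w"
    using assms \<alpha> by (simp add: w_def consistent_def grad_avg avg_def[of "\<lambda>i. \<alpha> *\<^sub>R grad (f i) _"] scaleR_sum_right[symmetric] scaleR_add_right add.commute)
  have "(norm (grad (avg_fun n f) (P (snd s)) + (1 / \<alpha>) *\<^sub>R (snd s - P (snd s))))\<^sup>2 = (w \<bullet> w) / \<alpha>\<^sup>2"
    unfolding eq power2_norm_eq_inner by (simp add: power2_eq_square)
  also have "\<dots> \<le> (J (fst s) / real n) / \<alpha>\<^sup>2"
    using residual_le_J[of "fst s"] n unfolding w_def[symmetric] by (intro divide_right_mono) (auto simp: field_simps)
  finally show ?thesis by simp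
qed

end

section \<open>The expectation as an average over finite histories\<close>

definition histories :: "nat \<Rightarrow> nat \<Rightarrow> (nat \<Rightarrow> nat) list set" where
  "histories n k = {ps. set ps \<subseteq> {p. p permutes {1..n}} \<and> length ps = k}"

lemma finite_histories: "finite (histories n k)"
  unfolding histories_def by (intro finite_lists_length_eq finite_permutations) simp

lemma sum_histories_Suc:
  "(\<Sum>ps\<in>histories n (Suc k). g ps) = (\<Sum>ps\<in>histories n k. \<Sum>p | p permutes {1..n}. g (ps @ [p]))"
proof -
  have "(\<Sum>ps\<in>histories n k. \<Sum>p | p permutes {1..n}. g (ps @ [p])) = (\<Sum>(ps,
      p)\<in>histories n k \<times> {p. p permutes {1..n}}. g (ps @ [p]))"
    by (rule sum.cartesian_product)
  also have "\<dots> = (\<Sum>ps\<in>histories n (Suc k). g ps)"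
  proof (rule sum.reindex_bij_witness[where i = "\<lambda>ps. (butlast ps, last ps)" and j = "\<lambda>(ps, p). ps @ [p]"])
    fix ps assume "ps \<in> histories n (Suc k)"
    then have ps: "ps \<noteq> []" "length ps = Suc k" "set ps \<subseteq> {p. p permutes {1..n}}" by (auto simp: histories_def)
    then have "last ps \<in> {p. p permutes {1..n}}" using last_in_set[of ps] by blast
    with ps show "(butlast ps, last ps) \<in> histories n k \<times> {p. p permutes {1..n}}"
      "(case (butlast ps, last ps) of (ps, p) \<Rightarrow> ps @ [p]) = ps"
      by (auto simp: histories_def dest: in_set_butlastD)
  qed (auto simp: histories_def)
  finally show ?thesis ..
qed

text \<open>The first k permutations take finitely many joint values, by independence all with the
  same probability. Hence integrability is automatic and the expectation is a finite
  average.\<close>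

lemma reshuffling_history:
  fixes g :: "(nat \<Rightarrow> nat) list \<Rightarrow> real"
  assumes rr: "random_reshuffling M n \<tau>"
  shows "integrable M (\<lambda>\<omega>. g (map (\<lambda>i. \<tau> i \<omega>) [0..<k]))"
    and "(\<integral>\<omega>. g (map (\<lambda>i. \<tau> i \<omega>) [0..<k]) \<partial>M)
        = (\<Sum>ps\<in>histories n k. g ps) / fact n ^ k"
proof -
  let ?S = "{p. p permutes {1..n}}"
  interpret prob_space M using rr by (simp add: random_reshuffling_def)
  have ind: "indep_vars (\<lambda>_. count_space ?S) \<tau> UNIV"
    and d: "distr M (count_space ?S) (\<tau> k) = uniform_count_measure ?S" for k
    using rr by (simp_all add: random_reshuffling_def)
  have m: "\<tau> k \<in> measurable M (count_space ?S)" for k using ind by (simp add: indep_vars_def)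
  have fin: "finite ?S" by (intro finite_permutations) simp
  have card: "card ?S = fact n" using card_permutations[of "{1..n}" n] by simp
  have one: "prob (\<tau> k -` {p} \<inter> space M) = 1 / fact n" if "p \<in> ?S" for k p
  proof -
    have "prob (\<tau> k -` {p} \<inter> space M) = measure (distr M (count_space ?S) (\<tau> k)) {p}"
      using that by (intro measure_distr[symmetric] m) auto
    also have "\<dots> = 1 / fact n"
      unfolding d using that fin by (simp add: measure_uniform_count_measure card[simplified])
    finally show ?thesis .
  qed
  let ?h = "\<lambda>\<omega>. map (\<lambda>i. \<tau> i \<omega>) [0..<k]"
  define Ev where "Ev ps = {\<omega>\<in>space M. ?h \<omega> = ps}" for ps
  have Ev: "Ev ps \<in> events \<and> prob (Ev ps) = 1 / fact n ^ k" if ps: "ps \<in> histories n k" for ps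
  proof (cases "k = 0")
    \<comment> \<open>Treated separately because an intersection over no indices is the universe of
      the type rather than \<open>space M\<close>.\<close>
    case True
    then have "Ev ps = space M" using ps by (auto simp: Ev_def histories_def)
    then show ?thesis using True by (simp add: prob_space)
  next
    case False
    have len: "length ps = k" and el: "\<And>i. i < k \<Longrightarrow> ps ! i \<in> ?S" using ps nth_mem by (auto simp: histories_def)
    have eq: "Ev ps = (\<Inter>i\<in>{..<k}. \<tau> i -` {ps ! i} \<inter> space M)"
      using False len by (auto simp: Ev_def list_eq_iff_nth_eq)
    have "prob (Ev ps) = (\<Prod>i\<in>{..<k}. prob (\<tau> i -` {ps ! i} \<inter> space M))"
      unfolding eq using False el by (intro indep_varsD[OF ind]) auto
    also have "\<dots> = (\<Prod>i\<in>{..<k}. 1 / fact n)" by (intro prod.cong refl one el) auto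
    also have "\<dots> = 1 / fact n ^ k" by (simp add: power_divide)
    finally have "prob (Ev ps) = 1 / fact n ^ k" .
    moreover have "Ev ps \<in> events"
      unfolding eq using False el by (intro sets.finite_INT measurable_sets[OF m]) auto
    ultimately show ?thesis by simp
  qed
  have hS: "?h \<omega> \<in> histories n k" if "\<omega> \<in> space M" for \<omega>
    using measurable_space[OF m that] by (auto simp: histories_def)
  have eq: "g (?h \<omega>) = (\<Sum>ps\<in>histories n k. g ps * indicator (Ev ps) \<omega>)" if "\<omega> \<in> space M" for \<omega>
  proof -
    have "(\<Sum>ps\<in>histories n k. g ps * indicator (Ev ps) \<omega>)
        = (\<Sum>ps\<in>histories n k. if ?h \<omega> = ps then g ps else 0)"
      using that by (intro sum.cong) (auto simp: Ev_def)
    also have "\<dots> = g (?h \<omega>)" using hS[OF that] finite_histories by simp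
    finally show ?thesis ..
  qed
  have int: "integrable M (\<lambda>\<omega>. \<Sum>ps\<in>histories n k. g ps * indicator (Ev ps) \<omega>)"
    using Ev by (intro Bochner_Integration.integrable_sum integrable_mult_right integrable_real_indicator) (auto simp: emeasure_eq_measure)
  show "integrable M (\<lambda>\<omega>. g (?h \<omega>))"
    using int by (rule Bochner_Integration.integrable_cong[THEN iffD1, rotated 2]) (auto simp: eq)
  have "(\<integral>\<omega>. g (?h \<omega>) \<partial>M) = (\<integral>\<omega>. (\<Sum>ps\<in>histories n k. g ps * indicator (Ev ps) \<omega>) \<partial>M)"
    by (intro Bochner_Integration.integral_cong refl eq)
  also have "\<dots> = (\<Sum>ps\<in>histories n k. \<integral>\<omega>. g ps * indicator (Ev ps) \<omega> \<partial>M)"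
    using Ev by (intro Bochner_Integration.integral_sum integrable_mult_right integrable_real_indicator) (auto simp: emeasure_eq_measure)
  also have "\<dots> = (\<Sum>ps\<in>histories n k. g ps / fact n ^ k)"
    using Ev sets.sets_into_space by (intro sum.cong refl) (auto simp: Int_absorb2)
  finally show "(\<integral>\<omega>. g (?h \<omega>) \<partial>M) = (\<Sum>ps\<in>histories n k. g ps) / fact n ^ k"
    by (simp add: sum_divide_distrib)
qed

lemma dfinito_epoch_cong:
  "(\<And>i. i < k \<Longrightarrow> \<sigma> i = \<sigma>' i) \<Longrightarrow> dfinito_epoch n \<alpha> \<theta> r f z0 \<sigma> k = dfinito_epoch n \<alpha> \<theta> r f z0 \<sigma>' k"
  by (induction k) auto

context composite
begin

text \<open>A history \<open>ps\<close> lists the permutations of the completed epochs; \<open>nth ps\<close> is unspecified beyond its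
  length, where \<open>dfinito_epoch\<close> does not look.\<close>

definition state where "state \<theta> z0 ps = dfinito_epoch n \<alpha> \<theta> r f z0 (nth ps) (length ps)"

lemma state_snoc: "state \<theta> z0 (ps @ [p]) = damp \<theta> (state \<theta> z0 ps) (dfinito_inner n \<alpha> r f p (state \<theta> z0 ps) n)"
proof -
  have "dfinito_epoch n \<alpha> \<theta> r f z0 (nth (ps @ [p])) (length ps) = state \<theta> z0 ps"
    unfolding state_def by (rule dfinito_epoch_cong) (simp add: nth_append)
  then show ?thesis by (simp add: state_def Let_def)
qed

lemma consistent_state: "ps \<in> histories n k \<Longrightarrow> consistent (state \<theta> z0 ps)"
proof (induction ps arbitrary: k rule: rev_induct)
  case Nil
  then show ?case by (simp add: state_def consistent_def avg_def)
next
  case (snoc p ps)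
  then have "ps \<in> histories n (length ps)" "p \<in> S" by (auto simp: histories_def)
  then show ?case unfolding state_snoc using snoc.IH by (intro epoch_step(2)[OF _ _ refl]) auto
qed

text \<open>Summed over all histories, the supermartingale inequality telescopes down to
  \<open>V z0\<close>; the lower bound on \<open>W\<close> then isolates \<open>J\<close>.\<close>

lemma expected_residual:
  assumes th: "0 < \<theta>" "\<theta> < 1"
  shows "36 / 100 * (\<theta> * (1 - \<theta>)) * (real k + 1) * (\<Sum>ps\<in>histories n k. J (fst (state \<theta> z0 ps))) \<le> fact n ^ k * V z0"
proof -
  obtain W where W: "\<And>z. W 0 z = V z"
    "\<And>k z nx. (\<And>p. p \<in> S \<Longrightarrow> epoch \<theta> p z (nx p)) \<Longrightarrow> (\<Sum>p\<in>S. W (Suc k) (nx p)) \<le> fact n * W k z"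
    "\<And>k z. 36 / 100 * (\<theta> * (1 - \<theta>)) * (real k + 1) * J z \<le> W k z"
    using lyapunov[OF th] by blast
  have "(\<Sum>ps\<in>histories n k. W k (fst (state \<theta> z0 ps))) \<le> fact n ^ k * V z0"
  proof (induction k)
    case 0
    have "histories n 0 = {[]}" by (auto simp: histories_def)
    then show ?case by (simp add: state_def W)
  next
    case (Suc k)
    have "(\<Sum>ps\<in>histories n (Suc k). W (Suc k) (fst (state \<theta> z0 ps))) =
      (\<Sum>ps\<in>histories n k. \<Sum>p\<in>S. W (Suc k) (fst (state \<theta> z0 (ps @ [p]))))"
      by (rule sum_histories_Suc)
    also have "\<dots> \<le> (\<Sum>ps\<in>histories n k. fact n * W k (fst (state \<theta> z0 ps)))"
      by (intro sum_mono W) (auto simp: state_snoc intro!: epoch_step(1)[OF _ _ refl] consistent_state)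
    also have "\<dots> \<le> fact n * (fact n ^ k * V z0)"
      unfolding sum_distrib_left[symmetric] by (intro mult_left_mono Suc) auto
    finally show ?case by (simp add: mult.assoc)
  qed
  moreover have "(\<Sum>ps\<in>histories n k. 36 / 100 * (\<theta> * (1 - \<theta>)) * (real k + 1) * J (fst (state \<theta> z0 ps)))
     \<le> (\<Sum>ps\<in>histories n k. W k (fst (state \<theta> z0 ps)))" by (intro sum_mono W)
  ultimately show ?thesis by (simp only: sum_distrib_left[symmetric])
qed

end

theorem theorem2:
  fixes n :: nat
    and f :: "nat \<Rightarrow> real ^ 'd \<Rightarrow> real"
    and r :: "real ^ 'd \<Rightarrow> ereal"
    and L \<alpha> \<theta> C :: real
    and z0 zstar :: "nat \<Rightarrow> real ^ 'd"
    and xstar :: "real ^ 'd"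
    and M :: "'w measure"
    and \<tau> :: "nat \<Rightarrow> 'w \<Rightarrow> nat \<Rightarrow> nat"
    and F :: "real ^ 'd \<Rightarrow> real"
    and x :: "nat \<Rightarrow> 'w \<Rightarrow> real ^ 'd"
  assumes "n \<ge> 1" and "L > 0"
    and "\<And>i. i \<in> {1..n} \<Longrightarrow> convex_on UNIV (f i)"
    and "\<And>i. i \<in> {1..n} \<Longrightarrow> smooth_fun L (f i)"
    and "closed_convex_proper r"
    and "0 < \<alpha>" and "\<alpha> \<le> 2 / L"
    and "0 < \<theta>" and "\<theta> < 1"
    and F_eq: "F = avg_fun n f"
    and xstar: "is_arg_min (\<lambda>y. ereal (F y) + r y) (\<lambda>_. True) xstar"
    and zstar_eq: "\<And>i. i \<in> {1..n} \<Longrightarrow> zstar i = xstar - \<alpha> *\<^sub>R grad (f i) xstar"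
    and "random_reshuffling M n \<tau>"
    and x_eq: "\<And>t \<omega>. x t \<omega> = prox_dfinito n \<alpha> \<theta> r f z0 (\<lambda>k. \<tau> k \<omega>) t"
    and C_eq: "C = (5 / (3 * \<alpha> * L))\<^sup>2 * (1 / real n) *
                 (L2_set (\<lambda>i. norm (z0 i - zstar i)) {1..n})\<^sup>2"
  shows "\<forall>k.
    (\<forall>\<omega>\<in>space M. \<exists>g. is_arg_min (\<lambda>g. (norm (grad F (x (k * n) \<omega>) + g))\<^sup>2)
                                (\<lambda>g. g \<in> subdiff r (x (k * n) \<omega>)) g) \<and>
    integrable M (\<lambda>\<omega>. INF g\<in>subdiff r (x (k * n) \<omega>). (norm (grad F (x (k * n) \<omega>) + g))\<^sup>2) \<and>
    (\<integral>\<omega>. (INF g\<in>subdiff r (x (k * n) \<omega>). (norm (grad F (x (k * n) \<omega>) + g))\<^sup>2) \<partial>M)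
      \<le> C * L\<^sup>2 / ((real k + 1) * \<theta> * (1 - \<theta>))"
proof (intro allI)
  fix k
  interpret composite n f r L \<alpha> xstar zstar
    using assms(1-7) xstar[unfolded F_eq] zstar_eq by unfold_locales
  note rr = \<open>random_reshuffling M n \<tau>\<close>
  define y where "y ps = P (snd (state \<theta> z0 ps))" for ps
  define G where "G ps = (INF g\<in>subdiff r (y ps). (norm (grad F (y ps) + g))\<^sup>2)" for ps
  \<comment> \<open>At time k n the inner loop of epoch k has made no step, so the point is the
    proximal point of the damped average and depends on the first k permutations only.\<close>
  have xk: "x (k * n) \<omega> = y (map (\<lambda>i. \<tau> i \<omega>) [0..<k])" for \<omega>
  proof -
    have "dfinito_epoch n \<alpha> \<theta> r f z0 (\<lambda>k. \<tau> k \<omega>) k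
        = state \<theta> z0 (map (\<lambda>i. \<tau> i \<omega>) [0..<k])"
      unfolding state_def by (simp, rule dfinito_epoch_cong) simp
    then show ?thesis using \<open>n \<ge> 1\<close> by (simp add: x_eq prox_dfinito_def y_def P_def)
  qed
  \<comment> \<open>The competitor in the minimum: the subgradient that the proximal map itself
    produces.\<close>
  have sub: "(1 / \<alpha>) *\<^sub>R (snd (state \<theta> z0 ps) - y ps) \<in> subdiff r (y ps)" for ps
    unfolding y_def by (rule P_subdiff)
  have yfin: "r (y ps) \<noteq> \<infinity>" for ps unfolding y_def by (rule P_finite)
  note near = nearest_subgradient[OF \<open>closed_convex_proper r\<close> yfin sub]
  have G: "G ps \<le> J (fst (state \<theta> z0 ps)) / (real n * \<alpha>\<^sup>2)" if "ps \<in> histories n k" for ps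
    using near(2)[of "grad F (y ps)" ps] residual_eq[OF consistent_state[OF that, of \<theta> z0]]
    unfolding G_def F_eq by (simp add: y_def)
  have "(\<Sum>ps\<in>histories n k. G ps) \<le> (\<Sum>ps\<in>histories n k. J (fst (state \<theta> z0 ps))) / (real n * \<alpha>\<^sup>2)"
    unfolding sum_divide_distrib by (intro sum_mono G)
  also have "\<dots> \<le> (fact n ^ k * V z0 / (36 / 100 * (\<theta> * (1 - \<theta>)) * (real k + 1))) / (real n * \<alpha>\<^sup>2)"
  proof (intro divide_right_mono)
    have "0 < 36 / 100 * (\<theta> * (1 - \<theta>)) * (real k + 1)" using \<open>0 < \<theta>\<close> \<open>\<theta> < 1\<close> by simp
    then show "(\<Sum>ps\<in>histories n k. J (fst (state \<theta> z0 ps)))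
        \<le> fact n ^ k * V z0 / (36 / 100 * (\<theta> * (1 - \<theta>)) * (real k + 1))"
      using expected_residual[OF \<open>0 < \<theta>\<close> \<open>\<theta> < 1\<close>, of k z0]
          by (subst pos_le_divide_eq) (simp_all add: mult.commute)
  qed simp
  finally have "(\<Sum>ps\<in>histories n k. G ps) / fact n ^ k \<le>
    (fact n ^ k * V z0 / (36 / 100 * (\<theta> * (1 - \<theta>)) * (real k + 1))) / (real n * \<alpha>\<^sup>2) / fact n ^ k"
    by (intro divide_right_mono) auto
  also have "\<dots> = V z0 / (36 / 100 * (\<theta> * (1 - \<theta>)) * (real k + 1)) / (real n * \<alpha>\<^sup>2)" by simp
  also have "V z0 = (L2_set (\<lambda>i. norm (z0 i - zstar i)) {1..n})\<^sup>2"
    by (simp add: V_def L2_set_def sum_nonneg power2_norm_eq_inner)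
  \<comment> \<open>36/100 = (3/5)^2 is the origin of the factor 5/3 in \<open>C\<close>, and the
    square of \<open>L\<close> cancels against the one in \<open>C\<close>.\<close>
  also have "\<dots> / (36 / 100 * (\<theta> * (1 - \<theta>)) * (real k + 1)) / (real n * \<alpha>\<^sup>2)
      = C * L\<^sup>2 / ((real k + 1) * \<theta> * (1 - \<theta>))"
    using \<open>L > 0\<close> unfolding C_eq by (simp add: power_divide power_mult_distrib mult_ac)
  finally have "(\<integral>\<omega>. G (map (\<lambda>i. \<tau> i \<omega>) [0..<k]) \<partial>M)
      \<le> C * L\<^sup>2 / ((real k + 1) * \<theta> * (1 - \<theta>))"
    unfolding reshuffling_history(2)[OF rr] .
  moreover have "integrable M (\<lambda>\<omega>. G (map (\<lambda>i. \<tau> i \<omega>) [0..<k]))" by (rule reshuffling_history(1)[OF rr])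
  ultimately show "(\<forall>\<omega>\<in>space M. \<exists>g. is_arg_min (\<lambda>g. (norm (grad F (x (k * n) \<omega>) + g))\<^sup>2)
                                (\<lambda>g. g \<in> subdiff r (x (k * n) \<omega>)) g) \<and>
    integrable M (\<lambda>\<omega>. INF g\<in>subdiff r (x (k * n) \<omega>). (norm (grad F (x (k * n) \<omega>) + g))\<^sup>2) \<and>
    (\<integral>\<omega>. (INF g\<in>subdiff r (x (k * n) \<omega>). (norm (grad F (x (k * n) \<omega>) + g))\<^sup>2) \<partial>M)
      \<le> C * L\<^sup>2 / ((real k + 1) * \<theta> * (1 - \<theta>))"
    using near(1) unfolding G_def xk by blast
qed

end
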